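(* Let $a_0\in\mathbb R$, $\dot a_0\in\,]-1,1[$, and let $b_0\in C^1([T^-,T^+],\,]-\infty,a_0[)$, where $T^{\pm}=\pm(a_0-b_0(T^{\pm}))$ and $\|\dot b_0\|_\infty<1$. Then the following holds. (a) There is at least one pair of trajectories $a\in C^2(\mathbb R_0^+)$ and $b\in C^1([T^-,\infty[)\cap C^2(]T^+,\infty[)$ such that $$\frac{d}{dt}\left(\frac{\dot a(t)}{\sqrt{1-\dot a(t)^2}}\right)=\frac{\kappa_a}{2}\left[\frac{\rho(\dot b(t_2^-))}{(a(t)-b(t_2^-))^2}+\frac{\sigma(\dot b(t_2^+))}{(a(t)-b(t_2^+))^2}\right]\quad\text{for all }t\ge 0,$$ $$\frac{d}{dt}\left(\frac{\dot b(t)}{\sqrt{1-\dot b(t)^2}}\right)=-\frac{\kappa_b}{2}\left[\frac{\sigma(\dot a(t_1^-))}{(b(t)-a(t_1^-))^2}+\frac{\rho(\dot a(t_1^+))}{(b(t)-a(t_1^+))^2}\right]\quad\text{for all }t\ge T^+,$$ where $t_i^\pm=t_i^\pm(a,b,t)$, and furthermore $a(0)=a_0$, $\dot a(0)=\dot a_0$, $b|_{[T^-,T^+]}=b_0$. (b) If $b_0\in C^{1+n}$ for some $n\in\mathbb N_0$, then the regularity of any solution $(a,b)$ as in (a) is characterized as follows. Let $\sigma_0:=0$, $\tau_0:=T^+$, $\sigma_1:=t_1^+(a,b,T^+)$, $\tau_1:=t_2^+(a,b,\sigma_1)$, and $\sigma_{k+1}:=t_1^+(a,b,\tau_k)$,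 $\tau_{k+1}:=t_2^+(a,b,\sigma_{k+1})$. Then $a$ is $2k$ times differentiable at $\sigma_k$ for every $k\in\mathbb N$, $b$ is $2k+1$ times differentiable at $\tau_k$ for every $k\in\mathbb N_0$, and $a|_{]\sigma_k,\sigma_{k+1}[}\in C^{2+n+2k}$ and $b|_{]\tau_k,\tau_{k+1}[}\in C^{3+n+2k}$ for every $k\in\mathbb N_0$.
   Context: Two like charges (charges $e_a,e_b$ of equal sign, masses $m_a,m_b>0$) move on a straight line; $\kappa_a=e_ae_b/m_a>0$ and $\kappa_b=e_ae_b/m_b>0$ are fixed coupling constants. The speed of light is $1$. Set $\rho(v)=\frac{1+v}{1-v}$, $\sigma(v)=\frac{1-v}{1+v}$ for $v\in\,]-1,1[$ (the function $\sigma$ is not to be confused with the times $\sigma_k$ in (b)). For trajectories $a,b$, the advanced ($+$) and retarded ($-$) times are defined implicitly by $$t_1^\pm(a,b,t)=t\pm|a(t_1^\pm(a,b,t))-b(t)|,\qquad t_2^\pm(a,b,t)=t\pm|a(t)-b(t_2^\pm(a,b,t))|.$$ That a pair $(a,b)$ satisfies the equations includes that $|\dot a|,|\dot b|<1$ pointwise, that the delayed times appearing exist in the domains of the trajectories, and that the denominators do not vanish. $C^n(D,E)$ is the set of $n$ times continuously differentiable functions on $D$ with values in $E$; derivatives at boundary points are one-sided, and at $t=T^+$ the second-order derivative in the equation for $b$ is the right-sided one. $\mathbb R_0^+=[0,\infty[$, $\mathbb N=\{1,2,\dots\}$, $\mathbb N_0=\{0,1,2,\dots\}$. *)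

theory Defs
  imports "HOL-Analysis.Analysis"
begin

(* Derivatives are taken within the domain, hence are one-sided at boundary points. *)
primrec Ck_on :: "nat \<Rightarrow> (real \<Rightarrow> real) \<Rightarrow> real set \<Rightarrow> bool" where
  "Ck_on 0 f D \<longleftrightarrow> continuous_on D f"
| "Ck_on (Suc n) f D \<longleftrightarrow>
     (\<exists>g. (\<forall>t\<in>D. (f has_real_derivative g t) (at t within D)) \<and> Ck_on n g D)"

(* Pointwise k-fold differentiability: the derivatives of order below k exist near t, and the one
   of order k - 1 is differentiable at t. Only used at interior points of the domain of f. *)
definition times_differentiable_at :: "nat \<Rightarrow> (real \<Rightarrow> real) \<Rightarrow> real \<Rightarrow> bool" where
  "times_differentiable_at k f t \<longleftrightarrow>
     (\<forall>j. Suc j < k \<longrightarrow> (\<forall>\<^sub>F s in nhds t. (deriv ^^ j) f differentiable (at s))) \<and>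
     (\<forall>j. Suc j = k \<longrightarrow> (deriv ^^ j) f differentiable (at t))"

abbreviation velocity :: "real set \<Rightarrow> (real \<Rightarrow> real) \<Rightarrow> real \<Rightarrow> real" where
  "velocity D f t \<equiv> vector_derivative f (at t within D)"

definition rho :: "real \<Rightarrow> real" where
  "rho v = (1 + v) / (1 - v)"

definition sig :: "real \<Rightarrow> real" where
  "sig v = (1 - v) / (1 + v)"

(* Delayed times: \<epsilon> = 1 is the advanced, \<epsilon> = -1 the retarded one. The trajectory a lives on
   [0,\<infinity>[, the trajectory b on [Tm,\<infinity>[. As these trajectories are slower than light, the implicit
   equations have at most one solution, so that THE picks it whenever there is one. *)
definition is_t1 :: "real \<Rightarrow> (real \<Rightarrow> real) \<Rightarrow> (real \<Rightarrow> real) \<Rightarrow> real \<Rightarrow> real \<Rightarrow> bool" where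
  "is_t1 \<epsilon> a b t s \<longleftrightarrow> s \<ge> 0 \<and> s = t + \<epsilon> * \<bar>a s - b t\<bar>"

definition is_t2 :: "real \<Rightarrow> real \<Rightarrow> (real \<Rightarrow> real) \<Rightarrow> (real \<Rightarrow> real) \<Rightarrow> real \<Rightarrow> real \<Rightarrow> bool" where
  "is_t2 Tm \<epsilon> a b t s \<longleftrightarrow> s \<ge> Tm \<and> s = t + \<epsilon> * \<bar>a t - b s\<bar>"

definition t1 :: "real \<Rightarrow> (real \<Rightarrow> real) \<Rightarrow> (real \<Rightarrow> real) \<Rightarrow> real \<Rightarrow> real" where
  "t1 \<epsilon> a b t = (THE s. is_t1 \<epsilon> a b t s)"

definition t2 :: "real \<Rightarrow> real \<Rightarrow> (real \<Rightarrow> real) \<Rightarrow> (real \<Rightarrow> real) \<Rightarrow> real \<Rightarrow> real" where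
  "t2 Tm \<epsilon> a b t = (THE s. is_t2 Tm \<epsilon> a b t s)"

(* The derivative within {Tp..} in the equation for b is the right-sided one at Tp and the
   two-sided one afterwards. *)
definition solves_equations ::
    "real \<Rightarrow> real \<Rightarrow> real \<Rightarrow> real \<Rightarrow> (real \<Rightarrow> real) \<Rightarrow> (real \<Rightarrow> real) \<Rightarrow> bool" where
  "solves_equations \<kappa>a \<kappa>b Tm Tp a b \<longleftrightarrow>
     (let va = velocity {0..} a; vb = velocity {Tm..} b in
      (\<forall>t\<ge>0. \<bar>va t\<bar> < 1) \<and> (\<forall>t\<ge>Tm. \<bar>vb t\<bar> < 1) \<and>
      (\<forall>t\<ge>0. \<forall>\<epsilon>\<in>{1, -1}. (\<exists>s. is_t2 Tm \<epsilon> a b t s) \<and> a t \<noteq> b (t2 Tm \<epsilon> a b t)) \<and>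
      (\<forall>t\<ge>Tp. \<forall>\<epsilon>\<in>{1, -1}. (\<exists>s. is_t1 \<epsilon> a b t s) \<and> b t \<noteq> a (t1 \<epsilon> a b t)) \<and>
      (\<forall>t\<ge>0. ((\<lambda>s. va s / sqrt (1 - (va s)\<^sup>2)) has_real_derivative
         \<kappa>a / 2 * (rho (vb (t2 Tm (-1) a b t)) / (a t - b (t2 Tm (-1) a b t))\<^sup>2
                 + sig (vb (t2 Tm 1 a b t)) / (a t - b (t2 Tm 1 a b t))\<^sup>2)) (at t within {0..})) \<and>
      (\<forall>t\<ge>Tp. ((\<lambda>s. vb s / sqrt (1 - (vb s)\<^sup>2)) has_real_derivative
         - (\<kappa>b / 2) * (sig (va (t1 (-1) a b t)) / (b t - a (t1 (-1) a b t))\<^sup>2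
                     + rho (va (t1 1 a b t)) / (b t - a (t1 1 a b t))\<^sup>2)) (at t within {Tp..})))"

definition is_solution ::
    "real \<Rightarrow> real \<Rightarrow> real \<Rightarrow> real \<Rightarrow> real \<Rightarrow> real \<Rightarrow> (real \<Rightarrow> real) \<Rightarrow> (real \<Rightarrow> real) \<Rightarrow> (real \<Rightarrow> real) \<Rightarrow> bool" where
  "is_solution \<kappa>a \<kappa>b a0 va0 Tm Tp b0 a b \<longleftrightarrow>
     Ck_on 2 a {0..} \<and> Ck_on 1 b {Tm..} \<and> Ck_on 2 b {Tp<..} \<and>
     solves_equations \<kappa>a \<kappa>b Tm Tp a b \<and>
     a 0 = a0 \<and> velocity {0..} a 0 = va0 \<and> (\<forall>t\<in>{Tm..Tp}. b t = b0 t)"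

fun sigma_seq tau_seq ::
    "real \<Rightarrow> real \<Rightarrow> (real \<Rightarrow> real) \<Rightarrow> (real \<Rightarrow> real) \<Rightarrow> nat \<Rightarrow> real" where
  "sigma_seq Tm Tp a b 0 = 0"
| "sigma_seq Tm Tp a b (Suc k) = t1 1 a b (tau_seq Tm Tp a b k)"
| "tau_seq Tm Tp a b 0 = Tp"
| "tau_seq Tm Tp a b (Suc k) = t2 Tm 1 a b (sigma_seq Tm Tp a b (Suc k))"

end

theory Submission
  imports Defs "HOL-Complex_Analysis.Great_Picard"
begin

text \<open>
  Existence.  Clamp the momenta to \<open>[-M, M]\<close> in the velocities and cut off the distances below \<open>\<delta>\<close>
  in the forces.  The regularized system is the fixed point equation of an integral operator mapping
  Lipschitz functions to Lipschitz functions, which Schauder's theorem solves on the whole half line.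
  Its solutions obey bounds that do not depend on \<open>M\<close> and \<open>\<delta>\<close>: since the forces are repulsive, \<open>a\<close>
  speeds up and \<open>b\<close> slows down, so while the particles approach each other their velocities are
  controlled by the data, and the impulse of the retarded force, of order \<open>1 / d\<^sup>2\<close>, keeps the distance
  \<open>d\<close> away from zero.  In the same way the relative velocity exceeds a positive constant after a fixed
  time, so \<open>d\<close> grows linearly.  The singular factor \<open>1 / (1 + vb)\<close> of the advanced force is, up to
  bounded terms, the derivative of the advanced time; with \<open>d\<close> growing linearly the impulse is then
  dominated by an increment of the arc tangent.  Hence for large \<open>M\<close> and small \<open>\<delta>\<close> the
  regularization is inactive.

  Regularity.  The velocity of a particle gains one derivative over the velocities that occur in its
  force; this is iterated along the zigzag of light rays through the points \<open>\<sigma> k\<close> and \<open>\<tau> k\<close>.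
\<close>

section \<open>Schauder's theorem for Lipschitz functions on the line\<close>

text \<open>Advanced arguments make the system non-causal: the force at a given time refers to a
  later state, so the data cannot be continued step by step and the fixed point is sought on the
  whole half line at once. Functions with a common Lipschitz constant that vanish at 0 form a convex
  set, compact for pointwise convergence, so sequences replace a topology on a function space. The
  regularization keeps the operator inside this set, since \<open>rho\<close> and \<open>sig\<close>
  blow up at the speed of light and the forces at a collision. Removing it requires bounds in terms
  of \<open>W\<close> (a speed bound below 1 for the data), the distance \<open>d0\<close> at time
  0, \<open>Tp\<close> and the couplings. They must come in the order distance, separation, momenta:
  the first two use only the retarded force on \<open>a\<close>, which needs no upper bound for the
  momenta. Particle \<open>b\<close> is reduced to \<open>a\<close> by reflecting the line, which
  exchanges \<open>rho\<close> and \<open>sig\<close>. In the regularity part the solution is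
  arbitrary and its speeds are below 1 only pointwise; contraction arguments give way to strict
  monotonicity along light rays.\<close>

lemma brouwer_cube:
  fixes G :: "(nat \<Rightarrow> real) \<Rightarrow> nat \<Rightarrow> real" and N :: nat
  assumes range: "\<And>x i. (\<And>j. j < N \<Longrightarrow> x j \<in> {0..1}) \<Longrightarrow> i < N \<Longrightarrow> G x i \<in> {0..1}"
    and cont: "\<And>X x i. (\<And>k j. j < N \<Longrightarrow> X k j \<in> {0..1}) \<Longrightarrow>
      (\<And>j. j < N \<Longrightarrow> (\<lambda>k. X k j) \<longlonglongrightarrow> x j) \<Longrightarrow> i < N \<Longrightarrow> (\<lambda>k. G (X k) i) \<longlonglongrightarrow> G x i"
  obtains x where "\<And>i. i < N \<Longrightarrow> x i \<in> {0..1}" "\<And>i. i < N \<Longrightarrow> G x i = x i"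
proof -
  \<comment> \<open>Kuhn's lemma on the grid of mesh \<open>1 / Suc m\<close> gives a cell in which
    each coordinate has a vertex where \<open>G\<close> does not decrease it and one where
    \<open>G\<close> does not increase it; compactness merges these points into a fixed point. The
    dimension \<open>N\<close> is a variable and not part of a type, since the number of nodes grows
    in the application.\<close>
  have cell: "\<exists>q. (\<forall>j<N. q j \<in> {0..1}) \<and> (\<forall>i<N. \<exists>r s.
      (\<forall>j<N. r j \<in> {0..1} \<and> \<bar>r j - q j\<bar> \<le> 1 / Suc m) \<and> (\<forall>j<N. s j \<in> {0..1} \<and> \<bar>s j - q j\<bar> \<le> 1 / Suc m) \<and>
      G r i \<ge> r i \<and> G s i \<le> s i)" for m :: nat
  proof -
    define p where "p = Suc m"
    define pt where "pt x = (\<lambda>j. real (x j) / real p)" for x :: "nat \<Rightarrow> nat"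
    \<comment> \<open>Label 0 means that \<open>G\<close> does not push the coordinate down, label 1
      that it does not push it up. On the two faces the label is prescribed as Kuhn's lemma
      requires; the inequality holds there anyway because \<open>G\<close> maps into the
      cube.\<close>
    define label where "label x i = (if x i = 0 \<or> x i \<noteq> p \<and> G (pt x) i \<ge> pt x i then 0 else 1::nat)"
      for x :: "nat \<Rightarrow> nat" and i
    have p: "p > 0" by (simp add: p_def)
    have pt01: "pt x j \<in> {0..1}" if "x j \<le> p" for x j
      using that p by (auto simp: pt_def divide_simps)
    have "\<forall>x. (\<forall>i<N. x i \<le> p) \<longrightarrow> (\<forall>i<N. label x i = 0 \<or> label x i = 1)"
      by (auto simp: label_def)
    moreover have "\<forall>x. (\<forall>i<N. x i \<le> p) \<longrightarrow> (\<forall>i<N. x i = 0 \<longrightarrow> label x i = 0)"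
      by (auto simp: label_def)
    moreover have "\<forall>x. (\<forall>i<N. x i \<le> p) \<longrightarrow> (\<forall>i<N. x i = p \<longrightarrow> label x i = 1)"
      using p by (auto simp: label_def)
    ultimately obtain q where q: "\<forall>i<N. q i < p"
      and rs: "\<forall>i<N. \<exists>r s. (\<forall>j<N. q j \<le> r j \<and> r j \<le> q j + 1) \<and>
          (\<forall>j<N. q j \<le> s j \<and> s j \<le> q j + 1) \<and> label r i \<noteq> label s i"
      by (rule kuhn_lemma[OF p])
    have lab0: "G (pt x) i \<ge> pt x i" if "label x i = 0" "\<And>j. j < N \<Longrightarrow> x j \<le> p" "i < N" for x i
    proof (cases "x i = 0")
      case True
      have "G (pt x) i \<in> {0..1}" using range[of "pt x" i] pt01 that by blast
      then show ?thesis using True by (simp add: pt_def)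
    qed (use that in \<open>auto simp: label_def split: if_splits\<close>)
    have lab1: "G (pt x) i \<le> pt x i" if "label x i \<noteq> 0" "\<And>j. j < N \<Longrightarrow> x j \<le> p" "i < N" for x i
    proof (cases "x i = p")
      case True
      have "G (pt x) i \<in> {0..1}" using range[of "pt x" i] pt01 that by blast
      then show ?thesis using True p by (simp add: pt_def)
    qed (use that in \<open>auto simp: label_def split: if_splits\<close>)
    have near: "\<bar>pt r j - pt q j\<bar> \<le> 1 / Suc m" if "q j \<le> r j" "r j \<le> q j + 1" for r j
    proof -
      have "pt r j - pt q j = (real (r j) - real (q j)) / p" by (simp add: pt_def diff_divide_distrib)
      moreover have "0 \<le> real (r j) - real (q j)" "real (r j) - real (q j) \<le> 1" using that by auto
      ultimately show ?thesis using p by (simp add: p_def divide_right_mono abs_of_nonneg)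
    qed
    show ?thesis
    proof (rule exI[of _ "pt q"], intro conjI allI impI)
      show "pt q j \<in> {0..1}" if "j < N" for j using q that by (intro pt01) (simp add: less_imp_le)
    next
      fix i assume i: "i < N"
      then obtain r s where r: "\<forall>j<N. q j \<le> r j \<and> r j \<le> q j + 1"
        and s: "\<forall>j<N. q j \<le> s j \<and> s j \<le> q j + 1" and ne: "label r i \<noteq> label s i"
        using rs by blast
      have rp: "r j \<le> p" and sp: "s j \<le> p" if "j < N" for j
        using r s q that by (metis Suc_eq_plus1 Suc_leI le_trans)+
      have *: "\<exists>r s. (\<forall>j<N. r j \<in> {0..1} \<and> \<bar>r j - pt q j\<bar> \<le> 1 / Suc m) \<and>
          (\<forall>j<N. s j \<in> {0..1} \<and> \<bar>s j - pt q j\<bar> \<le> 1 / Suc m) \<and> G r i \<ge> r i \<and> G s i \<le> s i"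
        if "label r' i = 0" "label s' i \<noteq> 0" "\<forall>j<N. q j \<le> r' j \<and> r' j \<le> q j + 1"
          "\<forall>j<N. q j \<le> s' j \<and> s' j \<le> q j + 1" "\<And>j. j < N \<Longrightarrow> r' j \<le> p" "\<And>j. j < N \<Longrightarrow> s' j \<le> p"
        for r' s'
        by (rule exI[of _ "pt r'"], rule exI[of _ "pt s'"])
          (use that i in \<open>intro conjI allI impI pt01 near lab0 lab1; simp\<close>)
      show "\<exists>r s. (\<forall>j<N. r j \<in> {0..1} \<and> \<bar>r j - pt q j\<bar> \<le> 1 / Suc m) \<and>
          (\<forall>j<N. s j \<in> {0..1} \<and> \<bar>s j - pt q j\<bar> \<le> 1 / Suc m) \<and> G r i \<ge> r i \<and> G s i \<le> s i"
      proof (cases "label r i = 0")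
        case True
        then have "label s i \<noteq> 0" using ne by simp
        then show ?thesis using *[of r s] True r s rp sp by blast
      next
        case False
        then have "label s i = 0" using ne by (auto simp: label_def split: if_splits)
        then show ?thesis using *[of s r] False r s rp sp by blast
      qed
    qed
  qed
  define near where "near m q y \<longleftrightarrow> (\<forall>j<N. y j \<in> {0..1} \<and> \<bar>y j - q j\<bar> \<le> 1 / Suc m)"
    for m :: nat and q y :: "nat \<Rightarrow> real"
  have "\<exists>q. (\<forall>j<N. q j \<in> {0..1}) \<and> (\<forall>i<N. \<exists>r s. near m q r \<and> near m q s \<and> G r i \<ge> r i \<and> G s i \<le> s i)"
    for m unfolding near_def by (rule cell)
  then obtain Q where Q: "\<And>m j. j < N \<Longrightarrow> Q m j \<in> {0..1}"
    and "\<And>m i. i < N \<Longrightarrow> \<exists>r s. near m (Q m) r \<and> near m (Q m) s \<and> G r i \<ge> r i \<and> G s i \<le> s i"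
    by metis
  then have "\<forall>m i. \<exists>p. i < N \<longrightarrow> near m (Q m) (fst p) \<and> near m (Q m) (snd p) \<and>
      G (fst p) i \<ge> fst p i \<and> G (snd p) i \<le> snd p i"
    by (metis fst_conv snd_conv)
  then obtain P where P: "\<And>m i. i < N \<Longrightarrow> near m (Q m) (fst (P m i)) \<and> near m (Q m) (snd (P m i)) \<and>
      G (fst (P m i)) i \<ge> fst (P m i) i \<and> G (snd (P m i)) i \<le> snd (P m i) i"
    unfolding choice_iff by blast
  define R S where "R m i = fst (P m i)" and "S m i = snd (P m i)" for m i
  have R: "R m i j \<in> {0..1} \<and> \<bar>R m i j - Q m j\<bar> \<le> 1 / Suc m"
    and S: "S m i j \<in> {0..1} \<and> \<bar>S m i j - Q m j\<bar> \<le> 1 / Suc m"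
    and GR: "G (R m i) i \<ge> R m i i" and GS: "G (S m i) i \<le> S m i i" if "i < N" "j < N" for m i j
    using P[OF that(1), of m] that(2) by (auto simp: near_def R_def S_def)
  have Q1: "norm (Q m j) \<le> 1" if "j \<in> {..<N}" for m j
    using Q[of j m] that by auto
  obtain k where k: "strict_mono k" and "\<And>j. j \<in> {..<N} \<Longrightarrow> \<exists>l. (\<lambda>n. Q (k n) j) \<longlonglongrightarrow> l"
    by (rule function_convergent_subsequence[of "{..<N}" Q 1, OF countable_finite[OF finite_lessThan] Q1]) blast+
  then obtain x where x: "\<And>j. j < N \<Longrightarrow> (\<lambda>n. Q (k n) j) \<longlonglongrightarrow> x j" by (metis lessThan_iff)
  have inv0: "(\<lambda>n. 1 / real (Suc (k n))) \<longlonglongrightarrow> 0"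
    using LIMSEQ_subseq_LIMSEQ[OF LIMSEQ_inverse_real_of_nat k]
    by (simp add: o_def inverse_eq_divide)
  have near_lim: "(\<lambda>n. Y (k n) j) \<longlonglongrightarrow> x j" if "j < N" "\<And>m. \<bar>Y m j - Q m j\<bar> \<le> 1 / Suc m" for Y j
  proof -
    have "(\<lambda>n. Y (k n) j - Q (k n) j) \<longlonglongrightarrow> 0"
      using that(2) by (intro Lim_null_comparison[OF _ inv0] always_eventually allI) (simp add: real_norm_def)
    from tendsto_add[OF this x[OF that(1)]] show ?thesis by simp
  qed
  show thesis
  proof (rule that[of x])
    fix i assume i: "i < N"
    show "x i \<in> {0..1}"
      using Q i closed_sequentially[OF _ _ x[OF i], of "{0..1}"] by simp
    have Rx: "(\<lambda>n. R (k n) i j) \<longlonglongrightarrow> x j" if "j < N" for j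
      using near_lim[of j "\<lambda>m. R m i"] R i that by blast
    have Sx: "(\<lambda>n. S (k n) i j) \<longlonglongrightarrow> x j" if "j < N" for j
      using near_lim[of j "\<lambda>m. S m i"] S i that by blast
    have "(\<lambda>n. G (R (k n) i) i) \<longlonglongrightarrow> G x i" using R Rx i by (intro cont) blast+
    then have "x i \<le> G x i" using Rx[OF i] GR[OF i i] by (intro LIMSEQ_le) blast+
    moreover have "(\<lambda>n. G (S (k n) i) i) \<longlonglongrightarrow> G x i" using S Sx i by (intro cont) blast+
    then have "G x i \<le> x i" using Sx[OF i] GS[OF i i] by (intro LIMSEQ_le) blast+
    ultimately show "G x i = x i" by simp
  qed
qed

section \<open>Lipschitz functions through finitely many points\<close>

primrec mcshane :: "real \<Rightarrow> (nat \<Rightarrow> real) \<Rightarrow> nat \<Rightarrow> (nat \<Rightarrow> real) \<Rightarrow> real \<Rightarrow> real" where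
  "mcshane L z 0 x t = L * \<bar>t\<bar>"
| "mcshane L z (Suc N) x t = min (mcshane L z N x t) (x N + L * \<bar>t - z N\<bar>)"

text \<open>The normalization at 0 bounds \<open>u t\<close> by \<open>L * \<bar>t\<bar>\<close>, so
  that no interval has to be fixed to obtain compactness.\<close>

definition lip0 :: "real \<Rightarrow> (real \<Rightarrow> real) \<Rightarrow> bool" where
  "lip0 L u \<longleftrightarrow> (\<forall>s t. \<bar>u s - u t\<bar> \<le> L * \<bar>s - t\<bar>) \<and> u 0 = 0"

lemma lip0_bound: "lip0 L u \<Longrightarrow> \<bar>u t\<bar> \<le> L * \<bar>t\<bar>"
  unfolding lip0_def by (metis diff_zero)

lemma lip0_continuous: "lip0 L u \<Longrightarrow> continuous_on S u"
proof -
  assume "lip0 L u"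
  then have "\<bar>u s - u t\<bar> \<le> max L 0 * \<bar>s - t\<bar>" for s t
    unfolding lip0_def by (meson abs_ge_zero max.cobounded1 mult_right_mono order_trans)
  then have "(max L 0)-lipschitz_on S u"
    by (intro lipschitz_onI) (auto simp: dist_real_def)
  then show ?thesis by (rule lipschitz_on_continuous_on)
qed

lemma mcshane_lipschitz:
  assumes "L \<ge> 0"
  shows "\<bar>mcshane L z N x s - mcshane L z N x t\<bar> \<le> L * \<bar>s - t\<bar>"
proof (induction N)
  case 0
  have "L * \<bar>s\<bar> - L * \<bar>t\<bar> = L * (\<bar>s\<bar> - \<bar>t\<bar>)" by (simp add: algebra_simps)
  then show ?case using assms by (simp add: abs_mult mult_left_mono)
next
  case (Suc N)
  have "\<bar>(x N + L * \<bar>s - z N\<bar>) - (x N + L * \<bar>t - z N\<bar>)\<bar> = L * \<bar>\<bar>s - z N\<bar> - \<bar>t - z N\<bar>\<bar>"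
    using assms by (simp add: abs_mult flip: right_diff_distrib)
  also have "\<dots> \<le> L * \<bar>s - t\<bar>" using assms by (intro mult_left_mono) auto
  finally have "\<bar>(x N + L * \<bar>s - z N\<bar>) - (x N + L * \<bar>t - z N\<bar>)\<bar> \<le> L * \<bar>s - t\<bar>" .
  with Suc show ?case unfolding mcshane.simps min_def abs_le_iff by (auto split: if_splits)
qed

text \<open>By the triangle inequality a cone of slope \<open>L\<close> with apex above
  \<open>- (L * \<bar>z\<bar>)\<close> stays above \<open>- (L * \<bar>t\<bar>)\<close>. Together
  with the base case, a cone with apex at the origin, this pins the value at 0.\<close>

lemma mcshane_lower:
  assumes "L \<ge> 0" "\<And>i. i < N \<Longrightarrow> \<bar>x i\<bar> \<le> L * \<bar>z i\<bar>"
  shows "- (L * \<bar>t\<bar>) \<le> mcshane L z N x t"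
  using assms(2)
proof (induction N)
  case 0
  then show ?case using assms(1) mult_nonneg_nonneg[of L "\<bar>t\<bar>"] by (simp del: mult_nonneg_nonneg)
next
  case (Suc N)
  have "L * \<bar>z N\<bar> \<le> L * (\<bar>t\<bar> + \<bar>t - z N\<bar>)" using assms(1) by (intro mult_left_mono) auto
  moreover have "- x N \<le> L * \<bar>z N\<bar>" using Suc.prems[of N] by (simp add: abs_le_iff)
  ultimately have "- (L * \<bar>t\<bar>) \<le> x N + L * \<bar>t - z N\<bar>" by (simp add: distrib_left)
  moreover have "- (L * \<bar>t\<bar>) \<le> mcshane L z N x t" using Suc.IH Suc.prems less_SucI by blast
  ultimately show ?case by simp
qed

lemma mcshane_upper: "mcshane L z N x t \<le> L * \<bar>t\<bar>"
  by (induction N) auto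

text \<open>The lower envelope of cones over the data can fall below data that violate the Lipschitz
  condition, but never below a \<open>lip0\<close> function through them; so it attains data sampled
  from such a function.\<close>

lemma mcshane_interpolates:
  assumes "lip0 L f" "\<And>i. i < N \<Longrightarrow> x i = f (z i)" "i < N"
  shows "mcshane L z N x (z i) = x i"
proof (rule antisym)
  show "mcshane L z N x (z i) \<le> x i"
    using assms(3) by (induction N) (auto simp: less_Suc_eq min_def)
  have "f t \<le> mcshane L z N x t" for t
    using assms(2)
  proof (induction N)
    case 0
    then show ?case using lip0_bound[OF assms(1), of t] by simp
  next
    case (Suc N)
    have "\<bar>f t - f (z N)\<bar> \<le> L * \<bar>t - z N\<bar>" using assms(1) by (simp add: lip0_def)
    then show ?case using Suc by fastforce
  qed
  then show "x i \<le> mcshane L z N x (z i)" using assms(2,3) by metis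
qed

lemma mcshane_lip0:
  assumes "L \<ge> 0" "\<And>i. i < N \<Longrightarrow> \<bar>x i\<bar> \<le> L * \<bar>z i\<bar>"
  shows "lip0 L (mcshane L z N x)"
  using mcshane_lipschitz[OF assms(1)] mcshane_lower[of L N x z 0, OF assms] mcshane_upper[of L z N x 0]
  by (simp add: lip0_def)

lemma mcshane_tendsto:
  assumes "\<And>i. i < N \<Longrightarrow> (\<lambda>k. X k i) \<longlonglongrightarrow> x i"
  shows "(\<lambda>k. mcshane L z N (X k) t) \<longlonglongrightarrow> mcshane L z N x t"
  using assms by (induction N) (auto intro!: tendsto_intros)

text \<open>The unknowns are the values at the nodes, scaled to a cube. Arbitrary values in that box
  need not respect the Lipschitz constant, so \<open>E y\<close> does not interpolate
  \<open>X y\<close> in general. At the Brouwer fixed point, however, the data are samples of the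
  \<open>lip0\<close> function \<open>F (E y)\<close>, and \<open>E y\<close> passes through
  them.\<close>

lemma schauder_lip0_finite:
  assumes L: "L > 0"
    and lip: "\<And>u. lip0 L u \<Longrightarrow> lip0 L (F u)"
    and cont: "\<And>(U :: nat \<Rightarrow> real \<Rightarrow> real) u t. (\<And>n. lip0 L (U n)) \<Longrightarrow> lip0 L u \<Longrightarrow> (\<And>t. (\<lambda>n. U n t) \<longlonglongrightarrow> u t) \<Longrightarrow>
      (\<lambda>n. F (U n) t) \<longlonglongrightarrow> F u t"
  obtains u where "lip0 L u" "\<And>i::nat. i < N \<Longrightarrow> u (z i) = F u (z i)"
proof -
  define X where "X y i = L * \<bar>z i\<bar> * (2 * y i - 1)" for y :: "nat \<Rightarrow> real" and i :: nat
  define E where "E y = mcshane L z N (X y)" for y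
  define G where "G y i = (F (E y) (z i) / (L * \<bar>z i\<bar>) + 1) / 2" for y i
  have X: "\<bar>X y i\<bar> \<le> L * \<bar>z i\<bar>" if "y i \<in> {0..1}" for y i
  proof -
    have "L * \<bar>z i\<bar> * \<bar>2 * y i - 1\<bar> \<le> L * \<bar>z i\<bar> * 1" using that L by (intro mult_left_mono) auto
    then show ?thesis using L by (simp add: X_def abs_mult)
  qed
  have E: "lip0 L (E y)" if "\<And>i. i < N \<Longrightarrow> y i \<in> {0..1}" for y
    unfolding E_def using X that L by (intro mcshane_lip0) auto
  have Gr: "G y i \<in> {0..1}" if "\<And>i. i < N \<Longrightarrow> y i \<in> {0..1}" for y i
  proof -
    have "\<bar>F (E y) (z i)\<bar> \<le> L * \<bar>z i\<bar>" using lip0_bound lip E that by blast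
    then have "\<bar>F (E y) (z i) / (L * \<bar>z i\<bar>)\<bar> \<le> 1" using L by (auto simp: abs_mult divide_le_eq_1)
    then have "- 1 \<le> F (E y) (z i) / (L * \<bar>z i\<bar>)" "F (E y) (z i) / (L * \<bar>z i\<bar>) \<le> 1"
      unfolding abs_le_iff by linarith+
    then show ?thesis by (simp add: G_def)
  qed
  have Gc: "(\<lambda>k. G (Y k) i) \<longlonglongrightarrow> G y i"
    if Y: "\<And>k j. j < N \<Longrightarrow> Y k j \<in> {0..1}" "\<And>j. j < N \<Longrightarrow> (\<lambda>k. Y k j) \<longlonglongrightarrow> y j" for Y y i
  proof -
    have y: "y j \<in> {0..1}" if "j < N" for j
      using closed_sequentially[OF _ _ Y(2), of "{0..1}"] Y(1) that by auto
    have "(\<lambda>k. E (Y k) t) \<longlonglongrightarrow> E y t" for t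
      unfolding E_def X_def using Y(2) by (intro mcshane_tendsto tendsto_intros)
    then have "(\<lambda>k. F (E (Y k)) (z i)) \<longlonglongrightarrow> F (E y) (z i)"
      using E Y(1) y by (intro cont) auto
    then show ?thesis unfolding G_def divide_inverse by (intro tendsto_intros)
  qed
  obtain y where y: "\<And>i. i < N \<Longrightarrow> y i \<in> {0..1}" and fixed: "\<And>i. i < N \<Longrightarrow> G y i = y i"
    by (rule brouwer_cube[of N G, OF Gr Gc]) blast+
  have FE: "lip0 L (F (E y))" using lip E y by blast
  have Xy: "X y i = F (E y) (z i)" if "i < N" for i
  \<comment> \<open>At a node 0 the division in \<open>G\<close> yields 0 and \<open>G\<close> is
    constantly 1/2; this is harmless, as both sides vanish there.\<close>
  proof (cases "z i = 0")
    case True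
    then show ?thesis using FE by (simp add: X_def lip0_def)
  next
    case False
    have "2 * y i - 1 = F (E y) (z i) / (L * \<bar>z i\<bar>)" using fixed[OF that] by (simp add: G_def field_simps)
    then show ?thesis using False L by (simp add: X_def)
  qed
  show thesis
  proof
    show "lip0 L (E y)" using E y by blast
    show "E y (z i) = F (E y) (z i)" if "i < N" for i
      using mcshane_interpolates[of L "F (E y)" N "X y" z i, OF FE Xy that] Xy[OF that] by (simp add: E_def)
  qed
qed

text \<open>Arzela-Ascoli on the line: a diagonal subsequence converges at the rationals, and the
  common Lipschitz constant carries the Cauchy property to all points.\<close>

lemma lip0_subsequence:
  fixes U :: "nat \<Rightarrow> real \<Rightarrow> real"
  assumes U: "\<And>n. lip0 L (U n)" and L: "L > 0"
  obtains k u where "strict_mono k" "lip0 L u" "\<And>t. (\<lambda>n. U (k n) t) \<longlonglongrightarrow> u t"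
proof -
  \<comment> \<open>The weight turns linear growth into the uniform bound of the diagonal argument;
    it is never zero and can be removed afterwards.\<close>
  have "norm (U n t / (1 + L * \<bar>t\<bar>)) \<le> 1" for n t
  proof -
    have "\<bar>U n t\<bar> \<le> 1 + L * \<bar>t\<bar>" using lip0_bound[OF U, of n t] by simp
    moreover have "0 < 1 + L * \<bar>t\<bar>" using L by (simp add: add_pos_nonneg)
    ultimately show ?thesis by (simp add: pos_divide_le_eq)
  qed
  from function_convergent_subsequence[of "\<rat>" "\<lambda>n t. U n t / (1 + L * \<bar>t\<bar>)", OF countable_rat this]
  obtain k where k: "strict_mono k"
    and lim: "\<And>t. t \<in> \<rat> \<Longrightarrow> \<exists>l. (\<lambda>n. U (k n) t / (1 + L * \<bar>t\<bar>)) \<longlonglongrightarrow> l" by metis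
  have conv_rat: "Cauchy (\<lambda>n. U (k n) t)" if t: "t \<in> \<rat>" for t
  proof -
    obtain l where "(\<lambda>n. U (k n) t / (1 + L * \<bar>t\<bar>)) \<longlonglongrightarrow> l" using lim t by blast
    from tendsto_mult_right[OF this, of "1 + L * \<bar>t\<bar>"]
    have "(\<lambda>n. U (k n) t) \<longlonglongrightarrow> l * (1 + L * \<bar>t\<bar>)"
      using L by (simp add: add_nonneg_eq_0_iff)
    then show ?thesis by (rule LIMSEQ_imp_Cauchy)
  qed
  have "convergent (\<lambda>n. U (k n) t)" for t
  proof (rule Cauchy_convergent, rule metric_CauchyI)
    fix e :: real assume e: "e > 0"
    obtain q where q: "q \<in> \<rat>" "t < q" "q < t + e / (3 * L)"
      using Rats_dense_in_real[of t "t + e / (3 * L)"] e L by auto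
    obtain M where M: "\<And>m n. m \<ge> M \<Longrightarrow> n \<ge> M \<Longrightarrow> dist (U (k m) q) (U (k n) q) < e / 3"
      using metric_CauchyD[OF conv_rat[OF q(1)], of "e / 3"] e by auto
    have near: "\<bar>U n t - U n q\<bar> < e / 3" for n
    proof -
      have "\<bar>U n t - U n q\<bar> \<le> L * \<bar>t - q\<bar>" using U by (simp add: lip0_def)
      also have "\<dots> < L * (e / (3 * L))" using q L by (intro mult_strict_left_mono) auto
      finally show ?thesis using L by simp
    qed
    show "\<exists>M. \<forall>m\<ge>M. \<forall>n\<ge>M. dist (U (k m) t) (U (k n) t) < e"
    proof (intro exI allI impI)
      fix m n assume "m \<ge> M" "n \<ge> M"
      from M[OF this] near[of "k m"] near[of "k n"]
      show "dist (U (k m) t) (U (k n) t) < e" unfolding dist_real_def by linarith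
    qed
  qed
  then obtain u where u: "\<And>t. (\<lambda>n. U (k n) t) \<longlonglongrightarrow> u t" unfolding convergent_def by metis
  have "\<bar>u s - u t\<bar> \<le> L * \<bar>s - t\<bar>" for s t
    using U by (intro LIMSEQ_le_const2[OF tendsto_rabs[OF tendsto_diff[OF u u]]]) (auto simp: lip0_def)
  moreover have "u 0 = 0" using u[of 0] U by (simp add: lip0_def LIMSEQ_const_iff)
  ultimately show thesis using that[OF k _ u] by (auto simp: lip0_def)
qed

text \<open>A limit of functions that are fixed at more and more rationals is fixed at all of them,
  and continuity extends this to the line.\<close>

lemma schauder_lip0:
  assumes L: "L > 0"
    and lip: "\<And>u. lip0 L u \<Longrightarrow> lip0 L (F u)"
    and cont: "\<And>(U :: nat \<Rightarrow> real \<Rightarrow> real) u t. (\<And>n. lip0 L (U n)) \<Longrightarrow> lip0 L u \<Longrightarrow> (\<And>t. (\<lambda>n. U n t) \<longlonglongrightarrow> u t) \<Longrightarrow>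
      (\<lambda>n. F (U n) t) \<longlonglongrightarrow> F u t"
  obtains u where "lip0 L u" "F u = u"
proof -
  define z where "z = from_nat_into (\<rat> :: real set)"
  have "\<exists>u. lip0 L u \<and> (\<forall>i<N. u (z i) = F u (z i))" for N
    by (rule schauder_lip0_finite[where L = L and F = F and N = N and z = z, OF L lip cont]) blast+
  then have "\<forall>N. \<exists>u. lip0 L u \<and> (\<forall>i<N. u (z i) = F u (z i))" by blast
  from choice[OF this] obtain U where U: "\<And>N. lip0 L (U N)"
    and Uz: "\<And>N i. i < N \<Longrightarrow> U N (z i) = F (U N) (z i)"
    by blast
  obtain k u where k: "strict_mono k" and u: "lip0 L u" and lim: "\<And>t. (\<lambda>n. U (k n) t) \<longlonglongrightarrow> u t"
    by (rule lip0_subsequence[where U = U and L = L, OF U L]) blast+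
  have Flim: "(\<lambda>n. F (U (k n)) t) \<longlonglongrightarrow> F u t" for t
    by (rule cont[OF U u lim])
  have "F u (z i) = u (z i)" for i
  proof -
    have "\<forall>\<^sub>F n in sequentially. U (k n) (z i) = F (U (k n)) (z i)"
      using eventually_gt_at_top[of i] by eventually_elim (rule Uz[OF order.strict_trans2[OF _ seq_suble[OF k]]])
    from Lim_transform_eventually[OF lim this] show ?thesis
      by (rule LIMSEQ_unique[OF Flim])
  qed
  then have rat: "F u t = u t" if "t \<in> \<rat>" for t
    using that from_nat_into_surj[OF countable_rat that] by (auto simp: z_def)
  have "F u t - u t = 0" for t
  proof (rule continuous_constant_on_closure[where f = "\<lambda>t. F u t - u t" and S = "\<rat>"])
    show "continuous_on (closure \<rat>) (\<lambda>t. F u t - u t)"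
      using lip0_continuous lip u by (intro continuous_on_diff) blast+
    show "t \<in> closure \<rat>"
      unfolding closure_approachable
    proof (intro allI impI)
      fix e :: real assume "0 < e"
      then obtain q where "q \<in> \<rat>" "t < q" "q < t + e" using Rats_dense_in_real[of t "t + e"] by auto
      then show "\<exists>y\<in>\<rat>. dist y t < e" by (intro bexI[of _ q]) (auto simp: dist_real_def)
    qed
  qed (simp add: rat)
  then show thesis using that[OF u] by auto
qed

section \<open>Velocities, momenta and delayed times\<close>

definition mom :: "real \<Rightarrow> real" where
  "mom v = v / sqrt (1 - v\<^sup>2)"

text \<open>Inverse of \<open>mom\<close>. With momenta as unknowns, speeds below 1 are automatic
  and the equations equate the derivative of the momentum to a force.\<close>

definition vel :: "real \<Rightarrow> real" where
  "vel p = p / sqrt (1 + p\<^sup>2)"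

lemma one_plus_square_pos: "0 < 1 + (p::real)\<^sup>2"
  by (simp add: add_pos_nonneg)

lemma vel_derivative: "(vel has_real_derivative 1 / sqrt (1 + p\<^sup>2) ^ 3) (at p)"
proof -
  let ?s = "sqrt (1 + p\<^sup>2)"
  have s: "?s > 0" "?s ^ 2 = 1 + p\<^sup>2" using one_plus_square_pos[of p] by auto
  have "(vel has_real_derivative (1 * ?s - p * (inverse ?s / 2 * (2 * p))) / (?s * ?s)) (at p)"
    unfolding vel_def[abs_def] using s(1) one_plus_square_pos[of p]
    by (auto intro!: derivative_eq_intros)
  also have "(1 * ?s - p * (inverse ?s / 2 * (2 * p))) / (?s * ?s) = (?s ^ 2 - p\<^sup>2) / ?s ^ 3"
    using s(1) by (simp add: field_simps power2_eq_square power3_eq_cube)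
  finally show ?thesis using s(2) by simp
qed

lemma vel_abs_less_1: "\<bar>vel p\<bar> < 1"
proof -
  have "\<bar>p\<bar> = sqrt (p\<^sup>2)" by simp
  also have "\<dots> < sqrt (1 + p\<^sup>2)" by (simp only: real_sqrt_less_iff)
  finally show ?thesis using one_plus_square_pos[of p] by (simp add: vel_def)
qed

lemma vel_strict_mono: "p < q \<Longrightarrow> vel p < vel q"
  by (rule DERIV_pos_imp_increasing) (auto intro!: exI vel_derivative simp: add_pos_nonneg)

lemma vel_less_iff [simp]: "vel p < vel q \<longleftrightarrow> p < q"
  using vel_strict_mono by (metis linorder_neq_iff order.asym)

lemma vel_le_iff [simp]: "vel p \<le> vel q \<longleftrightarrow> p \<le> q"
  using vel_less_iff[of q p] by linarith

lemma vel_mom: "\<bar>v\<bar> < 1 \<Longrightarrow> vel (mom v) = v"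
proof -
  assume "\<bar>v\<bar> < 1"
  then have v: "1 - v\<^sup>2 > 0" by (simp add: abs_square_less_1)
  then have "1 + (mom v)\<^sup>2 = 1 / (1 - v\<^sup>2)" by (simp add: mom_def power_divide field_simps)
  then show ?thesis using v by (simp add: vel_def mom_def real_sqrt_divide)
qed

lemma mom_vel: "mom (vel p) = p"
proof -
  have "1 - (vel p)\<^sup>2 = 1 / (1 + p\<^sup>2)"
    using one_plus_square_pos[of p] by (simp add: vel_def power_divide field_simps)
  then show ?thesis using one_plus_square_pos[of p] by (simp add: mom_def vel_def real_sqrt_divide)
qed

lemma mom_le: "\<bar>v\<bar> < 1 \<Longrightarrow> \<bar>w\<bar> < 1 \<Longrightarrow> v \<le> w \<Longrightarrow> mom v \<le> mom w"
  by (metis vel_le_iff vel_mom)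

lemma mom_uminus: "mom (- v) = - mom v"
  by (simp add: mom_def)

lemma vel_uminus: "vel (- v) = - vel v"
  by (simp add: vel_def)

lemma vel_continuous: "continuous_on S vel"
  by (meson DERIV_isCont continuous_at_imp_continuous_on vel_derivative)

lemma rho_mono: "v \<le> w \<Longrightarrow> \<bar>v\<bar> < 1 \<Longrightarrow> \<bar>w\<bar> < 1 \<Longrightarrow> rho v \<le> rho w"
  by (auto simp: rho_def intro!: frac_le)

lemma rho_pos: "\<bar>v\<bar> < 1 \<Longrightarrow> rho v > 0"
  by (auto simp: rho_def)

lemma sig_eq_rho: "sig v = rho (- v)"
  by (simp add: sig_def rho_def)

lemma sig_pos: "\<bar>v\<bar> < 1 \<Longrightarrow> sig v > 0"
  by (simp add: sig_eq_rho rho_pos)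

section \<open>Light cones of trajectories on the whole line\<close>

definition lightcone :: "real \<Rightarrow> (real \<Rightarrow> real) \<Rightarrow> real \<Rightarrow> real \<Rightarrow> real" where
  "lightcone \<epsilon> f t x = (THE s. s = t + \<epsilon> * \<bar>x - f s\<bar>)"

text \<open>A speed bound \<open>V < 1\<close> uniform in time makes the implicit equation a
  contraction. Trajectories are extended to the whole line so that existence requires no check of
  domains at this stage.\<close>

lemma lightcone_ex1:
  fixes f :: "real \<Rightarrow> real" and V t x \<epsilon> :: real
  assumes V: "0 \<le> V" "V < 1" and f: "\<And>s s'. \<bar>f s - f s'\<bar> \<le> V * \<bar>s - s'\<bar>" and \<epsilon>: "\<bar>\<epsilon>\<bar> = 1"
  shows "\<exists>!s. s = t + \<epsilon> * \<bar>x - f s\<bar>"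
proof -
  have "\<exists>!s. s \<in> UNIV \<and> t + \<epsilon> * \<bar>x - f s\<bar> = s"
  proof (rule Banach_fix[of _ V])
    fix s s' :: real
    have "\<bar>\<epsilon> * \<bar>x - f s\<bar> - \<epsilon> * \<bar>x - f s'\<bar>\<bar> = \<bar>\<bar>x - f s\<bar> - \<bar>x - f s'\<bar>\<bar>"
      using \<epsilon> by (metis abs_mult mult_1 right_diff_distrib)
    also have "\<dots> \<le> \<bar>f s - f s'\<bar>" by linarith
    finally show "dist (t + \<epsilon> * \<bar>x - f s\<bar>) (t + \<epsilon> * \<bar>x - f s'\<bar>) \<le> V * dist s s'"
      using f[of s s'] by (simp add: dist_real_def)
  qed (use V in \<open>auto simp: complete_UNIV\<close>)
  then show ?thesis by (metis UNIV_I)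
qed

lemma lightcone_eq:
  assumes "0 \<le> V" "V < 1" "\<And>s s'. \<bar>f s - f s'\<bar> \<le> V * \<bar>s - s'\<bar>" "\<bar>\<epsilon>\<bar> = 1"
  shows "lightcone \<epsilon> f t x = t + \<epsilon> * \<bar>x - f (lightcone \<epsilon> f t x)\<bar>"
  unfolding lightcone_def by (rule theI'[OF lightcone_ex1[OF assms]])

lemma lightcone_unique:
  assumes "0 \<le> V" "V < 1" "\<And>s s'. \<bar>f s - f s'\<bar> \<le> V * \<bar>s - s'\<bar>" "\<bar>\<epsilon>\<bar> = 1"
    and "s = t + \<epsilon> * \<bar>x - f s\<bar>"
  shows "lightcone \<epsilon> f t x = s"
  using lightcone_ex1[OF assms(1-4), of t x] lightcone_eq[OF assms(1-4), of t x] assms(5) by blast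

text \<open>One estimate yields both continuity in the event \<open>(t, x)\<close> and stability
  under a change of the trajectory. The trajectories are compared at a single time, so pointwise
  convergence is enough.\<close>

lemma lightcone_dist:
  assumes V: "0 \<le> V" "V < 1" and f: "\<And>s s'. \<bar>f s - f s'\<bar> \<le> V * \<bar>s - s'\<bar>"
    and g: "\<And>s s'. \<bar>g s - g s'\<bar> \<le> V * \<bar>s - s'\<bar>" and \<epsilon>: "\<bar>\<epsilon>\<bar> = 1"
  shows "(1 - V) * \<bar>lightcone \<epsilon> f t x - lightcone \<epsilon> g t' x'\<bar> \<le>
    \<bar>t - t'\<bar> + \<bar>x - x'\<bar> + \<bar>f (lightcone \<epsilon> g t' x') - g (lightcone \<epsilon> g t' x')\<bar>"
proof -
  define s s' where "s = lightcone \<epsilon> f t x" and "s' = lightcone \<epsilon> g t' x'"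
  have "s = t + \<epsilon> * \<bar>x - f s\<bar>" "s' = t' + \<epsilon> * \<bar>x' - g s'\<bar>"
    unfolding s_def s'_def by (rule lightcone_eq[OF V f \<epsilon>], rule lightcone_eq[OF V g \<epsilon>])
  then have "s - s' = (t - t') + \<epsilon> * (\<bar>x - f s\<bar> - \<bar>x' - g s'\<bar>)" by (simp add: algebra_simps)
  then have "\<bar>s - s'\<bar> \<le> \<bar>t - t'\<bar> + \<bar>\<epsilon> * (\<bar>x - f s\<bar> - \<bar>x' - g s'\<bar>)\<bar>" by linarith
  also have "\<bar>\<epsilon> * (\<bar>x - f s\<bar> - \<bar>x' - g s'\<bar>)\<bar> = \<bar>\<bar>x - f s\<bar> - \<bar>x' - g s'\<bar>\<bar>"
    using \<epsilon> by (simp add: abs_mult)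
  also have "\<dots> \<le> \<bar>x - x'\<bar> + \<bar>f s - f s'\<bar> + \<bar>f s' - g s'\<bar>" by linarith
  finally show ?thesis using f[of s s'] unfolding s_def s'_def by (simp add: algebra_simps)
qed

text \<open>Force on the right-hand particle \<open>x\<close> of a pair; the force on
  \<open>b\<close> arises by reflection. On a light ray the distance equals the time difference, and
  it is the latter that is cut off at \<open>\<delta>\<close>.\<close>

definition force ::
    "real \<Rightarrow> real \<Rightarrow> (real \<Rightarrow> real) \<Rightarrow> (real \<Rightarrow> real) \<Rightarrow> (real \<Rightarrow> real) \<Rightarrow> real \<Rightarrow> real" where
  "force \<kappa> \<delta> x y vy t =
    \<kappa> / 2 * (rho (vy (lightcone (-1) y t (x t))) / (max \<delta> \<bar>t - lightcone (-1) y t (x t)\<bar>)\<^sup>2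
          + sig (vy (lightcone 1 y t (x t))) / (max \<delta> \<bar>t - lightcone 1 y t (x t)\<bar>)\<^sup>2)"

lemma force_nonneg:
  assumes "\<kappa> > 0" "\<And>s. \<bar>vy s\<bar> < 1"
  shows "0 \<le> force \<kappa> \<delta> x y vy t"
  using assms rho_pos sig_pos by (auto simp: force_def less_imp_le intro!: mult_nonneg_nonneg add_nonneg_nonneg)

lemma lipschitz_of_derivative:
  assumes "\<And>t. (f has_real_derivative f' t) (at t)" "\<And>t. \<bar>f' t\<bar> \<le> V"
  shows "\<bar>f s - f t\<bar> \<le> V * \<bar>s - t\<bar>"
  using field_differentiable_bound[of UNIV f f' V s t] assms by auto

text \<open>Light outruns the trajectory, so the order of the two points is kept along the ray and
  the absolute value resolves. Up to the crossing \<open>f\<close> moves by at most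
  \<open>\<bar>s - t\<bar>\<close>, hence the ray is at least half as long as the present
  distance.\<close>

lemma lightcone_pair:
  fixes f :: "real \<Rightarrow> real" and V s t x :: real
  assumes V: "V < 1" and f: "\<bar>f s - f t\<bar> \<le> V * \<bar>s - t\<bar>" and d: "x - f t > 0"
    and s: "\<bar>s - t\<bar> = \<bar>x - f s\<bar>"
  shows "x - f s = \<bar>s - t\<bar>" "\<bar>s - t\<bar> \<ge> (x - f t) / 2"
proof -
  have "V * \<bar>s - t\<bar> \<le> \<bar>s - t\<bar>" using V mult_right_mono[of V 1 "\<bar>s - t\<bar>"] by simp
  then have "\<bar>f s - f t\<bar> \<le> \<bar>s - t\<bar>" using f by linarith
  moreover have "x - f s \<ge> 0"
  proof (rule ccontr)
    assume "\<not> x - f s \<ge> 0"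
    then have "f s - x = \<bar>s - t\<bar>" using s by linarith
    then show False using d calculation by linarith
  qed
  ultimately show "x - f s = \<bar>s - t\<bar>" "\<bar>s - t\<bar> \<ge> (x - f t) / 2" using s by (simp_all add: abs_le_iff)
qed

section \<open>Implicit derivatives, comparison of increments, a barrier principle\<close>

lemma implicit_derivative:
  assumes h: "(h has_real_derivative H) (at (s t))" and H: "H \<noteq> 0"
    and k: "(k has_real_derivative K) (at t)" and s: "isCont s t"
    and eq: "\<forall>\<^sub>F r in nhds t. h (s r) = k r"
  shows "(s has_real_derivative K / H) (at t)"
proof -
  \<comment> \<open>The slope function of Caratheodory avoids a division by
    \<open>s r - s t\<close>, which may vanish.\<close>
  obtain q where q: "\<And>z. h z - h (s t) = q z * (z - s t)" "isCont q (s t)" "q (s t) = H"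
    using h by (auto simp: CARAT_DERIV)
  have qs: "((\<lambda>r. q (s r)) \<longlongrightarrow> H) (at t)"
    using isCont_o2[OF s q(2)] q(3) by (simp add: isCont_def)
  have "((\<lambda>r. (k r - k t) / (r - t) / q (s r)) \<longlongrightarrow> K / H) (at t)"
    using k qs H by (intro tendsto_divide) (auto simp: has_field_derivative_iff)
  moreover have "\<forall>\<^sub>F r in at t. (k r - k t) / (r - t) / q (s r) = (s r - s t) / (r - t)"
  proof -
    have "\<forall>\<^sub>F r in at t. q (s r) \<noteq> 0" using qs H tendsto_imp_eventually_ne by blast
    moreover have "\<forall>\<^sub>F r in at t. h (s r) = k r" using eq eventually_nhds_conv_at by blast
    ultimately show ?thesis
    proof eventually_elim
      case (elim r)
      have "k r - k t = q (s r) * (s r - s t)" using q(1)[of "s r"] elim(2) eventually_nhds_x_imp_x[OF eq] by simp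
      then show ?case using elim(1) by simp
    qed
  qed
  ultimately show ?thesis unfolding has_field_derivative_iff by (rule Lim_transform_eventually)
qed

lemma derivative_le_imp_diff_le:
  fixes f g :: "real \<Rightarrow> real"
  assumes "a \<le> b" "continuous_on {a..b} f" "continuous_on {a..b} g"
    and "\<And>t. a < t \<Longrightarrow> t < b \<Longrightarrow>
      \<exists>f' g'. (f has_real_derivative f') (at t) \<and> (g has_real_derivative g') (at t) \<and> f' \<le> g'"
  shows "f b - f a \<le> g b - g a"
proof -
  have "g a - f a \<le> g b - f b"
  proof (rule DERIV_nonneg_imp_increasing_open[OF assms(1), where f = "\<lambda>t. g t - f t"])
    fix t assume "a < t" "t < b"
    with assms(4) obtain f' g' where "(f has_real_derivative f') (at t)"
      "(g has_real_derivative g') (at t)" "f' \<le> g'" by blast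
    then show "\<exists>y. ((\<lambda>t. g t - f t) has_real_derivative y) (at t) \<and> 0 \<le> y"
      by (intro exI[of _ "g' - f'"] conjI DERIV_diff) auto
  qed (use assms in \<open>intro continuous_on_diff\<close>)
  then show ?thesis by simp
qed

lemma derivative_within_interior:
  fixes f :: "real \<Rightarrow> real"
  shows "(f has_real_derivative D) (at t within {a..}) \<Longrightarrow> a < t \<Longrightarrow> (f has_real_derivative D) (at t)"
  using at_within_interior[of t "{a..}"] by simp

text \<open>The bound \<open>c\<close> has to be checked only at times of decrease, and there the
  cruder bound \<open>m\<close> may be assumed for the whole past. If \<open>f\<close> fell below
  \<open>c\<close>, consider the stretch from the last visit to \<open>c\<close> to the first visit
  to a level between \<open>m\<close> and \<open>c\<close>: there \<open>f\<close> is below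
  \<open>c\<close> with a past above \<open>m\<close>, so it cannot decrease.\<close>

lemma barrier:
  fixes f f' :: "real \<Rightarrow> real"
  assumes der: "\<And>t. t \<ge> 0 \<Longrightarrow> (f has_real_derivative f' t) (at t)" and f0: "f 0 \<ge> c" and m: "m < c"
    and down: "\<And>\<xi>. \<xi> \<ge> 0 \<Longrightarrow> (\<And>t. 0 \<le> t \<Longrightarrow> t \<le> \<xi> \<Longrightarrow> f t > m) \<Longrightarrow> f' \<xi> < 0 \<Longrightarrow> f \<xi> \<ge> c"
    and t: "t \<ge> 0"
  shows "f t \<ge> c"
proof (rule ccontr)
  assume "\<not> f t \<ge> c"
  define l where "l = max (f t) ((m + c) / 2)"
  have l: "m < l" "l < c" "f t \<le> l" using \<open>\<not> f t \<ge> c\<close> m by (auto simp: l_def max_def field_simps)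
  have cont: "continuous_on {0..r} f" for r
    by (rule DERIV_continuous_on[of _ _ f']) (auto intro: has_field_derivative_at_within der)
  define t1 where "t1 = Inf {x \<in> {0..t}. f x \<le> l}"
  have cl: "closed {x \<in> {0..t}. f x \<le> l}"
  proof -
    have "{x \<in> {0..t}. f x \<le> l} = {0..t} \<inter> f -` {..l}" by auto
    then show ?thesis using continuous_closed_preimage[OF cont closed_atLeastAtMost closed_atMost] by metis
  qed
  have t1: "t1 \<in> {x \<in> {0..t}. f x \<le> l}"
    unfolding t1_def by (rule closed_contains_Inf[OF _ _ cl]) (use l t in \<open>auto intro!: bdd_belowI[of _ 0]\<close>)
  have above: "f x > l" if "0 \<le> x" "x < t1" for x
  proof (rule ccontr)
    assume "\<not> f x > l"
    then have "t1 \<le> x" unfolding t1_def using that t1 by (intro cInf_lower) (auto intro!: bdd_belowI[of _ 0])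
    then show False using that by simp
  qed
  define t2 where "t2 = Sup {x \<in> {0..t1}. f x \<ge> c}"
  have cl2: "closed {x \<in> {0..t1}. f x \<ge> c}"
  proof -
    have "{x \<in> {0..t1}. f x \<ge> c} = {0..t1} \<inter> f -` {c..}" by auto
    then show ?thesis using continuous_closed_preimage[OF cont closed_atLeastAtMost closed_atLeast] by metis
  qed
  have t2: "t2 \<in> {x \<in> {0..t1}. f x \<ge> c}"
    unfolding t2_def by (rule closed_contains_Sup[OF _ _ cl2]) (use f0 t1 in \<open>auto intro!: bdd_aboveI[of _ t1]\<close>)
  have below: "f x < c" if "t2 < x" "x \<le> t1" for x
  proof (rule ccontr)
    assume "\<not> f x < c"
    then have "x \<le> t2" unfolding t2_def using that t2 by (intro cSup_upper) (auto intro!: bdd_aboveI[of _ t1])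
    then show False using that by simp
  qed
  have "f t2 \<le> f t1"
  proof (rule DERIV_nonneg_imp_increasing_open[where f = f and a = t2 and b = t1])
    show "t2 \<le> t1" using t2 by simp
    show "continuous_on {t2..t1} f" using cont[of t1] t2 by (auto intro: continuous_on_subset)
    fix x assume x: "t2 < x" "x < t1"
    have "f y > m" if "0 \<le> y" "y \<le> x" for y
      using above[of y] x that l by simp
    then have "f' x \<ge> 0" using down[of x] below[of x] x t2 by force
    then show "\<exists>y. (f has_real_derivative y) (at x) \<and> 0 \<le> y" using der[of x] x t2 by auto
  qed
  then show False using t1 t2 l by simp
qed

section \<open>A priori bounds\<close>

text \<open>Both parts of the force are dominated by derivatives of arc tangents. In the retarded
  part \<open>rho\<close> is at most \<open>rho W\<close>. In the advanced part \<open>sig\<close>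
  has no bound independent of \<open>V\<close>, but its denominator is that of the derivative
  \<open>(1 + vx t) / (1 + vy (s t))\<close> of \<open>s\<close>, so passing from \<open>t\<close>
  to \<open>s t\<close> absorbs it. The result contains neither \<open>V\<close> nor
  \<open>\<delta>\<close>.\<close>

lemma impulse_bound:
  fixes x y vx vy p :: "real \<Rightarrow> real"
  assumes V: "0 \<le> V" "V < 1" and W: "0 \<le> W" "W < 1" and \<kappa>: "\<kappa> > 0" and \<theta>: "\<theta> > 0" and t0: "0 \<le> t0"
    and x: "\<And>t. (x has_real_derivative vx t) (at t)" and y: "\<And>t. (y has_real_derivative vy t) (at t)"
    and vx: "\<And>t. \<bar>vx t\<bar> \<le> V" "\<And>t. - W \<le> vx t" and vy: "\<And>t. \<bar>vy t\<bar> \<le> V" "\<And>t. vy t \<le> W"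
    and d: "\<And>t. t \<ge> t0 \<Longrightarrow> \<theta> * (1 + t) \<le> x t - y t"
    and p: "\<And>t. t \<ge> t0 \<Longrightarrow> (p has_real_derivative force \<kappa> \<delta> x y vy t) (at t within {t0..})"
    and t: "t \<ge> t0"
  shows "p t \<le> p t0 + \<kappa> / 2 * ((2 / \<theta> + 1)\<^sup>2 + 4 / \<theta>\<^sup>2) * (rho W + 2 / (1 - W)) * pi"
proof -
  define C where "C = (2 / \<theta> + 1)\<^sup>2 + 4 / \<theta>\<^sup>2"
  have C: "C \<ge> 0" by (simp add: C_def)
  define s where "s t = lightcone 1 y t (x t)" for t
  define r where "r t = lightcone (-1) y t (x t)" for t
  have ly: "\<bar>y s - y s'\<bar> \<le> V * \<bar>s - s'\<bar>" for s s'
    by (rule lipschitz_of_derivative[OF y vy(1)])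
  have lx: "\<bar>x s - x s'\<bar> \<le> V * \<bar>s - s'\<bar>" for s s'
    by (rule lipschitz_of_derivative[OF x vx(1)])
  have seq: "s t = t + \<bar>x t - y (s t)\<bar>" and req: "r t = t - \<bar>x t - y (r t)\<bar>" for t
    using lightcone_eq[OF V ly, of 1 t "x t"] lightcone_eq[OF V ly, of "-1" t "x t"] by (simp_all add: s_def r_def)
  have slip: "(1 - V) * \<bar>s t - s t'\<bar> \<le> 2 * \<bar>t - t'\<bar>" for t t'
  proof -
    have "V * \<bar>t - t'\<bar> \<le> 1 * \<bar>t - t'\<bar>" using V by (intro mult_right_mono) auto
    then show ?thesis using lightcone_dist[OF V ly ly, of 1 t "x t" t' "x t'"] lx[of t t'] by (simp add: s_def)
  qed
  have scont: "isCont s t" for t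
  proof -
    have "\<bar>s t' - s t\<bar> \<le> 2 / (1 - V) * \<bar>t' - t\<bar>" for t'
      using slip[of t' t] V by (simp add: field_simps)
    moreover have "((\<lambda>t'. 2 / (1 - V) * \<bar>t' - t\<bar>) \<longlongrightarrow> 2 / (1 - V) * \<bar>t - t\<bar>) (at t)" by (intro tendsto_intros)
    ultimately have "((\<lambda>t'. s t' - s t) \<longlongrightarrow> 0) (at t)"
      by (intro Lim_null_comparison[where f = "\<lambda>t'. s t' - s t"]) auto
    then show ?thesis by (simp add: isCont_def LIM_zero_iff)
  qed
  have dpos: "x t - y t > 0" if "t \<ge> t0" for t
    using d[OF that] \<theta> t0 that mult_pos_pos[of \<theta> "1 + t"] by linarith
  have spos: "x t - y (s t) = s t - t" if "t \<ge> t0" for t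
    using lightcone_pair(1)[of V y "s t" t "x t", OF V(2) ly dpos[OF that]] seq[of t] by linarith
  have near: "s t - t \<ge> (x t - y t) / 2" "t - r t \<ge> (x t - y t) / 2" if "t \<ge> t0" for t
    using lightcone_pair(2)[of V y "s t" t "x t", OF V(2) ly dpos[OF that]]
      lightcone_pair(2)[of V y "r t" t "x t", OF V(2) ly dpos[OF that]] seq[of t] req[of t] by linarith+
  have sder: "(s has_real_derivative (1 + vx t) / (1 + vy (s t))) (at t)" if "t > t0" for t
  proof (rule implicit_derivative)
    show "((\<lambda>z. z + y z) has_real_derivative 1 + vy (s t)) (at (s t))"
      by (intro DERIV_add DERIV_ident y)
    show "((\<lambda>z. z + x z) has_real_derivative 1 + vx t) (at t)"
      by (intro DERIV_add DERIV_ident x)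
    show "1 + vy (s t) \<noteq> 0" using vy(1)[of "s t"] V by linarith
    show "\<forall>\<^sub>F r in nhds t. s r + y (s r) = r + x r"
      using eventually_nhds_in_open[of "{t0<..}" t] that
      by (auto elim!: eventually_mono dest!: less_imp_le spos)
  qed (rule scont)
  \<comment> \<open>Used for \<open>z = t\<close> and \<open>z = s t\<close>, with \<open>D\<close>
    the length of the ray. Linear growth gives \<open>1 + t \<le> 2 / \<theta> * D\<close>, which
    bounds \<open>z\<close> by \<open>(2 / \<theta> + 1) * D\<close> and 1 by
    \<open>2 / \<theta> * D\<close>; the two squares make up \<open>C\<close>.\<close>
  have C_bound: "1 + z\<^sup>2 \<le> C * D\<^sup>2" if "D \<ge> (x t - y t) / 2" "\<bar>z\<bar> \<le> t + D" "t \<ge> t0" for D z t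
  proof -
    have D: "1 + t \<le> 2 / \<theta> * D" using that d[OF that(3)] \<theta> by (simp add: field_simps)
    have "z\<^sup>2 \<le> ((2 / \<theta> + 1) * D)\<^sup>2"
      using that D t0 by (intro abs_le_square_iff[THEN iffD1]) (simp add: distrib_right)
    moreover have "1\<^sup>2 \<le> (2 / \<theta> * D)\<^sup>2" using D t0 that by (intro power_mono) auto
    moreover have "C * D\<^sup>2 = ((2 / \<theta> + 1) * D)\<^sup>2 + (2 / \<theta> * D)\<^sup>2"
      unfolding C_def power_mult_distrib by (simp add: power_divide distrib_right)
    ultimately show ?thesis by simp
  qed
  have inv_bound: "1 / (max \<delta> D)\<^sup>2 \<le> C / (1 + z\<^sup>2)"
    if "D \<ge> (x t - y t) / 2" "\<bar>z\<bar> \<le> t + D" "t \<ge> t0" for D z t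
  proof -
    have D: "0 < D" using less_le_trans[OF half_gt_zero[OF dpos[OF that(3)]] that(1)] .
    then have "0 < D\<^sup>2" "D\<^sup>2 \<le> (max \<delta> D)\<^sup>2" by (auto intro: power_mono)
    then have "1 / (max \<delta> D)\<^sup>2 \<le> 1 / D\<^sup>2" by (intro frac_le) auto
    also have "\<dots> \<le> C / (1 + z\<^sup>2)"
      using C_bound[OF that] \<open>0 < D\<^sup>2\<close> one_plus_square_pos[of z] by (simp add: field_simps)
    finally show ?thesis .
  qed
  let ?g = "\<lambda>t. \<kappa> / 2 * C * (rho W * arctan t + 2 / (1 - W) * arctan (s t))"
  have "p t - p t0 \<le> ?g t - ?g t0"
  proof (rule derivative_le_imp_diff_le[OF t])
    show "continuous_on {t0..t} p"
      by (rule continuous_on_subset[of "{t0..}"])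
        (auto intro: DERIV_continuous_on[of _ p] p)
    show "continuous_on {t0..t} ?g"
      using scont by (intro continuous_intros continuous_at_imp_continuous_on) auto
    fix u assume u: "t0 < u" "u < t"
    have W1: "\<bar>W\<bar> < 1" and vy1: "\<bar>vy z\<bar> < 1" for z using W V vy(1)[of z] by auto
    have "rho (vy (r u)) / (max \<delta> \<bar>u - r u\<bar>)\<^sup>2 \<le> rho W * (C / (1 + u\<^sup>2))"
    proof -
      have "rho (vy (r u)) * (1 / (max \<delta> \<bar>u - r u\<bar>)\<^sup>2) \<le> rho W * (C / (1 + u\<^sup>2))"
        using near[of u] u t0 dpos[of u] vy(2) W1 vy1
        by (intro mult_mono rho_mono inv_bound[of u]) (auto intro: less_imp_le rho_pos)
      then show ?thesis by simp
    qed
    moreover have "sig (vy (s u)) / (max \<delta> \<bar>u - s u\<bar>)\<^sup>2 \<le>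
        2 / (1 - W) * ((1 + vx u) / (1 + vy (s u))) * (C / (1 + (s u)\<^sup>2))"
    proof -
      \<comment> \<open>Origin of the factor \<open>2 / (1 - W)\<close>: the numerator of
        \<open>sig\<close> is at most 2, and the missing numerator \<open>1 + vx u\<close> is at
        least \<open>1 - W\<close>.\<close>
      have "1 - W \<le> 1 + vx u" using vx(2)[of u] by simp
      then have "(1 - W) * (1 - vy (s u)) \<le> (1 + vx u) * 2"
        using W vy1[of "s u"] by (intro mult_mono) auto
      then have "sig (vy (s u)) \<le> 2 / (1 - W) * ((1 + vx u) / (1 + vy (s u)))"
      proof -
        have "1 - vy (s u) \<le> 2 / (1 - W) * (1 + vx u)"
          using \<open>(1 - W) * (1 - vy (s u)) \<le> (1 + vx u) * 2\<close> W by (simp add: field_simps)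
        then have "(1 - vy (s u)) / (1 + vy (s u)) \<le> 2 / (1 - W) * (1 + vx u) / (1 + vy (s u))"
          using vy1[of "s u"] by (intro divide_right_mono) auto
        then show ?thesis by (simp add: sig_def)
      qed
      moreover have "1 / (max \<delta> \<bar>u - s u\<bar>)\<^sup>2 \<le> C / (1 + (s u)\<^sup>2)"
        using near[of u] u t0 dpos[of u] by (intro inv_bound[of u]) auto
      ultimately have "sig (vy (s u)) * (1 / (max \<delta> \<bar>u - s u\<bar>)\<^sup>2) \<le>
        2 / (1 - W) * ((1 + vx u) / (1 + vy (s u))) * (C / (1 + (s u)\<^sup>2))"
        using sig_pos[OF vy1[of "s u"]] by (intro mult_mono) auto
      then show ?thesis by simp
    qed
    ultimately have sum: "rho (vy (r u)) / (max \<delta> \<bar>u - r u\<bar>)\<^sup>2 + sig (vy (s u)) / (max \<delta> \<bar>u - s u\<bar>)\<^sup>2 \<le>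
       rho W * (C / (1 + u\<^sup>2)) + 2 / (1 - W) * ((1 + vx u) / (1 + vy (s u))) * (C / (1 + (s u)\<^sup>2))"
      by (rule add_mono)
    have "force \<kappa> \<delta> x y vy u \<le>
       \<kappa> / 2 * (rho W * (C / (1 + u\<^sup>2)) + 2 / (1 - W) * ((1 + vx u) / (1 + vy (s u))) * (C / (1 + (s u)\<^sup>2)))"
      using mult_left_mono[OF sum, of "\<kappa> / 2"] \<kappa> unfolding force_def r_def s_def by simp
    also have "\<dots> = \<kappa> / 2 * C * (rho W * inverse (1 + u\<^sup>2) +
        2 / (1 - W) * (inverse (1 + (s u)\<^sup>2) * ((1 + vx u) / (1 + vy (s u)))))"
    proof -
      have "\<kappa> / 2 * (R * (C * A) + K * q * (C * B)) = \<kappa> / 2 * C * (R * A + K * (B * q))" for R A K q B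
        by (simp add: algebra_simps)
      then show ?thesis unfolding divide_inverse[of C] .
    qed
    finally have le: "force \<kappa> \<delta> x y vy u \<le> \<dots>" .
    have "(?g has_real_derivative \<kappa> / 2 * C * (rho W * inverse (1 + u\<^sup>2) +
        2 / (1 - W) * (inverse (1 + (s u)\<^sup>2) * ((1 + vx u) / (1 + vy (s u)))))) (at u)"
      by (intro DERIV_cmult DERIV_add DERIV_arctan DERIV_chain2[OF DERIV_arctan] sder u)
    moreover have "(p has_real_derivative force \<kappa> \<delta> x y vy u) (at u)"
      using p[of u] u by (intro derivative_within_interior[of p _ u t0]) auto
    ultimately show "\<exists>f' g'. (p has_real_derivative f') (at u) \<and> (?g has_real_derivative g') (at u) \<and> f' \<le> g'"
      using le by blast
  qed
  also have "?g t - ?g t0 = \<kappa> / 2 * C * (rho W * (arctan t - arctan t0) + 2 / (1 - W) * (arctan (s t) - arctan (s t0)))"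
  proof -
    have "k * (R * A + K * B) - k * (R * A' + K * B') = k * (R * (A - A') + K * (B - B'))" for k R A A' K B B' :: real
      by (simp add: algebra_simps)
    then show ?thesis .
  qed
  also have "\<dots> \<le> \<kappa> / 2 * C * (rho W * pi + 2 / (1 - W) * pi)"
  proof -
    have "arctan u - arctan v \<le> pi" for u v using arctan_bounded[of u] arctan_bounded[of v] by linarith
    moreover have "0 \<le> rho W" using rho_pos[of W] W by simp
    ultimately show ?thesis using W C \<kappa> by (intro mult_left_mono add_mono) auto
  qed
  also have "\<dots> = \<kappa> / 2 * C * (rho W + 2 / (1 - W)) * pi"
    by (simp only: distrib_right mult.assoc)
  finally show ?thesis unfolding C_def by linarith
qed

section \<open>Constants of the a priori bounds\<close>

locale bounds =
  fixes W Tp d0 \<kappa>a \<kappa>b :: real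
  assumes W: "0 \<le> W" "W < 1" and Tp: "0 \<le> Tp" and d0: "d0 > 0" and \<kappa>a: "\<kappa>a > 0" and \<kappa>b: "\<kappa>b > 0"
begin

text \<open>A speed bound in force while the relative velocity is at most
  \<open>(1 - W) / 2\<close>: \<open>va\<close> exceeds \<open>vb \<le> W\<close>, and
  \<open>vb\<close> falls below \<open>va \<ge> - W\<close>, by no more than this amount.\<close>

definition W' :: real where "W' = (1 + W) / 2"

text \<open>Lower bound for the force on \<open>a\<close> times the squared distance, from the
  retarded part: \<open>- c\<close> bounds the past velocities of \<open>b\<close> from below, and
  \<open>vb \<le> W\<close> makes the retarded distance at most \<open>1 / (1 - W)\<close> times the
  present one.\<close>

definition gain :: "real \<Rightarrow> real" where
  "gain c = \<kappa>a / 2 * rho (- c) * (1 - W)\<^sup>2"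

text \<open>Solves \<open>K / dmin = K / d0 + 2 * mom W\<close> for \<open>K = gain W / 2\<close>:
  the quantity \<open>K / d\<close> grows by no more than the momentum gained by \<open>a\<close>,
  which is at most \<open>2 * mom W\<close> during an approach.\<close>

definition dmin :: real where
  "dmin = 1 / (1 / d0 + 2 * mom W / (gain W / 2))"

text \<open>Bound for the distance up to \<open>T0\<close> if the relative velocity stays at most
  \<open>1 / T0\<close> after \<open>Tp\<close>: the increase is at most \<open>2 * Tp\<close>
  before \<open>Tp\<close> and at most 1 afterwards.\<close>

definition dmax :: real where
  "dmax = d0 + 2 * Tp + 1"

text \<open>A force of at least \<open>gain W' / dmax\<^sup>2\<close> acting from \<open>Tp\<close>
  to \<open>T0\<close> transfers more than the momentum \<open>2 * mom W'\<close>. The summand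
  \<open>2 / (1 - W)\<close> ensures \<open>1 / T0 \<le> (1 - W) / 2\<close>.\<close>

definition T0 :: real where
  "T0 = Tp + 2 / (1 - W) + (2 * mom W' * dmax\<^sup>2 + 1) / gain W'"

text \<open>The first entry serves the times up to \<open>T0\<close>, when the distance is at least
  \<open>dmin\<close>; the second one the later times, when it grows at a rate above
  \<open>1 / T0\<close>.\<close>

definition \<theta> :: real where
  "\<theta> = min (dmin / (1 + T0)) (1 / T0)"

definition pmax :: real where
  "pmax = mom W' + max \<kappa>a \<kappa>b / 2 * ((2 / \<theta> + 1)\<^sup>2 + 4 / \<theta>\<^sup>2) * (rho W + 2 / (1 - W)) * pi"

lemma W': "0 \<le> W'" "W' < 1" "W \<le> W'"
  using W by (auto simp: W'_def)

lemma gain_pos: "0 \<le> c \<Longrightarrow> c < 1 \<Longrightarrow> gain c > 0"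
  using W \<kappa>a rho_pos[of "- c"] by (simp add: gain_def)

lemma mom_nonneg: "0 \<le> v \<Longrightarrow> v < 1 \<Longrightarrow> 0 \<le> mom v"
  using mom_le[of 0 v] by (simp add: mom_def)

lemma dmin: "0 < dmin" "dmin \<le> d0"
proof -
  have g: "0 \<le> 2 * mom W / (gain W / 2)" using gain_pos[OF W] mom_nonneg[OF W] by simp
  then have "0 < 1 / d0 + 2 * mom W / (gain W / 2)" using d0 by (simp add: add_pos_nonneg)
  then show "0 < dmin" by (simp add: dmin_def)
  have "dmin \<le> 1 / (1 / d0)" unfolding dmin_def using g d0 by (intro divide_left_mono) (auto simp: add_pos_nonneg)
  then show "dmin \<le> d0" by simp
qed

lemma T0: "T0 \<ge> Tp" "T0 > 0" "1 / T0 \<le> (1 - W) / 2" "gain W' * (T0 - Tp) > 2 * mom W' * dmax\<^sup>2"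
proof -
  have g: "gain W' > 0" and m: "0 \<le> mom W'" using gain_pos W' mom_nonneg by auto
  have e: "(2 * mom W' * dmax\<^sup>2 + 1) / gain W' > 0" using g m by (intro divide_pos_pos add_nonneg_pos) auto
  have w: "2 / (1 - W) > 0" using W by simp
  show "T0 \<ge> Tp" "T0 > 0" using e w Tp unfolding T0_def by linarith+
  have "2 / (1 - W) \<le> T0" using e Tp unfolding T0_def by linarith
  then show "1 / T0 \<le> (1 - W) / 2" using \<open>T0 > 0\<close> W by (simp add: field_simps)
  have "2 * mom W' * dmax\<^sup>2 < gain W' * ((2 * mom W' * dmax\<^sup>2 + 1) / gain W')" using g by simp
  also have "\<dots> \<le> gain W' * (T0 - Tp)" using g w by (intro mult_left_mono) (auto simp: T0_def)
  finally show "gain W' * (T0 - Tp) > 2 * mom W' * dmax\<^sup>2" .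
qed

lemma \<theta>: "\<theta> > 0"
  using dmin T0 by (simp add: \<theta>_def)

end

text \<open>The system with momenta clamped to \<open>[-M, M]\<close> in the velocities and distances cut off below \<open>\<delta>\<close>
  in the forces.  No bound proved in this locale depends on \<open>M\<close>, \<open>V\<close> or \<open>\<delta>\<close>.\<close>

locale clamped = bounds +
  fixes M V \<delta> :: real and a b va vb pa pb :: "real \<Rightarrow> real"
  assumes V: "0 \<le> V" "V < 1" and \<delta>: "0 < \<delta>" "\<delta> < dmin" and M: "M > mom W'"
    and a: "\<And>t. (a has_real_derivative va t) (at t)" and b: "\<And>t. (b has_real_derivative vb t) (at t)"
    and va: "\<And>t. \<bar>va t\<bar> \<le> V" and vb: "\<And>t. \<bar>vb t\<bar> \<le> V"
    and va_early: "\<And>t. t \<le> 0 \<Longrightarrow> va t = va 0" and vb_early: "\<And>t. t \<le> Tp \<Longrightarrow> \<bar>vb t\<bar> \<le> W"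
    and va_pa: "\<And>t. t \<ge> 0 \<Longrightarrow> va t = vel (max (- M) (min M (pa t)))"
    and vb_pb: "\<And>t. t \<ge> Tp \<Longrightarrow> vb t = vel (max (- M) (min M (pb t)))"
    and pa0: "\<bar>pa 0\<bar> \<le> mom W" and pbTp: "\<bar>pb Tp\<bar> \<le> mom W"
    and pa: "\<And>t. t \<ge> 0 \<Longrightarrow> (pa has_real_derivative force \<kappa>a \<delta> a b vb t) (at t within {0..})"
    and pb: "\<And>t. t \<ge> Tp \<Longrightarrow> (pb has_real_derivative
       - force \<kappa>b \<delta> (\<lambda>s. - b s) (\<lambda>s. - a s) (\<lambda>s. - va s) t) (at t within {Tp..})"
    and start: "a 0 - b 0 = d0"
begin

section \<open>Monotonicity of momenta and velocities\<close>

lemma speeds: "\<bar>va t\<bar> < 1" "\<bar>vb t\<bar> < 1"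
  using va[of t] vb[of t] V by auto

lemma force_a_nonneg: "0 \<le> force \<kappa>a \<delta> a b vb t"
  using speeds \<kappa>a by (intro force_nonneg)

lemma force_b_nonneg: "0 \<le> force \<kappa>b \<delta> (\<lambda>s. - b s) (\<lambda>s. - a s) (\<lambda>s. - va s) t"
  using speeds \<kappa>b by (intro force_nonneg) auto

lemma pa_cont: "0 \<le> r \<Longrightarrow> continuous_on {r..s} pa"
  by (rule continuous_on_subset[of "{0..}"]) (auto intro: DERIV_continuous_on[of _ pa] pa)

lemma pb_cont: "Tp \<le> r \<Longrightarrow> continuous_on {r..s} pb"
  by (rule continuous_on_subset[of "{Tp..}"]) (auto intro: DERIV_continuous_on[of _ pb] pb)

lemma pa_der: "0 < t \<Longrightarrow> (pa has_real_derivative force \<kappa>a \<delta> a b vb t) (at t)"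
  using pa[of t] by (intro derivative_within_interior[of pa _ t 0]) auto

lemma pb_der: "Tp < t \<Longrightarrow> (pb has_real_derivative
    - force \<kappa>b \<delta> (\<lambda>s. - b s) (\<lambda>s. - a s) (\<lambda>s. - va s) t) (at t)"
  using pb[of t] by (intro derivative_within_interior[of pb _ t Tp]) auto

lemma pa_mono:
  assumes "0 \<le> s" "s \<le> t"
  shows "pa s \<le> pa t"
proof (rule DERIV_nonneg_imp_increasing_open[where f = pa, OF assms(2) _ pa_cont[OF assms(1)]])
  fix x assume "s < x"
  then show "\<exists>y. (pa has_real_derivative y) (at x) \<and> 0 \<le> y"
    using pa_der[of x] force_a_nonneg[of x] assms(1) by (intro exI conjI) auto
qed

lemma pb_antimono:
  assumes "Tp \<le> s" "s \<le> t"
  shows "pb t \<le> pb s"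
proof (rule DERIV_nonpos_imp_decreasing_open[where f = pb, OF assms(2) _ pb_cont[OF assms(1)]])
  fix x assume "s < x"
  then show "\<exists>y. (pb has_real_derivative y) (at x) \<and> y \<le> 0"
    using pb_der[of x] force_b_nonneg[of x] assms(1) by (intro exI conjI) auto
qed

lemma va_mono: "s \<le> t \<Longrightarrow> va s \<le> va t"
proof -
  assume "s \<le> t"
  then have "pa (max s 0) \<le> pa (max t 0)" by (intro pa_mono) auto
  then have "va (max s 0) \<le> va (max t 0)" by (auto simp: va_pa)
  moreover have "va (max z 0) = va z" for z using va_early[of z] by (simp add: max_def)
  ultimately show ?thesis by simp
qed

lemma vb_antimono: "Tp \<le> s \<Longrightarrow> s \<le> t \<Longrightarrow> vb t \<le> vb s"
  using pb_antimono[of s t] by (auto simp: vb_pb)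

text \<open>A velocity sees only the clamped momentum; if the bound on it corresponds to a momentum
  below \<open>M\<close>, the upper clamp cannot be active and the momentum itself is
  bounded.\<close>

lemma clamp_vel_le:
  assumes "vel (max (- M) (min M p)) \<le> c" "\<bar>c\<bar> < 1" "mom c < M"
  shows "p \<le> mom c"
proof -
  have "max (- M) (min M p) \<le> mom c" using assms by (metis vel_le_iff vel_mom)
  then show ?thesis using assms(3) by linarith
qed

lemma mom_W: "mom W < M"
  using mom_le[of W W'] W' W M by simp

lemma vel_clamp_abs: "\<bar>p\<bar> \<le> mom W \<Longrightarrow> \<bar>vel (max (- M) (min M p))\<bar> \<le> W"
proof -
  assume p: "\<bar>p\<bar> \<le> mom W"
  then have "max (- M) (min M p) = p" using mom_W by auto
  moreover have "vel p \<le> vel (mom W)" "vel (- mom W) \<le> vel p" using p by (auto simp: abs_le_iff)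
  ultimately show ?thesis using W by (simp add: vel_mom vel_uminus abs_le_iff)
qed

text \<open>Repulsion only increases \<open>va\<close>, so the bound at time 0 persists. This
  one-sided bound and \<open>vb_le\<close> replace the two-sided ones that would depend on
  \<open>M\<close>.\<close>

lemma va_ge: "- W \<le> va t"
proof -
  have "- W \<le> va 0" using vel_clamp_abs[OF pa0] va_pa[of 0] by simp
  then show ?thesis using va_mono[of 0 t] va_early[of t] by (cases "t \<le> 0") auto
qed

lemma vb_le: "vb t \<le> W"
proof -
  have "vb Tp \<le> W" using vel_clamp_abs[OF pbTp] vb_pb[of Tp] by simp
  then show ?thesis using vb_antimono[of Tp t] vb_early[of t] by (cases "t \<le> Tp") auto
qed

section \<open>Distance of the particles: lower bound and linear growth\<close>

lemma lip_a: "\<bar>a s - a s'\<bar> \<le> V * \<bar>s - s'\<bar>"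
  by (rule lipschitz_of_derivative[OF a va])

lemma lip_b: "\<bar>b s - b s'\<bar> \<le> V * \<bar>s - s'\<bar>"
  by (rule lipschitz_of_derivative[OF b vb])

lemma retarded_le:
  assumes "a t - b t > 0"
  shows "(1 - W) * \<bar>t - lightcone (-1) b t (a t)\<bar> \<le> a t - b t"
proof -
  define r where "r = lightcone (-1) b t (a t)"
  have r: "r = t - \<bar>a t - b r\<bar>" using lightcone_eq[OF V lip_b, of "-1" t "a t"] by (simp add: r_def)
  then have "a t - b r = \<bar>r - t\<bar>" using lightcone_pair(1)[of V b r t "a t", OF V(2) lip_b assms] by linarith
  moreover have "b t - b r \<le> W * t - W * r"
  proof (rule derivative_le_imp_diff_le[where g = "\<lambda>z. W * z"])
    show "r \<le> t" using r by linarith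
    show "continuous_on {r..t} b" by (meson DERIV_isCont b continuous_at_imp_continuous_on)
    show "\<exists>f' g'. (b has_real_derivative f') (at z) \<and> ((*) W has_real_derivative g') (at z) \<and> f' \<le> g'" for z
      using b vb_le DERIV_cmult_Id by blast
  qed (intro continuous_intros)
  moreover have "r \<le> t" using r by linarith
  ultimately have "(1 - W) * (t - r) \<le> a t - b t" by (simp add: algebra_simps)
  then show ?thesis using \<open>r \<le> t\<close> unfolding r_def by simp
qed

text \<open>Only the retarded part is estimated, the advanced one being nonnegative. The retarded
  time lies in the past, so \<open>c\<close> concerns velocities of \<open>b\<close> up to
  \<open>t\<close> and can be supplied by monotonicity.\<close>

lemma force_a_ge:
  assumes D: "0 < a t - b t" "a t - b t \<le> D" "\<delta> \<le> D"
    and c: "0 \<le> c" "c < 1" "\<And>r. r \<le> t \<Longrightarrow> - c \<le> vb r"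
  shows "gain c / D\<^sup>2 \<le> force \<kappa>a \<delta> a b vb t"
proof -
  define r where "r = lightcone (-1) b t (a t)"
  define s where "s = lightcone 1 b t (a t)"
  have "r = t - \<bar>a t - b r\<bar>" using lightcone_eq[OF V lip_b, of "-1" t "a t"] by (simp add: r_def)
  then have rho: "rho (- c) \<le> rho (vb r)" using c speeds(2)[of r] by (intro rho_mono) auto
  have D0: "D > 0" using D by simp
  have "\<bar>t - r\<bar> \<le> D / (1 - W)" using retarded_le[OF D(1)] D(2) W by (simp add: r_def field_simps)
  moreover have "\<delta> \<le> D / (1 - W)"
  proof -
    have "D * (1 - W) \<le> D * 1" using D0 W by (intro mult_left_mono) auto
    then have "D \<le> D / (1 - W)" using W by (simp add: pos_le_divide_eq)
    then show ?thesis using D(3) by simp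
  qed
  ultimately have "(max \<delta> \<bar>t - r\<bar>)\<^sup>2 \<le> (D / (1 - W))\<^sup>2" using \<delta> by (intro power_mono) auto
  then have "rho (- c) / (D / (1 - W))\<^sup>2 \<le> rho (vb r) / (max \<delta> \<bar>t - r\<bar>)\<^sup>2"
    using rho rho_pos[of "- c"] c \<delta> by (intro frac_le) (auto simp: less_max_iff_disj)
  moreover have "0 \<le> sig (vb s) / (max \<delta> \<bar>t - s\<bar>)\<^sup>2" using sig_pos[OF speeds(2)] by (auto simp: less_imp_le)
  ultimately have sum: "rho (- c) / (D / (1 - W))\<^sup>2 \<le> rho (vb r) / (max \<delta> \<bar>t - r\<bar>)\<^sup>2 + sig (vb s) / (max \<delta> \<bar>t - s\<bar>)\<^sup>2"
    by linarith
  have "gain c / D\<^sup>2 = \<kappa>a / 2 * (rho (- c) / (D / (1 - W))\<^sup>2)" using W by (simp add: gain_def power_divide)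
  also have "\<dots> \<le> force \<kappa>a \<delta> a b vb t"
    using mult_left_mono[OF sum, of "\<kappa>a / 2"] \<kappa>a by (simp add: force_def r_def s_def)
  finally show ?thesis .
qed

lemma distance_derivative: "((\<lambda>t. a t - b t) has_real_derivative va t - vb t) (at t)"
  by (intro DERIV_diff a b)

lemma distance_continuous: "continuous_on S (\<lambda>t. a t - b t)"
  by (rule continuous_at_imp_continuous_on) (use DERIV_isCont[OF distance_derivative] in blast)

text \<open>At a time \<open>\<xi>\<close> of approach \<open>va \<xi>\<close> is below
  \<open>vb \<xi> \<le> W\<close>, hence \<open>pa \<xi> \<le> mom W\<close>, and the velocities of
  \<open>b\<close> up to \<open>\<xi>\<close> are at least \<open>- W\<close>. So \<open>a\<close>
  has gained at most \<open>2 * mom W\<close>, and this gain dominates the increase of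
  \<open>K / (a - b)\<close>. The provisional bound \<open>\<delta>\<close> of the barrier principle
  provides the hypothesis on the cutoff in \<open>force_a_ge\<close>.\<close>

lemma distance_ge:
  assumes "t \<ge> 0"
  shows "dmin \<le> a t - b t"
proof (rule barrier[where m = \<delta>, OF _ _ \<delta>(2) _ assms])
  fix \<xi> :: real assume \<xi>: "0 \<le> \<xi>" and pos: "\<And>t. 0 \<le> t \<Longrightarrow> t \<le> \<xi> \<Longrightarrow> \<delta> < a t - b t" and neg: "va \<xi> - vb \<xi> < 0"
  \<comment> \<open>As \<open>vb - va\<close> is less than 2, the derivative of
    \<open>K / (a - b)\<close> is at most \<open>2 * K / (a - b)\<^sup>2\<close>, and
    \<open>2 * K\<close> is \<open>gain W\<close>.\<close>
  define K where "K = gain W / 2"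
  have K: "K > 0" using gain_pos[OF W] by (simp add: K_def)
  have vb_ge: "- W \<le> vb r" if "r \<le> \<xi>" for r
    using vb_early[of r] vb_antimono[of r \<xi>] that neg va_ge[of \<xi>] by (cases "r \<le> Tp") auto
  have "(\<lambda>t. K / (a t - b t)) \<xi> - (\<lambda>t. K / (a t - b t)) 0 \<le> pa \<xi> - pa 0"
  proof (rule derivative_le_imp_diff_le[OF \<xi>])
    show "continuous_on {0..\<xi>} (\<lambda>t. K / (a t - b t))"
      using pos \<delta> by (intro continuous_on_divide continuous_on_const distance_continuous) force
    show "continuous_on {0..\<xi>} pa" by (rule pa_cont) simp
    fix t assume t: "0 < t" "t < \<xi>"
    have d: "\<delta> < a t - b t" using pos t by simp
    have "((\<lambda>t. K / (a t - b t)) has_real_derivative (0 * (a t - b t) - K * (va t - vb t)) / ((a t - b t) * (a t - b t))) (at t)"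
      using d \<delta> by (intro DERIV_divide DERIV_const distance_derivative) auto
    moreover have "(0 * (a t - b t) - K * (va t - vb t)) / ((a t - b t) * (a t - b t)) \<le> force \<kappa>a \<delta> a b vb t"
    proof -
      have "K * (vb t - va t) \<le> K * 2" using K speeds[of t] by (intro mult_left_mono) auto
      then have "0 * (a t - b t) - K * (va t - vb t) \<le> gain W" by (simp add: K_def right_diff_distrib)
      then have "(0 * (a t - b t) - K * (va t - vb t)) / ((a t - b t) * (a t - b t)) \<le> gain W / (a t - b t)\<^sup>2"
        unfolding power2_eq_square by (rule divide_right_mono) (rule zero_le_square)
      also have "\<dots> \<le> force \<kappa>a \<delta> a b vb t" using d \<delta> W t vb_ge by (intro force_a_ge) auto
      finally show ?thesis .
    qed
    ultimately show "\<exists>f' g'. ((\<lambda>t. K / (a t - b t)) has_real_derivative f') (at t) \<and> (pa has_real_derivative g') (at t) \<and> f' \<le> g'"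
      using pa_der t by blast
  qed
  moreover have "pa \<xi> \<le> mom W"
  proof (rule clamp_vel_le)
    show "vel (max (- M) (min M (pa \<xi>))) \<le> W" using va_pa[OF \<xi>] neg vb_le[of \<xi>] by simp
  qed (use W mom_W in auto)
  ultimately have "K / (a \<xi> - b \<xi>) \<le> K / d0 + 2 * mom W" using pa0 start by (simp add: abs_le_iff)
  then have "1 / (a \<xi> - b \<xi>) \<le> 1 / d0 + 2 * mom W / K" using K by (simp add: field_simps)
  then have "1 / (a \<xi> - b \<xi>) \<le> 1 / dmin" by (simp add: dmin_def K_def)
  then show "dmin \<le> a \<xi> - b \<xi>" using pos[of \<xi>] \<xi> \<delta> dmin by (simp add: field_simps)
qed (use start dmin distance_derivative in auto)

text \<open>Were the relative velocity at \<open>T0\<close> at most \<open>1 / T0\<close>, it would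
  be so since \<open>Tp\<close> by monotonicity. The particles would remain within
  \<open>dmax\<close>, and the impulse on \<open>a\<close> would exceed what the speed bound
  \<open>W'\<close> at \<open>T0\<close> permits.\<close>

lemma separation: "1 / T0 < va T0 - vb T0"
proof (rule ccontr)
  define \<eta> where "\<eta> = 1 / T0"
  assume "\<not> 1 / T0 < va T0 - vb T0"
  then have le: "va T0 - vb T0 \<le> \<eta>" by (simp add: \<eta>_def)
  have \<eta>: "0 < \<eta>" "\<eta> \<le> (1 - W) / 2" "\<eta> * T0 = 1" using T0 by (auto simp: \<eta>_def)
  have le': "va t - vb t \<le> \<eta>" if "Tp \<le> t" "t \<le> T0" for t
    using va_mono[of t T0] vb_antimono[of t T0] that le by linarith
  \<comment> \<open>After \<open>Tp\<close> the value of \<open>vb\<close> at \<open>T0\<close> is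
    the worst case; it lies at most \<open>\<eta>\<close> below
    \<open>va T0 \<ge> - W\<close>.\<close>
  have vb_ge: "- W' \<le> vb r" if "r \<le> T0" for r
  proof (cases "r \<le> Tp")
    case True
    then show ?thesis using vb_early[of r] W' by auto
  next
    case False
    then have "vb T0 \<le> vb r" using vb_antimono[of r T0] that by simp
    moreover have "(1 - W) / 2 = W' - W" by (simp add: W'_def field_simps)
    ultimately show ?thesis using le va_ge[of T0] \<eta>(2) by linarith
  qed
  have dTp: "a Tp - b Tp \<le> d0 + 2 * Tp"
  proof -
    have "(a Tp - b Tp) - (a 0 - b 0) \<le> 2 * Tp - 2 * 0"
    proof (rule derivative_le_imp_diff_le[OF Tp distance_continuous])
      show "\<exists>f' g'. ((\<lambda>t. a t - b t) has_real_derivative f') (at t) \<and> ((\<lambda>t. 2 * t) has_real_derivative g') (at t) \<and> f' \<le> g'" for t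
        using distance_derivative[of t] DERIV_cmult_Id[of "2::real" t UNIV] speeds[of t]
        by (intro exI[of _ "va t - vb t"] exI[of _ 2]) auto
    qed (intro continuous_intros)
    then show ?thesis using start by simp
  qed
  have d: "a t - b t \<le> dmax" if t: "Tp \<le> t" "t \<le> T0" for t
  proof -
    have "(a t - b t) - (a Tp - b Tp) \<le> \<eta> * t - \<eta> * Tp"
    proof (rule derivative_le_imp_diff_le[OF t(1) distance_continuous])
      fix u assume "Tp < u" "u < t"
      then show "\<exists>f' g'. ((\<lambda>t. a t - b t) has_real_derivative f') (at u) \<and> ((*) \<eta> has_real_derivative g') (at u) \<and> f' \<le> g'"
        using distance_derivative[of u] DERIV_cmult_Id[of \<eta> u UNIV] le'[of u] t
        by (intro exI[of _ "va u - vb u"] exI[of _ \<eta>]) auto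
    qed (intro continuous_intros)
    moreover have "\<eta> * t \<le> \<eta> * T0" "0 \<le> \<eta> * Tp"
      using \<eta>(1) t Tp by (auto intro!: mult_left_mono mult_nonneg_nonneg simp del: mult_le_cancel_left_pos)
    ultimately show ?thesis using dTp \<eta>(3) unfolding dmax_def by linarith
  qed
  have dm: "0 < dmax" "\<delta> \<le> dmax" using d0 Tp \<delta> dmin by (auto simp: dmax_def)
  have "gain W' / dmax\<^sup>2 * T0 - gain W' / dmax\<^sup>2 * Tp \<le> pa T0 - pa Tp"
  proof (rule derivative_le_imp_diff_le[OF T0(1) _ pa_cont[OF Tp]])
    fix t assume t: "Tp < t" "t < T0"
    have "gain W' / dmax\<^sup>2 \<le> force \<kappa>a \<delta> a b vb t"
      using distance_ge[of t] dmin d[of t] t Tp W' vb_ge dm by (intro force_a_ge) auto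
    then show "\<exists>f' g'. ((*) (gain W' / dmax\<^sup>2) has_real_derivative f') (at t) \<and> (pa has_real_derivative g') (at t) \<and> f' \<le> g'"
      using pa_der[of t] DERIV_cmult_Id[of "gain W' / dmax\<^sup>2" t UNIV] t Tp by force
  qed (intro continuous_intros)
  moreover have "pa T0 \<le> mom W'"
  proof (rule clamp_vel_le)
    have "W + (1 - W) / 2 = W'" by (simp add: W'_def field_simps)
    then have "va T0 \<le> W'" using le vb_le[of T0] \<eta>(2) by linarith
    then show "vel (max (- M) (min M (pa T0))) \<le> W'" using va_pa[of T0] T0 by simp
  qed (use W' M in auto)
  moreover have "- mom W' \<le> pa Tp" using pa_mono[of 0 Tp] Tp pa0 mom_le[of W W'] W W' by (auto simp: abs_le_iff)
  ultimately have "gain W' / dmax\<^sup>2 * (T0 - Tp) \<le> 2 * mom W'" by (simp add: right_diff_distrib)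
  then have "gain W' * (T0 - Tp) \<le> 2 * mom W' * dmax\<^sup>2" using dm by (simp add: field_simps)
  then show False using T0(4) by simp
qed

lemma distance_linear:
  assumes t: "t \<ge> 0"
  shows "\<theta> * (1 + t) \<le> a t - b t"
proof -
  have "\<theta> \<le> dmin / (1 + T0)" by (simp add: \<theta>_def)
  then have le: "\<theta> * (1 + T0) \<le> dmin" "\<theta> \<le> 1 / T0" using T0(2) by (simp add: pos_le_divide_eq, simp add: \<theta>_def)
  show ?thesis
  proof (cases "t \<le> T0")
    case True
    then have "\<theta> * (1 + t) \<le> \<theta> * (1 + T0)" using \<theta> by (intro mult_left_mono) auto
    then show ?thesis using le distance_ge[OF t] by linarith
  next
    case False
    have "\<theta> * t - \<theta> * T0 \<le> (a t - b t) - (a T0 - b T0)"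
    proof (rule derivative_le_imp_diff_le[OF _ _ distance_continuous])
      fix u assume u: "T0 < u" "u < t"
      then have "\<theta> \<le> va u - vb u"
        using va_mono[of T0 u] vb_antimono[of T0 u] T0 le separation by linarith
      then show "\<exists>f' g'. ((*) \<theta> has_real_derivative f') (at u) \<and> ((\<lambda>t. a t - b t) has_real_derivative g') (at u) \<and> f' \<le> g'"
        using distance_derivative[of u] DERIV_cmult_Id[of \<theta> u UNIV] by blast
    qed (use False in \<open>auto intro!: continuous_intros\<close>)
    moreover have "dmin \<le> a T0 - b T0" using distance_ge[of T0] T0 by simp
    ultimately show ?thesis using le by (simp add: algebra_simps)
  qed
qed

section \<open>Bounds for the momenta\<close>

lemma pa_le: "t \<ge> 0 \<Longrightarrow> pa t \<le> pmax"
proof -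
  assume t: "t \<ge> 0"
  have "pa t \<le> pa 0 + \<kappa>a / 2 * ((2 / \<theta> + 1)\<^sup>2 + 4 / \<theta>\<^sup>2) * (rho W + 2 / (1 - W)) * pi"
    by (rule impulse_bound[OF V W \<kappa>a \<theta> order_refl a b va va_ge vb vb_le distance_linear pa t])
  also have "\<dots> \<le> pmax"
    unfolding pmax_def using pa0 mom_le[of W W'] W W' \<theta> rho_pos[of W]
    by (intro add_mono mult_right_mono divide_right_mono) (auto simp: abs_le_iff)
  finally show ?thesis .
qed

text \<open>After reflection \<open>- b\<close> is the right-hand particle, with momentum
  \<open>- pb\<close>, and obeys its equation from \<open>Tp\<close> on.\<close>

lemma pb_ge: "t \<ge> Tp \<Longrightarrow> - pmax \<le> pb t"
proof -
  assume t: "t \<ge> Tp"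
  have "- pb t \<le> - pb Tp + \<kappa>b / 2 * ((2 / \<theta> + 1)\<^sup>2 + 4 / \<theta>\<^sup>2) * (rho W + 2 / (1 - W)) * pi"
  proof (rule impulse_bound[where x = "\<lambda>s. - b s" and y = "\<lambda>s. - a s" and vx = "\<lambda>s. - vb s" and vy = "\<lambda>s. - va s"
        and t = t and p = "\<lambda>s. - pb s" and \<delta> = \<delta>, OF V W \<kappa>b \<theta> Tp])
    show "\<theta> * (1 + t) \<le> - b t - - a t" if "t \<ge> Tp" for t using distance_linear[of t] that Tp by simp
    show "((\<lambda>s. - pb s) has_real_derivative force \<kappa>b \<delta> (\<lambda>s. - b s) (\<lambda>s. - a s) (\<lambda>s. - va s) t) (at t within {Tp..})"
      if "t \<ge> Tp" for t using DERIV_minus[OF pb[OF that]] by simp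
  qed (use a b va vb va_ge vb_le t in \<open>auto intro: DERIV_minus simp: minus_le_iff\<close>)
  also have "\<dots> \<le> pmax"
    unfolding pmax_def using pbTp mom_le[of W W'] W W' \<theta> rho_pos[of W]
    by (intro add_mono mult_right_mono divide_right_mono) (auto simp: abs_le_iff)
  finally show ?thesis by simp
qed

end

section \<open>Existence of solutions\<close>

definition prim :: "(real \<Rightarrow> real) \<Rightarrow> real \<Rightarrow> real" where
  "prim f t = integral {0..t} f - integral {t..0} f"

lemma prim_0 [simp]: "prim f 0 = 0"
  by (simp add: prim_def)

lemma prim_derivative:
  assumes f: "continuous_on UNIV f"
  shows "(prim f has_real_derivative f t) (at t)"
proof -
  define R where "R = \<bar>t\<bar> + 1"
  have R: "-R < t" "t < R" "0 < R" by (auto simp: R_def)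
  have int: "f integrable_on {r..s}" for r s
    by (intro integrable_continuous_real continuous_on_subset[OF f]) auto
  have eq: "prim f s = integral {-R..s} f - integral {-R..0} f" if "s \<in> {-R<..<R}" for s
  proof (cases "s \<ge> 0")
    case True
    then have "integral {s..0} f = 0" by (cases "s = 0") auto
    moreover have "integral {-R..0} f + integral {0..s} f = integral {-R..s} f"
      using True R by (intro Henstock_Kurzweil_Integration.integral_combine int) auto
    ultimately show ?thesis by (simp add: prim_def)
  next
    case False
    moreover have "integral {-R..s} f + integral {s..0} f = integral {-R..0} f"
      using False that by (intro Henstock_Kurzweil_Integration.integral_combine int) auto
    ultimately show ?thesis by (simp add: prim_def)
  qed
  have "((\<lambda>s. integral {-R..s} f) has_real_derivative f t) (at t within {-R..R})"
    using R by (intro integral_has_real_derivative continuous_on_subset[OF f]) auto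
  then have "((\<lambda>s. integral {-R..s} f) has_real_derivative f t) (at t)"
    using R at_within_interior[of t "{-R..R}"] by simp
  then have "((\<lambda>s. integral {-R..s} f - integral {-R..0} f) has_real_derivative f t - 0) (at t)"
    by (intro DERIV_diff DERIV_const)
  then have "((\<lambda>s. integral {-R..s} f - integral {-R..0} f) has_real_derivative f t) (at t)" by simp
  then show ?thesis
    by (rule has_field_derivative_transform_within_open[of _ _ _ "{-R<..<R}"]) (use R eq in auto)
qed

lemma prim_lipschitz:
  assumes "continuous_on UNIV f" "\<And>t. \<bar>f t\<bar> \<le> B"
  shows "\<bar>prim f s - prim f t\<bar> \<le> B * \<bar>s - t\<bar>"
  by (rule lipschitz_of_derivative[OF prim_derivative[OF assms(1)] assms(2)])

lemma prim_tendsto: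
  fixes f :: "nat \<Rightarrow> real \<Rightarrow> real"
  assumes f: "\<And>n. continuous_on UNIV (f n)" and B: "\<And>n t. \<bar>f n t\<bar> \<le> B"
    and lim: "\<And>t. (\<lambda>n. f n t) \<longlonglongrightarrow> g t"
  shows "(\<lambda>n. prim (f n) t) \<longlonglongrightarrow> prim g t"
proof -
  have "(\<lambda>n. integral {r..s} (f n)) \<longlonglongrightarrow> integral {r..s} g" for r s
  proof (rule dominated_convergence(2)[where h = "\<lambda>_. B"])
    show "f n integrable_on {r..s}" for n
      by (intro integrable_continuous_real continuous_on_subset[OF f]) auto
  qed (use B lim in auto)
  then show ?thesis unfolding prim_def by (intro tendsto_diff)
qed

text \<open>Equicontinuity upgrades pointwise convergence to convergence along moving arguments, as
  required for velocities at delayed times, which move with the trajectories.\<close>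

lemma lip0_tendsto:
  assumes U: "\<And>n. lip0 L (U n)" and lim: "\<And>t. (\<lambda>n. U n t) \<longlonglongrightarrow> u t" and S: "S \<longlonglongrightarrow> s"
  shows "(\<lambda>n. U n (S n)) \<longlonglongrightarrow> u s"
proof -
  have "(\<lambda>n. L * \<bar>S n - s\<bar>) \<longlonglongrightarrow> L * \<bar>s - s\<bar>" by (intro tendsto_intros S)
  then have "(\<lambda>n. U n (S n) - U n s) \<longlonglongrightarrow> 0"
    by (intro Lim_null_comparison[where f = "\<lambda>n. U n (S n) - U n s"]) (use U in \<open>auto simp: lip0_def\<close>)
  from tendsto_add[OF this lim[of s]] show ?thesis by simp
qed

section \<open>Continuity of delayed times and forces in time and in the trajectories\<close>

lemma lightcone_continuous:
  assumes V: "0 \<le> V" "V < 1" and f: "\<And>s s'. \<bar>f s - f s'\<bar> \<le> V * \<bar>s - s'\<bar>" and \<epsilon>: "\<bar>\<epsilon>\<bar> = 1"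
    and x: "continuous_on UNIV x"
  shows "continuous_on UNIV (\<lambda>t. lightcone \<epsilon> f t (x t))"
proof (rule continuous_at_imp_continuous_on, intro ballI)
  fix t :: real
  have x: "(x \<longlongrightarrow> x t) (at t)" using x by (auto simp: continuous_on_eq_continuous_at isCont_def)
  have "((\<lambda>r. (\<bar>r - t\<bar> + \<bar>x r - x t\<bar>) / (1 - V)) \<longlongrightarrow> (\<bar>t - t\<bar> + \<bar>x t - x t\<bar>) / (1 - V)) (at t)"
    using V by (intro tendsto_intros x) auto
  then have lim: "((\<lambda>r. (\<bar>r - t\<bar> + \<bar>x r - x t\<bar>) / (1 - V)) \<longlongrightarrow> 0) (at t)" by simp
  have "norm (lightcone \<epsilon> f r (x r) - lightcone \<epsilon> f t (x t)) \<le> (\<bar>r - t\<bar> + \<bar>x r - x t\<bar>) / (1 - V)" for r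
    using lightcone_dist[OF V f f \<epsilon>, of r "x r" t "x t"] V by (simp add: pos_le_divide_eq mult.commute)
  then have "((\<lambda>r. lightcone \<epsilon> f r (x r) - lightcone \<epsilon> f t (x t)) \<longlongrightarrow> 0) (at t)"
    by (intro Lim_null_comparison[OF _ lim] always_eventually) blast
  then show "isCont (\<lambda>t. lightcone \<epsilon> f t (x t)) t" by (simp add: isCont_def LIM_zero_iff)
qed

lemma lightcone_tendsto:
  fixes f :: "nat \<Rightarrow> real \<Rightarrow> real"
  assumes V: "0 \<le> V" "V < 1" and f: "\<And>n s s'. \<bar>f n s - f n s'\<bar> \<le> V * \<bar>s - s'\<bar>"
    and g: "\<And>s s'. \<bar>g s - g s'\<bar> \<le> V * \<bar>s - s'\<bar>" and \<epsilon>: "\<bar>\<epsilon>\<bar> = 1"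
    and fg: "\<And>s. (\<lambda>n. f n s) \<longlonglongrightarrow> g s" and x: "X \<longlonglongrightarrow> x"
  shows "(\<lambda>n. lightcone \<epsilon> (f n) t (X n)) \<longlonglongrightarrow> lightcone \<epsilon> g t x"
proof -
  let ?s = "lightcone \<epsilon> g t x"
  have "(\<lambda>n. (\<bar>X n - x\<bar> + \<bar>f n ?s - g ?s\<bar>) / (1 - V)) \<longlonglongrightarrow> (\<bar>x - x\<bar> + \<bar>g ?s - g ?s\<bar>) / (1 - V)"
    using V by (intro tendsto_intros x fg) auto
  then have lim: "(\<lambda>n. (\<bar>X n - x\<bar> + \<bar>f n ?s - g ?s\<bar>) / (1 - V)) \<longlonglongrightarrow> 0" by simp
  have "norm (lightcone \<epsilon> (f n) t (X n) - ?s) \<le> (\<bar>X n - x\<bar> + \<bar>f n ?s - g ?s\<bar>) / (1 - V)" for n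
    using lightcone_dist[OF V f g \<epsilon>, of n t "X n" t x] V by (simp add: pos_le_divide_eq mult.commute)
  then have "(\<lambda>n. lightcone \<epsilon> (f n) t (X n) - ?s) \<longlonglongrightarrow> 0"
    by (intro Lim_null_comparison[OF _ lim] always_eventually) blast
  then show ?thesis by (simp add: LIM_zero_iff)
qed

lemma force_continuous:
  assumes V: "0 \<le> V" "V < 1" and y: "\<And>s s'. \<bar>y s - y s'\<bar> \<le> V * \<bar>s - s'\<bar>" and \<delta>: "\<delta> > 0"
    and vy: "continuous_on UNIV vy" "\<And>s. \<bar>vy s\<bar> \<le> V" and x: "continuous_on UNIV x"
  shows "continuous_on UNIV (force \<kappa> \<delta> x y vy)"
proof -
  have c: "continuous_on UNIV (\<lambda>t. lightcone 1 y t (x t))" "continuous_on UNIV (\<lambda>t. lightcone (-1) y t (x t))"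
    by (rule lightcone_continuous[OF V y _ x], simp)+
  have v: "continuous_on UNIV (\<lambda>t. vy (lightcone 1 y t (x t)))" "continuous_on UNIV (\<lambda>t. vy (lightcone (-1) y t (x t)))"
    by (rule continuous_on_compose2[OF vy(1)]; use c in auto)+
  have ne: "1 - vy s \<noteq> 0" "1 + vy s \<noteq> 0" for s using vy(2)[of s] V by auto
  have "max \<delta> z \<noteq> 0" for z using \<delta> by auto
  then show ?thesis
    unfolding force_def[abs_def] rho_def sig_def using ne
    by (intro continuous_intros c v) auto
qed

lemma force_bound:
  assumes V: "0 \<le> V" "V < 1" and \<delta>: "\<delta> > 0" and vy: "\<And>s. \<bar>vy s\<bar> \<le> V" and \<kappa>: "\<kappa> > 0"
  shows "\<bar>force \<kappa> \<delta> x y vy t\<bar> \<le> \<kappa> * (rho V / \<delta>\<^sup>2)"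
proof -
  have vy1: "\<bar>vy s\<bar> < 1" for s using vy[of s] V by simp
  have q: "rho v / (max \<delta> z)\<^sup>2 \<le> rho V / \<delta>\<^sup>2" if "\<bar>v\<bar> \<le> V" for v z
    using that V \<delta> rho_pos[of v] rho_pos[of V] by (intro frac_le rho_mono power_mono) auto
  have "rho (vy r) / (max \<delta> z)\<^sup>2 + sig (vy s) / (max \<delta> z')\<^sup>2 \<le> 2 * (rho V / \<delta>\<^sup>2)" for r s z z'
    using q[OF vy[of r], of z] q[of "- vy s" z'] vy[of s] by (simp add: sig_eq_rho)
  from mult_left_mono[OF this, of "\<kappa> / 2"] \<kappa>
  have "force \<kappa> \<delta> x y vy t \<le> \<kappa> * (rho V / \<delta>\<^sup>2)" by (simp add: force_def)
  then show ?thesis using force_nonneg[OF \<kappa> vy1, where x = x and y = y and t = t and \<delta> = \<delta>] by simp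
qed

lemma force_tendsto:
  fixes x y vy :: "nat \<Rightarrow> real \<Rightarrow> real"
  assumes V: "0 \<le> V" "V < 1" and y: "\<And>n s s'. \<bar>y n s - y n s'\<bar> \<le> V * \<bar>s - s'\<bar>"
    and y': "\<And>s s'. \<bar>y' s - y' s'\<bar> \<le> V * \<bar>s - s'\<bar>" and \<delta>: "\<delta> > 0"
    and vy': "\<And>s. \<bar>vy' s\<bar> \<le> V" and xlim: "(\<lambda>n. x n t) \<longlonglongrightarrow> x' t" and ylim: "\<And>s. (\<lambda>n. y n s) \<longlonglongrightarrow> y' s"
    and vlim: "\<And>S s. S \<longlonglongrightarrow> s \<Longrightarrow> (\<lambda>n. vy n (S n)) \<longlonglongrightarrow> vy' s"
  shows "(\<lambda>n. force \<kappa> \<delta> (x n) (y n) (vy n) t) \<longlonglongrightarrow> force \<kappa> \<delta> x' y' vy' t"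
proof -
  have c: "(\<lambda>n. lightcone 1 (y n) t (x n t)) \<longlonglongrightarrow> lightcone 1 y' t (x' t)"
    "(\<lambda>n. lightcone (-1) (y n) t (x n t)) \<longlonglongrightarrow> lightcone (-1) y' t (x' t)"
    by (rule lightcone_tendsto[OF V y y' _ ylim xlim], simp)+
  have ne: "1 - vy' s \<noteq> 0" "1 + vy' s \<noteq> 0" for s using vy'[of s] V by auto
  have "max \<delta> z \<noteq> 0" for z using \<delta> by auto
  then show ?thesis
    unfolding force_def rho_def sig_def using ne by (intro tendsto_intros vlim c) auto
qed

section \<open>The integral operator and its fixed point\<close>

locale cauchy_data = bounds +
  fixes Tm a0 va0 :: real and b0 gb :: "real \<Rightarrow> real"
  assumes va0: "\<bar>va0\<bar> \<le> W"
    and strip: "Tm < Tp" "Tm \<le> 0" "Tm = - (a0 - b0 Tm)" "Tp = a0 - b0 Tp"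
    and gb: "\<And>t. t \<in> {Tm..Tp} \<Longrightarrow> (b0 has_real_derivative gb t) (at t within {Tm..Tp})"
    and gb_cont: "continuous_on {Tm..Tp} gb"
    and gb_W: "\<And>t. t \<in> {Tm..Tp} \<Longrightarrow> \<bar>gb t\<bar> \<le> W"
    and d0_eq: "a0 - b0 0 = d0"
begin

definition M :: real where "M = pmax + 1"

text \<open>\<open>W\<close> covers the prescribed motion of \<open>b\<close>, \<open>vel M\<close>
  the clamped velocities.\<close>

definition V :: real where "V = max W (vel M)"

text \<open>By \<open>lightcone_pair\<close> a ray is at least half as long as the present distance,
  hence at least \<open>dmin / 2\<close> once the distance bound is known; this is where the cutoff
  may be placed.\<close>

definition \<delta> :: real where "\<delta> = dmin / 2"

definition L :: real where "L = max \<kappa>a \<kappa>b * (rho V / \<delta>\<^sup>2)"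

definition clamp :: "real \<Rightarrow> real" where "clamp p = max (- M) (min M p)"

text \<open>Before time 0 the velocity is frozen, which extends the trajectory of \<open>a\<close>
  to the line; \<open>vb\<close> is frozen likewise before \<open>Tm\<close>.\<close>

definition va :: "(real \<Rightarrow> real) \<Rightarrow> real \<Rightarrow> real" where
  "va u t = vel (clamp (mom va0 + u (max t 0)))"

text \<open>The value is \<open>gb s\<close> on the strip and \<open>vel (clamp (mom (gb Tp) + u (Tp - s)))\<close> after it, because
  \<open>u 0 = 0\<close>; the sum makes the continuity at \<open>Tp\<close> evident.\<close>

definition vb :: "(real \<Rightarrow> real) \<Rightarrow> real \<Rightarrow> real" where
  "vb u s = gb (max Tm (min s Tp)) + (vel (clamp (mom (gb Tp) + u (min 0 (Tp - s)))) - gb Tp)"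

definition xa :: "(real \<Rightarrow> real) \<Rightarrow> real \<Rightarrow> real" where
  "xa u t = a0 + prim (va u) t"

text \<open>Anchored at \<open>Tp\<close>, where the data end; agreement with \<open>b0\<close> on
  the strip then follows from equal derivatives.\<close>

definition xb :: "(real \<Rightarrow> real) \<Rightarrow> real \<Rightarrow> real" where
  "xb u s = b0 Tp + (prim (vb u) s - prim (vb u) Tp)"

definition fa :: "(real \<Rightarrow> real) \<Rightarrow> real \<Rightarrow> real" where
  "fa u = force \<kappa>a \<delta> (xa u) (xb u) (vb u)"

definition fb :: "(real \<Rightarrow> real) \<Rightarrow> real \<Rightarrow> real" where
  "fb u = force \<kappa>b \<delta> (\<lambda>s. - xb u s) (\<lambda>s. - xa u s) (\<lambda>s. - va u s)"

text \<open>A single function \<open>u\<close> encodes both momenta: \<open>u t\<close> for \<open>t \<ge> 0\<close> is the momentum gained by the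
  particle \<open>a\<close> at time \<open>t\<close>, and \<open>u (Tp - s)\<close> for \<open>s \<ge> Tp\<close> the one gained by \<open>b\<close> at time \<open>s\<close>.\<close>

definition F :: "(real \<Rightarrow> real) \<Rightarrow> real \<Rightarrow> real" where
  "F u z = prim (fa u) (max z 0) - prim (\<lambda>r. fb u (Tp + r)) (max (- z) 0)"

lemma pmax: "mom W' \<le> pmax" "mom W \<le> mom W'" "0 \<le> mom W"
proof -
  show "mom W' \<le> pmax" using \<kappa>a \<theta> W rho_pos[of W] by (auto simp: pmax_def intro!: mult_nonneg_nonneg)
  show "mom W \<le> mom W'" using mom_le[of W W'] W W' by simp
  show "0 \<le> mom W" by (rule mom_nonneg[OF W])
qed

lemma V: "0 \<le> V" "V < 1" "W \<le> V"
  using W vel_abs_less_1[of M] by (auto simp: V_def abs_less_iff)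

lemma M: "M \<ge> 0" "mom W \<le> M" "mom W' < M"
  using pmax by (auto simp: M_def)

lemma \<delta>: "0 < \<delta>" "\<delta> < dmin"
  using dmin by (auto simp: \<delta>_def)

lemma L: "L > 0"
  using \<kappa>a V rho_pos[of V] \<delta> by (auto simp: L_def intro!: mult_pos_pos divide_pos_pos)

lemma clamp_id: "\<bar>p\<bar> \<le> M \<Longrightarrow> clamp p = p"
  by (auto simp: clamp_def)

lemma vel_clamp: "\<bar>vel (clamp p)\<bar> \<le> V"
proof -
  have "vel (clamp p) \<le> vel M" "vel (- M) \<le> vel (clamp p)" using M by (auto simp: clamp_def)
  moreover have "vel M \<le> V" by (simp add: V_def)
  ultimately show ?thesis unfolding vel_uminus abs_le_iff by linarith
qed

lemma vel_clamp_continuous: "continuous_on S (\<lambda>p. vel (clamp p))"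
  unfolding clamp_def by (rule continuous_on_compose2[OF vel_continuous[of UNIV]]) (auto intro!: continuous_intros)

lemma Tp_mem: "Tp \<in> {Tm..Tp}"
  using strip by simp

lemma mom_data: "\<bar>mom va0\<bar> \<le> mom W" "\<bar>mom (gb Tp)\<bar> \<le> mom W"
proof -
  have "\<bar>mom v\<bar> \<le> mom W" if "\<bar>v\<bar> \<le> W" for v
    using mom_le[of v W] mom_le[of "- v" W] that W by (auto simp: mom_uminus abs_le_iff)
  then show "\<bar>mom va0\<bar> \<le> mom W" "\<bar>mom (gb Tp)\<bar> \<le> mom W" using va0 gb_W[OF Tp_mem] by blast+
qed

lemma vel_gb: "vel (clamp (mom (gb Tp))) = gb Tp"
proof -
  have "\<bar>mom (gb Tp)\<bar> \<le> M" using mom_data M by simp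
  then show ?thesis using clamp_id vel_mom[of "gb Tp"] gb_W[OF Tp_mem] W by simp
qed

context
  fixes u :: "real \<Rightarrow> real"
  assumes u: "lip0 L u"
begin

lemma vb_early: "s \<le> Tp \<Longrightarrow> vb u s = gb (max Tm s)"
  using vel_gb u by (simp add: vb_def lip0_def)

lemma vb_late: "s \<ge> Tp \<Longrightarrow> vb u s = vel (clamp (mom (gb Tp) + u (Tp - s)))"
  using strip by (simp add: vb_def min_def)

lemma va_bound: "\<bar>va u t\<bar> \<le> V"
  by (simp add: va_def vel_clamp)

lemma vb_bound: "\<bar>vb u s\<bar> \<le> V"
proof (cases "s \<le> Tp")
  case True
  then have "\<bar>gb (max Tm s)\<bar> \<le> W" using strip by (intro gb_W) auto
  then show ?thesis using vb_early[OF True] V by simp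
qed (use vb_late vel_clamp in auto)

lemma va_continuous: "continuous_on UNIV (va u)"
proof -
  have "continuous_on UNIV (\<lambda>t. u (max t 0))"
    by (rule continuous_on_compose2[OF lip0_continuous[OF u, of UNIV]]) (auto intro!: continuous_intros)
  then have "continuous_on UNIV (\<lambda>t. mom va0 + u (max t 0))" by (intro continuous_intros)
  then show ?thesis
    unfolding va_def by (rule continuous_on_compose2[OF vel_clamp_continuous[of UNIV]]) auto
qed

lemma vb_continuous: "continuous_on UNIV (vb u)"
proof -
  have "continuous_on UNIV (\<lambda>s. gb (max Tm (min s Tp)))"
    by (rule continuous_on_compose2[OF gb_cont]) (use strip in \<open>auto intro!: continuous_intros\<close>)
  moreover have "continuous_on UNIV (\<lambda>s. u (min 0 (Tp - s)))"
    by (rule continuous_on_compose2[OF lip0_continuous[OF u, of UNIV]]) (auto intro!: continuous_intros)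
  then have "continuous_on UNIV (\<lambda>s. mom (gb Tp) + u (min 0 (Tp - s)))" by (intro continuous_intros)
  then have "continuous_on UNIV (\<lambda>s. vel (clamp (mom (gb Tp) + u (min 0 (Tp - s)))))"
    by (rule continuous_on_compose2[OF vel_clamp_continuous[of UNIV]]) auto
  ultimately show ?thesis unfolding vb_def by (intro continuous_intros)
qed

lemma xa_derivative: "(xa u has_real_derivative va u t) (at t)"
  unfolding xa_def using DERIV_add[OF DERIV_const prim_derivative[OF va_continuous]] by simp

lemma xb_derivative: "(xb u has_real_derivative vb u t) (at t)"
  unfolding xb_def using DERIV_add[OF DERIV_const DERIV_diff[OF prim_derivative[OF vb_continuous] DERIV_const]] by simp

lemma xa_lipschitz: "\<bar>xa u s - xa u t\<bar> \<le> V * \<bar>s - t\<bar>"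
  by (rule lipschitz_of_derivative[OF xa_derivative va_bound])

lemma xb_lipschitz: "\<bar>xb u s - xb u t\<bar> \<le> V * \<bar>s - t\<bar>"
  by (rule lipschitz_of_derivative[OF xb_derivative vb_bound])

lemma xa_continuous: "continuous_on UNIV (xa u)"
  using xa_derivative by (meson DERIV_isCont continuous_at_imp_continuous_on)

lemma xb_continuous: "continuous_on UNIV (xb u)"
  using xb_derivative by (meson DERIV_isCont continuous_at_imp_continuous_on)

lemma fa_continuous: "continuous_on UNIV (fa u)"
  unfolding fa_def
  by (rule force_continuous[OF V(1,2) xb_lipschitz \<delta>(1) vb_continuous vb_bound xa_continuous])

lemma fb_continuous: "continuous_on UNIV (fb u)"
  unfolding fb_def
proof (rule force_continuous[OF V(1,2) _ \<delta>(1)])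
  show "\<bar>- xa u s - - xa u t\<bar> \<le> V * \<bar>s - t\<bar>" for s t using xa_lipschitz[of t s] by (simp add: abs_minus_commute)
qed (use va_continuous va_bound xb_continuous in \<open>auto intro!: continuous_intros\<close>)

lemma fb_shift_continuous: "continuous_on UNIV (\<lambda>r. fb u (Tp + r))"
  by (rule continuous_on_compose2[OF fb_continuous]) (auto intro!: continuous_intros)

lemma fa_bound: "\<bar>fa u t\<bar> \<le> L"
proof -
  have "\<bar>fa u t\<bar> \<le> \<kappa>a * (rho V / \<delta>\<^sup>2)"
    unfolding fa_def by (rule force_bound[OF V(1,2) \<delta>(1) vb_bound \<kappa>a])
  also have "\<dots> \<le> L" unfolding L_def using rho_pos[of V] V by (intro mult_right_mono) auto
  finally show ?thesis .
qed

lemma fb_bound: "\<bar>fb u t\<bar> \<le> L"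
proof -
  have "\<bar>fb u t\<bar> \<le> \<kappa>b * (rho V / \<delta>\<^sup>2)"
    unfolding fb_def by (rule force_bound[OF V(1,2) \<delta>(1) _ \<kappa>b]) (simp add: va_bound)
  also have "\<dots> \<le> L" unfolding L_def using rho_pos[of V] V by (intro mult_right_mono) auto
  finally show ?thesis .
qed

lemma F_lip0: "lip0 L (F u)"
proof -
  have "\<bar>F u s - F u t\<bar> \<le> L * \<bar>s - t\<bar>" for s t
  proof -
    define A where "A z = prim (fa u) (max z 0)" for z
    define B where "B z = prim (\<lambda>r. fb u (Tp + r)) (max (- z) 0)" for z
    have "F u z = A z - B z" for z by (simp add: F_def A_def B_def)
    then have "\<bar>F u s - F u t\<bar> \<le> \<bar>A s - A t\<bar> + \<bar>B s - B t\<bar>" by simp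
    also have "\<dots> \<le> L * \<bar>max s 0 - max t 0\<bar> + L * \<bar>max (- s) 0 - max (- t) 0\<bar>"
      unfolding A_def B_def
      by (intro add_mono prim_lipschitz fa_continuous fb_shift_continuous fa_bound fb_bound)
    \<comment> \<open>The two half lines share the increment between them, so gluing both momenta
      into one function does not enlarge the Lipschitz constant.\<close>
    also have "\<dots> = L * \<bar>s - t\<bar>" unfolding distrib_left[symmetric] by (auto simp: max_def)
    finally show ?thesis .
  qed
  then show ?thesis by (auto simp: lip0_def F_def)
qed

end

text \<open>Convergence passes from momenta to velocities, trajectories, delayed times and forces;
  the bounds \<open>V\<close> and \<open>L\<close>, uniform in \<open>n\<close>, permit dominated
  convergence at the integrations.\<close>

lemma F_tendsto:
  assumes U: "\<And>n. lip0 L (U n)" and u: "lip0 L u" and lim: "\<And>t. (\<lambda>n. U n t) \<longlonglongrightarrow> u t"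
  shows "(\<lambda>n. F (U n) z) \<longlonglongrightarrow> F u z"
proof -
  have vel_lim: "(\<lambda>n. vel (clamp (P n))) \<longlonglongrightarrow> vel (clamp p)" if "P \<longlonglongrightarrow> p" for P p
    using continuous_on_tendsto_compose[OF vel_clamp_continuous[of UNIV] that] by simp
  have va_lim: "(\<lambda>n. va (U n) (S n)) \<longlonglongrightarrow> va u s" if "S \<longlonglongrightarrow> s" for S s
    unfolding va_def by (intro vel_lim tendsto_intros lip0_tendsto[OF U lim] that)
  have vb_lim: "(\<lambda>n. vb (U n) (S n)) \<longlonglongrightarrow> vb u s" if "S \<longlonglongrightarrow> s" for S s
  proof -
    have "(\<lambda>n. gb (max Tm (min (S n) Tp))) \<longlonglongrightarrow> gb (max Tm (min s Tp))"
      by (rule continuous_on_tendsto_compose[OF gb_cont]) (use strip in \<open>auto intro!: tendsto_intros that always_eventually\<close>)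
    then show ?thesis unfolding vb_def by (intro vel_lim tendsto_intros lip0_tendsto[OF U lim] that)
  qed
  have xa_lim: "(\<lambda>n. xa (U n) t) \<longlonglongrightarrow> xa u t" for t
    unfolding xa_def
    by (intro tendsto_intros prim_tendsto[where B = V] va_continuous va_bound va_lim U)
  have xb_lim: "(\<lambda>n. xb (U n) t) \<longlonglongrightarrow> xb u t" for t
    unfolding xb_def
    by (intro tendsto_intros prim_tendsto[where B = V] vb_continuous vb_bound vb_lim U)
  have fa_lim: "(\<lambda>n. fa (U n) t) \<longlonglongrightarrow> fa u t" for t
    unfolding fa_def
    by (rule force_tendsto[where x = "\<lambda>n. xa (U n)" and x' = "xa u", OF V(1,2) xb_lipschitz[OF U] xb_lipschitz[OF u] \<delta>(1) vb_bound[OF u] xa_lim xb_lim vb_lim])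
  have fb_lim: "(\<lambda>n. fb (U n) t) \<longlonglongrightarrow> fb u t" for t
    unfolding fb_def
  proof (rule force_tendsto[where x = "\<lambda>n s. - xb (U n) s" and x' = "\<lambda>s. - xb u s", OF V(1,2) _ _ \<delta>(1)])
    show "\<bar>- xa (U n) s - - xa (U n) t\<bar> \<le> V * \<bar>s - t\<bar>" for n s t
      using xa_lipschitz[OF U[of n], of t s] by (simp add: abs_minus_commute)
    show "\<bar>- xa u s - - xa u t\<bar> \<le> V * \<bar>s - t\<bar>" for s t
      using xa_lipschitz[OF u, of t s] by (simp add: abs_minus_commute)
  qed (use va_bound[OF u] in \<open>auto intro!: tendsto_minus xa_lim xb_lim va_lim\<close>)
  show ?thesis
    unfolding F_def
    by (intro tendsto_diff prim_tendsto[where B = L] fa_continuous fb_shift_continuous fa_bound fb_bound fa_lim fb_lim U)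
qed

lemma fixed_point: obtains u where "lip0 L u" "F u = u"
  by (rule schauder_lip0[where L = L and F = F, OF L F_lip0 F_tendsto]) blast+

end

section \<open>From the fixed point to a solution\<close>

lemma derivative_cong_within:
  fixes f g :: "real \<Rightarrow> real"
  assumes "t \<in> S" "\<And>s. s \<in> S \<Longrightarrow> g s = f s" "(f has_real_derivative d) (at t within S)"
  shows "(g has_real_derivative d) (at t within S)"
  by (rule has_field_derivative_transform_within[OF assms(3) zero_less_one assms(1)]) (simp add: assms(2))

lemma Ck_on_1I:
  assumes "\<And>t. t \<in> D \<Longrightarrow> (f has_real_derivative g t) (at t within D)" "continuous_on D g"
  shows "Ck_on 1 f D"
  unfolding One_nat_def Ck_on.simps using assms by blast

lemma Ck_on_2I:
  assumes "\<And>t. t \<in> D \<Longrightarrow> (f has_real_derivative g t) (at t within D)"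
    and "\<And>t. t \<in> D \<Longrightarrow> (g has_real_derivative h t) (at t within D)" "continuous_on D h"
  shows "Ck_on 2 f D"
  unfolding numeral_2_eq_2 Ck_on.simps using assms by blast

lemma velocity_eq:
  assumes "(f has_real_derivative v) (at t within D)" "at t within D \<noteq> bot"
  shows "velocity D f t = v"
  using vector_derivative_within[OF assms(2)] assms(1)
  by (simp add: has_real_derivative_iff_has_vector_derivative)

lemma at_within_atLeast:
  assumes "c \<le> t"
  shows "at t within {c..} \<noteq> (bot :: real filter)"
proof (cases "t = c")
  case False
  then show ?thesis using assms at_within_interior[of t "{c..}"] by simp
qed (simp add: at_within_Ici_at_right)

lemma velocity_atLeast:
  assumes "(f has_real_derivative v) (at t)" "t \<ge> c"
  shows "velocity {c..} f t = v"
  by (rule velocity_eq[OF has_field_derivative_at_within[OF assms(1)] at_within_atLeast[OF assms(2)]])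

context cauchy_data
begin

text \<open>Besides clamp and cutoff, the extension of the trajectories has to be undone: the light
  cone times must lie in the original domains, which holds because \<open>Tm\<close> and
  \<open>Tp\<close> are light cone times of the event \<open>(0, a0)\<close>.\<close>

lemma solution_exists: "\<exists>a b. is_solution \<kappa>a \<kappa>b a0 va0 Tm Tp b0 a b"
proof -
  obtain u where u: "lip0 L u" and Fu: "F u = u" by (rule fixed_point)
  define a b where "a = xa u" and "b = xb u"
  define v w where "v = va u" and "w = vb u"
  define pa where "pa t = mom va0 + u t" for t
  define pb where "pb s = mom (gb Tp) + u (Tp - s)" for s
  have u0: "u 0 = 0" using u by (simp add: lip0_def)
  have a_der: "(a has_real_derivative v t) (at t)" for t unfolding a_def v_def by (rule xa_derivative[OF u])
  have b_der: "(b has_real_derivative w t) (at t)" for t unfolding b_def w_def by (rule xb_derivative[OF u])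
  have a_0: "a 0 = a0" by (simp add: a_def xa_def)
  have w_strip: "w t = gb t" if "t \<in> {Tm..Tp}" for t
    using vb_early[OF u, of t] that by (simp add: w_def max_def)
  have b_strip: "b t = b0 t" if "t \<in> {Tm..Tp}" for t
  proof -
    have "((\<lambda>t. b t - b0 t) has_real_derivative 0) (at t within {Tm..Tp})" if "t \<in> {Tm..Tp}" for t
      using DERIV_diff[OF has_field_derivative_at_within[OF b_der] gb[OF that]] w_strip[OF that] by simp
    then obtain c where c: "\<And>t. t \<in> {Tm..Tp} \<Longrightarrow> b t - b0 t = c"
      using has_field_derivative_zero_constant[of "{Tm..Tp}" "\<lambda>t. b t - b0 t"] by auto
    have "b Tp - b0 Tp = 0" by (simp add: b_def xb_def)
    then show ?thesis using c[OF Tp_mem] c[OF that] by simp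
  qed
  have fa_der: "(pa has_real_derivative fa u t) (at t within {0..})" if "t \<ge> 0" for t
  proof -
    have "u z = prim (fa u) z" if "z \<ge> 0" for z
      using fun_cong[OF Fu, of z] that by (simp add: F_def)
    then have eq: "pa z = mom va0 + prim (fa u) z" if "z \<in> {0..}" for z using that by (simp add: pa_def)
    have "((\<lambda>z. mom va0 + prim (fa u) z) has_real_derivative 0 + fa u t) (at t within {0..})"
      by (intro DERIV_add DERIV_const has_field_derivative_at_within[OF prim_derivative] fa_continuous[OF u])
    then have "((\<lambda>z. mom va0 + prim (fa u) z) has_real_derivative fa u t) (at t within {0..})" by simp
    then show ?thesis by (rule derivative_cong_within[rotated 2]) (use eq that in auto)
  qed
  have fb_der: "(pb has_real_derivative - fb u t) (at t within {Tp..})" if "t \<ge> Tp" for t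
  proof -
    have "u z = - prim (\<lambda>r. fb u (Tp + r)) (- z)" if "z \<le> 0" for z
      using fun_cong[OF Fu, of z] that by (simp add: F_def)
    then have eq: "pb z = mom (gb Tp) - prim (\<lambda>r. fb u (Tp + r)) (z - Tp)" if "z \<in> {Tp..}" for z
      using that by (simp add: pb_def)
    have "((\<lambda>z. prim (\<lambda>r. fb u (Tp + r)) (z - Tp)) has_real_derivative fb u (Tp + (t - Tp)) * (1 - 0)) (at t)"
      by (intro DERIV_chain2[OF prim_derivative] fb_shift_continuous[OF u] DERIV_diff DERIV_ident DERIV_const)
    then have "((\<lambda>z. mom (gb Tp) - prim (\<lambda>r. fb u (Tp + r)) (z - Tp)) has_real_derivative 0 - fb u t) (at t)"
      by (intro DERIV_diff DERIV_const) simp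
    then have "((\<lambda>z. mom (gb Tp) - prim (\<lambda>r. fb u (Tp + r)) (z - Tp)) has_real_derivative - fb u t) (at t within {Tp..})"
      by (simp add: has_field_derivative_at_within)
    then show ?thesis by (rule derivative_cong_within[rotated 2]) (use eq that in auto)
  qed
  interpret cl: clamped W Tp d0 \<kappa>a \<kappa>b M V \<delta> a b v w pa pb
  proof unfold_locales
    show "\<bar>v t\<bar> \<le> V" "\<bar>w t\<bar> \<le> V" for t
      using va_bound[OF u] vb_bound[OF u] by (simp_all add: v_def w_def)
    show "v t = v 0" if "t \<le> 0" for t using that by (simp add: v_def va_def)
    show "\<bar>w t\<bar> \<le> W" if "t \<le> Tp" for t
      using vb_early[OF u that] gb_W[of "max Tm t"] that strip by (simp add: w_def)
    show "v t = vel (max (- M) (min M (pa t)))" if "0 \<le> t" for t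
      using that by (simp add: v_def va_def pa_def clamp_def max_def)
    show "w t = vel (max (- M) (min M (pb t)))" if "Tp \<le> t" for t
      using vb_late[OF u that] by (simp add: w_def pb_def clamp_def)
    show "\<bar>pa 0\<bar> \<le> mom W" "\<bar>pb Tp\<bar> \<le> mom W" using mom_data u0 by (simp_all add: pa_def pb_def)
    show "(pa has_real_derivative force \<kappa>a \<delta> a b w t) (at t within {0..})" if "0 \<le> t" for t
      using fa_der[OF that] by (simp add: fa_def a_def b_def w_def)
    show "(pb has_real_derivative - force \<kappa>b \<delta> (\<lambda>s. - b s) (\<lambda>s. - a s) (\<lambda>s. - v s) t) (at t within {Tp..})"
      if "Tp \<le> t" for t
      using fb_der[OF that] by (simp add: fb_def a_def b_def v_def)
    have "0 \<in> {Tm..Tp}" using strip Tp by simp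
    then show "a 0 - b 0 = d0" using a_0 b_strip d0_eq by simp
  qed (use a_der b_der V \<delta> M in auto)
  \<comment> \<open>Monotonicity excludes the lower clamp, the impulse bound the upper one.\<close>
  have v_pa: "v t = vel (pa t)" if "t \<ge> 0" for t
  proof -
    have "- M \<le> pa t" using cl.pa_mono[of 0 t] that mom_data u0 M by (simp add: pa_def abs_le_iff)
    moreover have "pa t \<le> M" using cl.pa_le[OF that] by (simp add: M_def)
    ultimately show ?thesis using cl.va_pa[OF that] by simp
  qed
  have w_pb: "w t = vel (pb t)" if "t \<ge> Tp" for t
  proof -
    have "pb t \<le> M" using cl.pb_antimono[of Tp t] that mom_data u0 M by (simp add: pb_def abs_le_iff)
    moreover have "- M \<le> pb t" using cl.pb_ge[OF that] by (simp add: M_def)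
    ultimately show ?thesis using cl.vb_pb[OF that] by simp
  qed
  have v1: "\<bar>v t\<bar> < 1" and w1: "\<bar>w t\<bar> < 1" for t using cl.speeds by auto
  have vel_a: "velocity {0..} a t = v t" if "t \<ge> 0" for t
    by (rule velocity_atLeast[OF a_der that])
  have vel_b: "velocity {Tm..} b t = w t" if "t \<ge> Tm" for t
    by (rule velocity_atLeast[OF b_der that])
  have v_0: "v 0 = va0" using v_pa[of 0] u0 va0 W by (simp add: pa_def vel_mom)
  have less_a: "\<bar>a s - a t\<bar> < \<bar>s - t\<bar>" and less_b: "\<bar>b s - b t\<bar> < \<bar>s - t\<bar>" if "s \<noteq> t" for s t
  proof -
    have "V * \<bar>s - t\<bar> < \<bar>s - t\<bar>" using V that by simp
    then show "\<bar>a s - a t\<bar> < \<bar>s - t\<bar>" "\<bar>b s - b t\<bar> < \<bar>s - t\<bar>"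
      using cl.lip_a[of s t] cl.lip_b[of s t] by auto
  qed
  have d_pos: "a t - b t > 0" if "t \<ge> 0" for t using cl.distance_ge[OF that] dmin by linarith
  have \<epsilon>: "\<epsilon> = 1 \<or> \<epsilon> = -1 \<Longrightarrow> \<bar>\<epsilon>\<bar> = 1" for \<epsilon> :: real by auto
  have t2: "t2 Tm \<epsilon> a b t = lightcone \<epsilon> b t (a t)" "is_t2 Tm \<epsilon> a b t (lightcone \<epsilon> b t (a t))"
    "a t - b (lightcone \<epsilon> b t (a t)) = \<bar>t - lightcone \<epsilon> b t (a t)\<bar>"
    "\<delta> \<le> \<bar>t - lightcone \<epsilon> b t (a t)\<bar>" if t: "t \<ge> 0" and e: "\<epsilon> = 1 \<or> \<epsilon> = -1" for t \<epsilon>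
  proof -
    define s where "s = lightcone \<epsilon> b t (a t)"
    have s: "s = t + \<epsilon> * \<bar>a t - b s\<bar>" unfolding s_def by (rule lightcone_eq[OF V(1,2) cl.lip_b \<epsilon>[OF e]])
    have abs: "\<bar>s - t\<bar> = \<bar>a t - b s\<bar>" using s e by auto
    have pair: "a t - b s = \<bar>s - t\<bar>" "(a t - b t) / 2 \<le> \<bar>s - t\<bar>"
      using lightcone_pair[of V b s t "a t", OF V(2) cl.lip_b d_pos[OF t] abs] by auto
    \<comment> \<open>On the past ray \<open>s - b s\<close> equals \<open>t - a t\<close>, which is
      at least its value at time 0, and that is \<open>Tm - b Tm\<close>. As \<open>s - b s\<close>
      increases with \<open>s\<close>, the crossing does not precede \<open>Tm\<close>.\<close>
    have "s \<ge> Tm"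
    proof (cases "s \<ge> t")
      case False
      then have "s - b s = t - a t" using pair s e by auto
      have "t - a t \<ge> 0 - a 0" using less_a[of t 0] t by (cases "t = 0") auto
      moreover have "Tm - b Tm = - a 0" using b_strip[of Tm] strip a_0 by simp
      ultimately have "s - b s \<ge> Tm - b Tm" using \<open>s - b s = t - a t\<close> by simp
      then show ?thesis using less_b[of s Tm] by (cases "s < Tm") auto
    qed (use t strip in auto)
    then have ist: "is_t2 Tm \<epsilon> a b t s" using s by (simp add: is_t2_def)
    have "t2 Tm \<epsilon> a b t = s"
      unfolding t2_def
    proof (rule the_equality[where P = "is_t2 Tm \<epsilon> a b t", OF ist])
      fix r assume "is_t2 Tm \<epsilon> a b t r"
      then have "r = t + \<epsilon> * \<bar>a t - b r\<bar>" by (simp add: is_t2_def)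
      from lightcone_unique[OF V(1,2) cl.lip_b \<epsilon>[OF e] this] show "r = s" by (simp add: s_def)
    qed
    moreover have "\<delta> \<le> (a t - b t) / 2" using cl.distance_ge[OF t] by (simp add: \<delta>_def)
    then have "\<delta> \<le> \<bar>s - t\<bar>" using pair(2) by linarith
    ultimately show "t2 Tm \<epsilon> a b t = lightcone \<epsilon> b t (a t)" "is_t2 Tm \<epsilon> a b t (lightcone \<epsilon> b t (a t))"
      "a t - b (lightcone \<epsilon> b t (a t)) = \<bar>t - lightcone \<epsilon> b t (a t)\<bar>"
      "\<delta> \<le> \<bar>t - lightcone \<epsilon> b t (a t)\<bar>"
      using ist pair(1) unfolding s_def by (simp_all add: abs_minus_commute)
  qed
  have t1: "t1 \<epsilon> a b t = lightcone \<epsilon> a t (b t)" "is_t1 \<epsilon> a b t (lightcone \<epsilon> a t (b t))"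
    "a (lightcone \<epsilon> a t (b t)) - b t = \<bar>t - lightcone \<epsilon> a t (b t)\<bar>"
    "\<delta> \<le> \<bar>t - lightcone \<epsilon> a t (b t)\<bar>" if t: "t \<ge> Tp" and e: "\<epsilon> = 1 \<or> \<epsilon> = -1" for t \<epsilon>
  proof -
    have t0: "t \<ge> 0" using t Tp by simp
    define s where "s = lightcone \<epsilon> a t (b t)"
    have s: "s = t + \<epsilon> * \<bar>b t - a s\<bar>" unfolding s_def by (rule lightcone_eq[OF V(1,2) cl.lip_a \<epsilon>[OF e]])
    have abs: "\<bar>s - t\<bar> = \<bar>- b t - - a s\<bar>" using s e by auto
    have "\<bar>- a s - - a t\<bar> \<le> V * \<bar>s - t\<bar>" using cl.lip_a[of t s] by (simp add: abs_minus_commute)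
    from lightcone_pair[of V "\<lambda>s. - a s" s t "- b t", OF V(2) this _ abs]
    have pair: "a s - b t = \<bar>s - t\<bar>" "(a t - b t) / 2 \<le> \<bar>s - t\<bar>" using d_pos[OF t0] by auto
    \<comment> \<open>Likewise with \<open>s + a s\<close>: the event \<open>(0, a0)\<close> lies on
      the past ray of \<open>(Tp, b Tp)\<close>.\<close>
    have "s \<ge> 0"
    proof (cases "s \<ge> t")
      case False
      then have "s + a s = t + b t" using pair s e by auto
      have "t + b t \<ge> Tp + b Tp" using less_b[of t Tp] t by (cases "t = Tp") auto
      moreover have "Tp + b Tp = a 0" using b_strip[OF Tp_mem] strip a_0 by simp
      ultimately have "s + a s \<ge> 0 + a 0" using \<open>s + a s = t + b t\<close> by simp
      then show ?thesis using less_a[of s 0] by (cases "s < 0") auto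
    qed (use t0 in auto)
    then have ist: "is_t1 \<epsilon> a b t s" using s by (simp add: is_t1_def abs_minus_commute)
    have "t1 \<epsilon> a b t = s"
      unfolding t1_def
    proof (rule the_equality[where P = "is_t1 \<epsilon> a b t", OF ist])
      fix r assume "is_t1 \<epsilon> a b t r"
      then have "r = t + \<epsilon> * \<bar>b t - a r\<bar>" by (simp add: is_t1_def abs_minus_commute)
      from lightcone_unique[OF V(1,2) cl.lip_a \<epsilon>[OF e] this] show "r = s" by (simp add: s_def)
    qed
    moreover have "\<delta> \<le> (a t - b t) / 2" using cl.distance_ge[OF t0] by (simp add: \<delta>_def)
    then have "\<delta> \<le> \<bar>s - t\<bar>" using pair(2) by linarith
    ultimately show "t1 \<epsilon> a b t = lightcone \<epsilon> a t (b t)" "is_t1 \<epsilon> a b t (lightcone \<epsilon> a t (b t))"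
      "a (lightcone \<epsilon> a t (b t)) - b t = \<bar>t - lightcone \<epsilon> a t (b t)\<bar>"
      "\<delta> \<le> \<bar>t - lightcone \<epsilon> a t (b t)\<bar>"
      using ist pair(1) unfolding s_def by (simp_all add: abs_minus_commute)
  qed
  have mirror: "lightcone \<epsilon> (\<lambda>s. - a s) t (- b t) = lightcone \<epsilon> a t (b t)" for \<epsilon> t
  proof -
    have "\<bar>- b t - - a s\<bar> = \<bar>b t - a s\<bar>" for s by (simp add: abs_minus_commute)
    then show ?thesis by (simp only: lightcone_def)
  qed
  have a_eq: "((\<lambda>s. velocity {0..} a s / sqrt (1 - (velocity {0..} a s)\<^sup>2)) has_real_derivative
      \<kappa>a / 2 * (rho (velocity {Tm..} b (t2 Tm (-1) a b t)) / (a t - b (t2 Tm (-1) a b t))\<^sup>2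
         + sig (velocity {Tm..} b (t2 Tm 1 a b t)) / (a t - b (t2 Tm 1 a b t))\<^sup>2)) (at t within {0..})"
    if t: "t \<ge> 0" for t
  proof (rule derivative_cong_within[where f = pa])
    show "velocity {0..} a s / sqrt (1 - (velocity {0..} a s)\<^sup>2) = pa s" if "s \<in> {0..}" for s
      using vel_a[of s] v_pa[of s] mom_vel[of "pa s"] that by (simp add: mom_def)
    have vt: "velocity {Tm..} b (t2 Tm \<epsilon> a b t) = w (lightcone \<epsilon> b t (a t))" if "\<epsilon> = 1 \<or> \<epsilon> = -1" for \<epsilon>
      using t2(1,2)[OF t that] vel_b by (simp add: is_t2_def)
    have mx: "max \<delta> \<bar>t - lightcone \<epsilon> b t (a t)\<bar> = a t - b (t2 Tm \<epsilon> a b t)" if "\<epsilon> = 1 \<or> \<epsilon> = -1" for \<epsilon>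
      using t2(1,3,4)[OF t that] by simp
    show "(pa has_real_derivative
      \<kappa>a / 2 * (rho (velocity {Tm..} b (t2 Tm (-1) a b t)) / (a t - b (t2 Tm (-1) a b t))\<^sup>2
         + sig (velocity {Tm..} b (t2 Tm 1 a b t)) / (a t - b (t2 Tm 1 a b t))\<^sup>2)) (at t within {0..})"
      using cl.pa[OF t] by (simp add: force_def vt mx)
  qed (use t in simp)
  have b_eq: "((\<lambda>s. velocity {Tm..} b s / sqrt (1 - (velocity {Tm..} b s)\<^sup>2)) has_real_derivative
      - (\<kappa>b / 2) * (sig (velocity {0..} a (t1 (-1) a b t)) / (b t - a (t1 (-1) a b t))\<^sup>2
         + rho (velocity {0..} a (t1 1 a b t)) / (b t - a (t1 1 a b t))\<^sup>2)) (at t within {Tp..})"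
    if t: "t \<ge> Tp" for t
  proof (rule derivative_cong_within[where f = pb])
    show "velocity {Tm..} b s / sqrt (1 - (velocity {Tm..} b s)\<^sup>2) = pb s" if "s \<in> {Tp..}" for s
      using vel_b[of s] w_pb[of s] mom_vel[of "pb s"] that strip by (simp add: mom_def)
    have vt: "velocity {0..} a (t1 \<epsilon> a b t) = v (lightcone \<epsilon> a t (b t))" if "\<epsilon> = 1 \<or> \<epsilon> = -1" for \<epsilon>
      using t1(1,2)[OF t that] vel_a by (simp add: is_t1_def)
    have mx: "(max \<delta> \<bar>t - lightcone \<epsilon> a t (b t)\<bar>)\<^sup>2 = (b t - a (t1 \<epsilon> a b t))\<^sup>2" if "\<epsilon> = 1 \<or> \<epsilon> = -1" for \<epsilon>
    proof -
      have "max \<delta> \<bar>t - lightcone \<epsilon> a t (b t)\<bar> = a (t1 \<epsilon> a b t) - b t" using t1(1,3,4)[OF t that] by simp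
      then show ?thesis by (simp only: power2_commute[of "b t"])
    qed
    show "(pb has_real_derivative
      - (\<kappa>b / 2) * (sig (velocity {0..} a (t1 (-1) a b t)) / (b t - a (t1 (-1) a b t))\<^sup>2
         + rho (velocity {0..} a (t1 1 a b t)) / (b t - a (t1 1 a b t))\<^sup>2)) (at t within {Tp..})"
      using cl.pb[OF t] by (simp add: force_def mirror vt mx sig_eq_rho)
  qed (use t in simp)
  have solves: "solves_equations \<kappa>a \<kappa>b Tm Tp a b"
    unfolding solves_equations_def Let_def
  proof (intro conjI allI impI ballI)
    fix t \<epsilon> :: real assume t: "0 \<le> t" and "\<epsilon> \<in> {1, -1}"
    then have e: "\<epsilon> = 1 \<or> \<epsilon> = -1" by auto
    show "\<exists>s. is_t2 Tm \<epsilon> a b t s" using t2(2)[OF t e] by blast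
    show "a t \<noteq> b (t2 Tm \<epsilon> a b t)" using t2(1,3,4)[OF t e] \<delta> by simp
  next
    fix t \<epsilon> :: real assume t: "Tp \<le> t" and "\<epsilon> \<in> {1, -1}"
    then have e: "\<epsilon> = 1 \<or> \<epsilon> = -1" by auto
    show "\<exists>s. is_t1 \<epsilon> a b t s" using t1(2)[OF t e] by blast
    show "b t \<noteq> a (t1 \<epsilon> a b t)" using t1(1,3,4)[OF t e] \<delta> by simp
  qed (use a_eq b_eq vel_a vel_b v1 w1 in simp_all)
  have "Ck_on 2 a {0..}"
  proof -
    have "continuous_on {0..} (\<lambda>t. 1 / sqrt (1 + (pa t)\<^sup>2) ^ 3 * fa u t)"
      unfolding pa_def using one_plus_square_pos
      by (intro continuous_intros lip0_continuous[OF u] continuous_on_subset[OF fa_continuous[OF u]])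
        (auto simp: less_imp_neq[THEN not_sym])
    moreover have "(v has_real_derivative 1 / sqrt (1 + (pa t)\<^sup>2) ^ 3 * fa u t) (at t within {0..})" if "t \<in> {0..}" for t
      by (rule derivative_cong_within[OF that, of _ "\<lambda>t. vel (pa t)"])
        (use v_pa that DERIV_chain2[OF vel_derivative fa_der] in auto)
    ultimately show ?thesis by (intro Ck_on_2I[OF has_field_derivative_at_within[OF a_der]])
  qed
  moreover have "Ck_on 1 b {Tm..}"
    unfolding b_def
    by (rule Ck_on_1I[OF has_field_derivative_at_within[OF xb_derivative[OF u]]
          continuous_on_subset[OF vb_continuous[OF u] subset_UNIV]])
  moreover have "Ck_on 2 b {Tp<..}"
  proof -
    have "continuous_on {Tp<..} (\<lambda>t. 1 / sqrt (1 + (pb t)\<^sup>2) ^ 3 * - fb u t)"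
      unfolding pb_def using one_plus_square_pos
      by (intro continuous_intros continuous_on_compose2[OF lip0_continuous[OF u, of UNIV]]
          continuous_on_subset[OF fb_continuous[OF u]])
        (auto simp: less_imp_neq[THEN not_sym])
    moreover have "(w has_real_derivative 1 / sqrt (1 + (pb t)\<^sup>2) ^ 3 * - fb u t) (at t within {Tp<..})" if "t \<in> {Tp<..}" for t
    proof (rule derivative_cong_within[OF that, of _ "\<lambda>t. vel (pb t)"])
      show "((\<lambda>t. vel (pb t)) has_real_derivative 1 / sqrt (1 + (pb t)\<^sup>2) ^ 3 * - fb u t) (at t within {Tp<..})"
        by (rule DERIV_chain2[OF vel_derivative], rule has_field_derivative_subset[OF fb_der]) (use that in auto)
    qed (use w_pb in auto)
    ultimately show ?thesis by (intro Ck_on_2I[OF has_field_derivative_at_within[OF b_der]])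
  qed
  ultimately have "is_solution \<kappa>a \<kappa>b a0 va0 Tm Tp b0 a b"
    unfolding is_solution_def using solves a_0 v_0 vel_a[of 0] b_strip by simp
  then show ?thesis by blast
qed

end

section \<open>Regularity of solutions\<close>

text \<open>Both claims of the regularity part are closed under the same calculus: for \<open>d = False\<close> this is
  being \<open>n\<close> times continuously differentiable near \<open>t\<close>, for \<open>d = True\<close> being \<open>n + 1\<close> times
  differentiable at \<open>t\<close>.\<close>

primrec smooth :: "bool \<Rightarrow> nat \<Rightarrow> (real \<Rightarrow> real) \<Rightarrow> real \<Rightarrow> bool" where
  "smooth d 0 f t \<longleftrightarrow> (if d then f differentiable (at t) else \<forall>\<^sub>F s in nhds t. isCont f s)"
| "smooth d (Suc n) f t \<longleftrightarrow> (\<forall>\<^sub>F s in nhds t. f differentiable (at s)) \<and> smooth d n (deriv f) t"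

section \<open>Closure properties of smoothness near and at a point\<close>

lemma eventually_nhds_twice: "(\<forall>\<^sub>F s in nhds t. P s) \<Longrightarrow> \<forall>\<^sub>F s in nhds t. \<forall>\<^sub>F r in nhds s. P (r :: real)"
  by (simp add: eventually_eventually)

lemma eventually_nhds_isCont:
  assumes "isCont g t" "\<forall>\<^sub>F s in nhds (g t). P s"
  shows "\<forall>\<^sub>F s in nhds t. P (g s)"
  by (rule eventually_compose_filterlim[OF assms(2) assms(1)[unfolded isCont_def tendsto_at_iff_tendsto_nhds]])

lemma differentiable_cong_nhds:
  fixes f g :: "real \<Rightarrow> real"
  assumes "\<forall>\<^sub>F s in nhds t. f s = g s" "f differentiable (at t)"
  shows "g differentiable (at t)"
  using assms DERIV_cong_ev[OF refl assms(1) refl] by (auto simp: real_differentiable_def)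

lemma smooth_cong:
  assumes "\<forall>\<^sub>F s in nhds t. f s = g s" "smooth d n f t"
  shows "smooth d n g t"
  using assms
proof (induction n arbitrary: f g)
  case 0
  show ?case
  proof (cases d)
    case True
    then show ?thesis using 0 differentiable_cong_nhds by simp
  next
    case False
    have "\<forall>\<^sub>F s in nhds t. isCont f s" using 0(2) False by simp
    with eventually_nhds_twice[OF 0(1)] have "\<forall>\<^sub>F s in nhds t. isCont g s"
      by eventually_elim (use isCont_cong in blast)
    then show ?thesis using False by simp
  qed
next
  case (Suc n)
  have "\<forall>\<^sub>F s in nhds t. f differentiable (at s)" using Suc.prems by simp
  with eventually_nhds_twice[OF Suc.prems(1)] have "\<forall>\<^sub>F s in nhds t. g differentiable (at s)"
    by eventually_elim (rule differentiable_cong_nhds)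
  moreover have "\<forall>\<^sub>F s in nhds t. deriv f s = deriv g s"
    using eventually_nhds_twice[OF Suc.prems(1)] by eventually_elim (rule deriv_cong_ev, auto)
  then have "smooth d n (deriv g) t" by (rule Suc.IH) (use Suc.prems in simp)
  ultimately show ?case by simp
qed

text \<open>Any function that is the derivative near \<open>t\<close> may stand in for
  \<open>deriv f\<close>, so the closure proofs can work with explicit derivatives.\<close>

lemma smooth_SucI:
  assumes "\<forall>\<^sub>F s in nhds t. (f has_real_derivative g s) (at s)" "smooth d n g t"
  shows "smooth d (Suc n) f t"
proof -
  have "\<forall>\<^sub>F s in nhds t. f differentiable (at s)"
    using assms(1) by eventually_elim (auto simp: real_differentiable_def)
  moreover have "\<forall>\<^sub>F s in nhds t. g s = deriv f s"
    using assms(1) by eventually_elim (simp add: DERIV_imp_deriv)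
  ultimately show ?thesis using smooth_cong assms(2) by simp
qed

lemma smooth_SucE:
  assumes "smooth d (Suc n) f t"
  obtains g where "\<forall>\<^sub>F s in nhds t. (f has_real_derivative g s) (at s)" "smooth d n g t"
proof
  show "\<forall>\<^sub>F s in nhds t. (f has_real_derivative deriv f s) (at s)"
    using assms by (auto elim!: eventually_mono simp: DERIV_deriv_iff_real_differentiable)
qed (use assms in simp)

lemma smooth_SucD: "smooth d (Suc n) f t \<Longrightarrow> smooth d n f t"
proof (induction n arbitrary: f)
  case 0
  then have ev: "\<forall>\<^sub>F s in nhds t. f differentiable (at s)" by simp
  then have "f differentiable (at t)" by (rule eventually_nhds_x_imp_x)
  moreover have "\<forall>\<^sub>F s in nhds t. isCont f s"
    using ev by eventually_elim (auto simp: real_differentiable_def intro: DERIV_isCont)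
  ultimately show ?case by simp
qed simp

lemma smooth_le: "smooth d n f t \<Longrightarrow> m \<le> n \<Longrightarrow> smooth d m f t"
  by (induction n) (auto simp: le_Suc_eq dest: smooth_SucD simp del: smooth.simps)

lemma smooth_0_isCont: "smooth d 0 f t \<Longrightarrow> isCont f t"
  by (auto split: if_splits dest: eventually_nhds_x_imp_x simp: real_differentiable_def intro: DERIV_isCont)

lemma smooth_isCont: "smooth d n f t \<Longrightarrow> isCont f t"
  using smooth_le[of d n f t 0] smooth_0_isCont by blast

lemma smooth_0I: "\<forall>\<^sub>F s in nhds t. (f has_real_derivative g s) (at s) \<Longrightarrow> smooth d 0 f t"
proof -
  assume ev: "\<forall>\<^sub>F s in nhds t. (f has_real_derivative g s) (at s)"
  then have "f differentiable (at t)" using eventually_nhds_x_imp_x by (fastforce simp: real_differentiable_def)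
  moreover have "\<forall>\<^sub>F s in nhds t. isCont f s" using ev by eventually_elim (rule DERIV_isCont)
  ultimately show ?thesis by simp
qed

lemma smooth_const [simp]: "smooth d n (\<lambda>_. c) t"
proof (induction n arbitrary: c)
  case (Suc n)
  show ?case by (rule smooth_SucI[where g = "\<lambda>_. 0"]) (use Suc in auto)
qed auto

lemma smooth_ident [simp]: "smooth d n (\<lambda>s. s) t"
proof (cases n)
  case (Suc m)
  show ?thesis unfolding Suc by (rule smooth_SucI[where g = "\<lambda>_. 1"]) (auto intro: always_eventually DERIV_ident)
qed auto

lemma smooth_add:
  assumes "smooth d n f t" "smooth d n g t"
  shows "smooth d n (\<lambda>s. f s + g s) t"
  using assms
proof (induction n arbitrary: f g)
  case 0
  then show ?case by (auto split: if_splits elim: eventually_elim2 intro: isCont_add differentiable_add)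
next
  case (Suc n)
  obtain f' where f': "\<forall>\<^sub>F s in nhds t. (f has_real_derivative f' s) (at s)" "smooth d n f' t"
    by (rule smooth_SucE[OF Suc.prems(1)])
  obtain g' where g': "\<forall>\<^sub>F s in nhds t. (g has_real_derivative g' s) (at s)" "smooth d n g' t"
    by (rule smooth_SucE[OF Suc.prems(2)])
  have "\<forall>\<^sub>F s in nhds t. ((\<lambda>s. f s + g s) has_real_derivative f' s + g' s) (at s)"
    using f'(1) g'(1) by eventually_elim (rule DERIV_add)
  then show ?case by (rule smooth_SucI) (rule Suc.IH[OF f'(2) g'(2)])
qed

lemma smooth_mult:
  assumes "smooth d n f t" "smooth d n g t"
  shows "smooth d n (\<lambda>s. f s * g s) t"
  using assms
proof (induction n arbitrary: f g)
  case 0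
  then show ?case by (auto split: if_splits elim: eventually_elim2 intro: isCont_mult differentiable_mult)
next
  case (Suc n)
  obtain f' where f': "\<forall>\<^sub>F s in nhds t. (f has_real_derivative f' s) (at s)" "smooth d n f' t"
    by (rule smooth_SucE[OF Suc.prems(1)])
  obtain g' where g': "\<forall>\<^sub>F s in nhds t. (g has_real_derivative g' s) (at s)" "smooth d n g' t"
    by (rule smooth_SucE[OF Suc.prems(2)])
  have "\<forall>\<^sub>F s in nhds t. ((\<lambda>s. f s * g s) has_real_derivative f' s * g s + g' s * f s) (at s)"
    using f'(1) g'(1) by eventually_elim (rule DERIV_mult)
  then show ?case
    by (rule smooth_SucI) (intro smooth_add Suc.IH f'(2) g'(2) smooth_SucD[OF Suc.prems(1)] smooth_SucD[OF Suc.prems(2)])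
qed

lemma smooth_minus: "smooth d n f t \<Longrightarrow> smooth d n (\<lambda>s. - f s) t"
  using smooth_mult[OF smooth_const[of d n "-1" t], of f] by simp

lemma smooth_diff: "smooth d n f t \<Longrightarrow> smooth d n g t \<Longrightarrow> smooth d n (\<lambda>s. f s - g s) t"
  using smooth_add[OF _ smooth_minus, of d n f t g] by simp

lemma eventually_nhds_nonzero:
  fixes f :: "real \<Rightarrow> real"
  assumes "isCont f t" "f t \<noteq> 0"
  shows "\<forall>\<^sub>F s in nhds t. f s \<noteq> 0"
  using eventually_nhds_isCont[OF assms(1), of "\<lambda>z. z \<noteq> 0"] assms(2) t1_space_nhds[of "f t" 0] by simp

lemma smooth_inverse:
  assumes "smooth d n f t" "f t \<noteq> 0"
  shows "smooth d n (\<lambda>s. inverse (f s)) t"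
  using assms
proof (induction n arbitrary: f)
  case 0
  have nz: "\<forall>\<^sub>F s in nhds t. f s \<noteq> 0" using 0 eventually_nhds_nonzero smooth_0_isCont by blast
  show ?case
  proof (cases d)
    case True
    then show ?thesis using 0 by (simp add: differentiable_inverse)
  next
    case False
    then have "\<forall>\<^sub>F s in nhds t. isCont f s" using 0 by simp
    with nz have "\<forall>\<^sub>F s in nhds t. isCont (\<lambda>s. inverse (f s)) s" by eventually_elim (intro continuous_intros)
    then show ?thesis using False by simp
  qed
next
  case (Suc n)
  obtain f' where f': "\<forall>\<^sub>F s in nhds t. (f has_real_derivative f' s) (at s)" "smooth d n f' t"
    by (rule smooth_SucE[OF Suc.prems(1)])
  have "\<forall>\<^sub>F s in nhds t. f s \<noteq> 0" using Suc.prems eventually_nhds_nonzero smooth_isCont by blast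
  with f'(1) have der: "\<forall>\<^sub>F s in nhds t. ((\<lambda>s. inverse (f s)) has_real_derivative - (inverse (f s) * f' s * inverse (f s))) (at s)"
    by eventually_elim (rule DERIV_inverse')
  have "smooth d n (\<lambda>s. inverse (f s)) t" using Suc.IH smooth_SucD Suc.prems by blast
  then show ?case by (intro smooth_SucI[OF der] smooth_minus smooth_mult f'(2))
qed

lemma smooth_divide:
  "smooth d n f t \<Longrightarrow> smooth d n g t \<Longrightarrow> g t \<noteq> 0 \<Longrightarrow> smooth d n (\<lambda>s. f s / g s) t"
  unfolding divide_inverse by (intro smooth_mult smooth_inverse)

lemma smooth_compose:
  assumes "smooth d n f (g t)" "smooth d n g t"
  shows "smooth d n (\<lambda>s. f (g s)) t"
  using assms
proof (induction n arbitrary: f)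
  case 0
  show ?case
  proof (cases d)
    case True
    then show ?thesis using 0 differentiable_compose[of f g t] by (simp add: comp_def)
  next
    case False
    have "isCont g t" using 0 smooth_0_isCont by blast
    moreover have "\<forall>\<^sub>F s in nhds (g t). isCont f s" "\<forall>\<^sub>F s in nhds t. isCont g s" using 0 False by simp_all
    ultimately have "\<forall>\<^sub>F s in nhds t. isCont f (g s)" "\<forall>\<^sub>F s in nhds t. isCont g s"
      using eventually_nhds_isCont by blast+
    then have "\<forall>\<^sub>F s in nhds t. isCont (\<lambda>s. f (g s)) s" by eventually_elim (rule isCont_o2)
    then show ?thesis using False by simp
  qed
next
  case (Suc n)
  obtain f' where f': "\<forall>\<^sub>F s in nhds (g t). (f has_real_derivative f' s) (at s)" "smooth d n f' (g t)"
    by (rule smooth_SucE[OF Suc.prems(1)])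
  obtain g' where g': "\<forall>\<^sub>F s in nhds t. (g has_real_derivative g' s) (at s)" "smooth d n g' t"
    by (rule smooth_SucE[OF Suc.prems(2)])
  have "\<forall>\<^sub>F s in nhds t. (f has_real_derivative f' (g s)) (at (g s))"
    by (rule eventually_nhds_isCont[OF smooth_isCont[OF Suc.prems(2)] f'(1)])
  with g'(1) have "\<forall>\<^sub>F s in nhds t. ((\<lambda>s. f (g s)) has_real_derivative f' (g s) * g' s) (at s)"
    by eventually_elim (rule DERIV_chain2)
  then show ?case
    by (rule smooth_SucI) (rule smooth_mult[OF Suc.IH[OF f'(2) smooth_SucD[OF Suc.prems(2)]] g'(2)])
qed

text \<open>The derivative of \<open>?q\<close> is \<open>- p\<close> times the cube of
  \<open>?q\<close>, a polynomial in \<open>p\<close> and \<open>?q\<close>, so the induction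
  closes.\<close>

lemma smooth_vel: "smooth d n vel p"
proof -
  let ?q = "\<lambda>p. inverse (sqrt (1 + p\<^sup>2))"
  have der: "(?q has_real_derivative - (p * ((?q p * ?q p) * ?q p))) (at p)" for p
  proof -
    have "((\<lambda>p. sqrt (1 + p\<^sup>2)) has_real_derivative inverse (sqrt (1 + p\<^sup>2)) / 2 * (0 + 2 * p)) (at p)"
      using one_plus_square_pos[of p] by (auto intro!: derivative_eq_intros)
    from DERIV_inverse'[OF this] show ?thesis
      using one_plus_square_pos[of p] by (simp add: algebra_simps)
  qed
  have "smooth d n ?q p"
  proof (induction n)
    case 0
    show ?case by (rule smooth_0I[OF always_eventually[OF allI[OF der]]])
  next
    case (Suc n)
    show ?case
      by (rule smooth_SucI[OF always_eventually[OF allI[OF der]]]) (intro smooth_minus smooth_mult smooth_ident Suc)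
  qed
  then show ?thesis
    unfolding vel_def[abs_def] divide_inverse by (intro smooth_mult smooth_ident)
qed

lemma smooth_rho: "smooth d n f t \<Longrightarrow> \<bar>f t\<bar> < 1 \<Longrightarrow> smooth d n (\<lambda>s. rho (f s)) t"
  unfolding rho_def by (intro smooth_divide smooth_add smooth_diff smooth_const) auto

lemma smooth_sig: "smooth d n f t \<Longrightarrow> \<bar>f t\<bar> < 1 \<Longrightarrow> smooth d n (\<lambda>s. sig (f s)) t"
  unfolding sig_def by (intro smooth_divide smooth_add smooth_diff smooth_const) auto

lemma times_differentiable_smooth:
  "times_differentiable_at (Suc n) f t \<longleftrightarrow> smooth True n f t"
proof (induction n arbitrary: f)
  case 0
  show ?case by (simp add: times_differentiable_at_def)
next
  case (Suc n)
  have "(\<forall>j<Suc n. \<forall>\<^sub>F s in nhds t. (deriv ^^ j) f differentiable (at s)) \<longleftrightarrow>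
      (\<forall>\<^sub>F s in nhds t. f differentiable (at s)) \<and> (\<forall>j<n. \<forall>\<^sub>F s in nhds t. (deriv ^^ Suc j) f differentiable (at s))"
    by (auto simp: less_Suc_eq_0_disj)
  then show ?case
    using Suc.IH[of "deriv f"] by (simp add: times_differentiable_at_def funpow_swap1)
qed

lemma smooth_imp_Ck_on:
  assumes "open S" "\<And>t. t \<in> S \<Longrightarrow> smooth False n f t"
  shows "Ck_on n f S"
  using assms(2)
proof (induction n arbitrary: f)
  case 0
  then show ?case
    by (auto intro!: continuous_at_imp_continuous_on dest: eventually_nhds_x_imp_x)
next
  case (Suc n)
  have "Ck_on n (deriv f) S" using Suc by simp
  moreover have "(f has_real_derivative deriv f t) (at t within S)" if "t \<in> S" for t
  proof -
    have "f differentiable (at t)" using Suc.prems[OF that] eventually_nhds_x_imp_x by fastforce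
    then show ?thesis by (simp add: DERIV_deriv_iff_real_differentiable has_field_derivative_at_within)
  qed
  ultimately show ?case by auto
qed

lemma Ck_on_imp_smooth:
  assumes "Ck_on n f D" "t \<in> interior D"
  shows "smooth False n f t"
  using assms
proof (induction n arbitrary: f)
  case 0
  have "\<forall>\<^sub>F s in nhds t. s \<in> interior D" using 0 eventually_nhds_in_open open_interior by blast
  then have "\<forall>\<^sub>F s in nhds t. isCont f s"
    by eventually_elim (use 0 in \<open>auto intro: continuous_on_interior\<close>)
  then show ?case by simp
next
  case (Suc n)
  then obtain g where g: "\<And>s. s \<in> D \<Longrightarrow> (f has_real_derivative g s) (at s within D)" "Ck_on n g D" by auto
  have "\<forall>\<^sub>F s in nhds t. s \<in> interior D" using Suc.prems eventually_nhds_in_open open_interior by blast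
  then have "\<forall>\<^sub>F s in nhds t. (f has_real_derivative g s) (at s)"
    by eventually_elim (metis at_within_interior g(1) interior_subset subsetD)
  then show ?case by (rule smooth_SucI) (rule Suc.IH[OF g(2) Suc.prems(2)])
qed

text \<open>Without a uniform speed bound no contraction controls the delayed times. Strict
  monotonicity of \<open>h\<close>, in the application time plus or minus position, gives continuity
  by order alone; \<open>c < s t\<close> leaves room for comparison points on the left.\<close>

lemma monotone_implicit_continuous:
  fixes h k s :: "real \<Rightarrow> real"
  assumes mono: "\<And>x y. c \<le> x \<Longrightarrow> x < y \<Longrightarrow> h x < h y" and st: "c < s t" and k: "isCont k t"
    and eq: "\<forall>\<^sub>F r in nhds t. c \<le> s r \<and> h (s r) = k r"
  shows "isCont s t"
  unfolding isCont_def
proof (rule order_tendstoI)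
  have kt: "(k \<longlongrightarrow> h (s t)) (at t)" using k eventually_nhds_x_imp_x[OF eq] by (simp add: isCont_def)
  have ev: "\<forall>\<^sub>F r in at t. c \<le> s r \<and> h (s r) = k r" using eq eventually_nhds_conv_at by blast
  fix l
  show "\<forall>\<^sub>F r in at t. l < s r" if "l < s t"
  proof -
    define l' where "l' = max l c"
    have "h l' < h (s t)" using mono[of l' "s t"] that st by (simp add: l'_def)
    then have "\<forall>\<^sub>F r in at t. h l' < k r" using kt order_tendstoD(1) by blast
    with ev show ?thesis
    proof eventually_elim
      case (elim r)
      have "\<not> s r \<le> l'"
      proof
        assume "s r \<le> l'"
        then have "h (s r) \<le> h l'" using mono[of "s r" l'] elim by (cases "s r = l'") auto
        then show False using elim by simp
      qed
      then show ?case by (simp add: l'_def)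
    qed
  qed
  show "\<forall>\<^sub>F r in at t. s r < l" if "s t < l"
  proof -
    have "h (s t) < h l" using mono[of "s t" l] that st by simp
    then have "\<forall>\<^sub>F r in at t. k r < h l" using kt order_tendstoD(2) by blast
    with ev show ?thesis
    proof eventually_elim
      case (elim r)
      show ?case
      proof (rule ccontr)
        assume "\<not> s r < l"
        then have "h l \<le> h (s r)" using mono[of l "s r"] that st by (cases "s r = l") auto
        then show False using elim by simp
      qed
    qed
  qed
qed

text \<open>The derivative \<open>k' z / h' (s z)\<close> contains \<open>s\<close> itself, so the
  regularity of \<open>s\<close> is raised one order at a time until the order \<open>m\<close> of
  \<open>h'\<close> and \<open>k'\<close> is exhausted.\<close>

lemma smooth_implicit:
  assumes h: "\<forall>\<^sub>F z in nhds (s t). (h has_real_derivative h' z) (at z)" "h' (s t) \<noteq> 0" "smooth d m h' (s t)"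
    and k: "\<forall>\<^sub>F z in nhds t. (k has_real_derivative k' z) (at z)" "smooth d m k' t"
    and s: "\<forall>\<^sub>F z in nhds t. isCont s z \<and> h (s z) = k z"
  shows "smooth d (Suc m) s t"
proof -
  have st: "isCont s t" using eventually_nhds_x_imp_x[OF s] by simp
  have nz: "\<forall>\<^sub>F z in nhds t. h' (s z) \<noteq> 0"
    by (rule eventually_nhds_isCont[OF st eventually_nhds_nonzero[OF smooth_isCont[OF h(3)] h(2)]])
  have "\<forall>\<^sub>F z in nhds t. (h has_real_derivative h' (s z)) (at (s z))"
    by (rule eventually_nhds_isCont[OF st h(1)])
  with nz k(1) eventually_nhds_twice[OF s]
  have der: "\<forall>\<^sub>F z in nhds t. (s has_real_derivative k' z / h' (s z)) (at z)"
  proof eventually_elim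
    case (elim z)
    have "isCont s z" using eventually_nhds_x_imp_x[OF elim(3)] by simp
    moreover have "\<forall>\<^sub>F r in nhds z. h (s r) = k r" using elim(3) by (rule eventually_mono) simp
    ultimately show ?case using elim by (intro implicit_derivative) auto
  qed
  have step: "smooth d (Suc j) s t" if "smooth d j s t" "j \<le> m" for j
    using that h(2) by (intro smooth_SucI[OF der] smooth_divide smooth_compose[of d j h' s t]
        smooth_le[OF h(3)] smooth_le[OF k(2)])
  have "smooth d j s t" if "j \<le> m" for j
    using that
  proof (induction j)
    case 0
    show ?case by (rule smooth_0I[OF der])
  next
    case (Suc j)
    then show ?case by (intro step) auto
  qed
  then show ?thesis using step by blast
qed

text \<open>One step of the bootstrap: the delayed times inherit the regularity of the velocities through
  the quotient \<open>(1 \<mp> vx) / (1 \<mp> vy)\<close>, and integrating the equation gains one derivative.\<close>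

lemma velocity_regularity:
  assumes x: "\<forall>\<^sub>F s in nhds t. (x has_real_derivative vx s) (at s)"
    and yr: "\<forall>\<^sub>F s in nhds (r t). (y has_real_derivative vy s) (at s)"
    and yq: "\<forall>\<^sub>F s in nhds (q t). (y has_real_derivative vy s) (at s)"
    and vr: "\<bar>vy (r t)\<bar> < 1" and vq: "\<bar>vy (q t)\<bar> < 1"
    and r: "\<forall>\<^sub>F s in nhds t. isCont r s \<and> s - r s = x s - y (r s)" "x t \<noteq> y (r t)"
    and q: "\<forall>\<^sub>F s in nhds t. isCont q s \<and> q s - s = x s - y (q s)" "x t \<noteq> y (q t)"
    and p: "\<forall>\<^sub>F s in nhds t. (p has_real_derivative
       \<kappa> / 2 * (rho (vy (r s)) / (x s - y (r s))\<^sup>2 + sig (vy (q s)) / (x s - y (q s))\<^sup>2)) (at s)"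
    and v: "\<forall>\<^sub>F s in nhds t. vx s = vel (p s)"
    and smooth: "smooth d m vx t" "smooth d m vy (r t)" "smooth d m vy (q t)"
  shows "smooth d (Suc m) vx t"
proof -
  \<comment> \<open>With \<open>x\<close> to the right of \<open>y\<close>, time minus position is
    constant along the past ray, time plus position along the future ray.\<close>
  have "smooth d (Suc m) r t"
  proof (rule smooth_implicit[where h = "\<lambda>z. z - y z" and k = "\<lambda>z. z - x z"])
    show "\<forall>\<^sub>F z in nhds (r t). ((\<lambda>z. z - y z) has_real_derivative 1 - vy z) (at z)"
      using yr by eventually_elim (intro DERIV_diff DERIV_ident)
    show "\<forall>\<^sub>F z in nhds t. ((\<lambda>z. z - x z) has_real_derivative 1 - vx z) (at z)"
      using x by eventually_elim (intro DERIV_diff DERIV_ident)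
    show "\<forall>\<^sub>F z in nhds t. isCont r z \<and> r z - y (r z) = z - x z"
      using r(1) by eventually_elim auto
  qed (use vr smooth in \<open>auto intro: smooth_diff\<close>)
  then have rs: "smooth d m r t" by (rule smooth_SucD)
  have "smooth d (Suc m) q t"
  proof (rule smooth_implicit[where h = "\<lambda>z. z + y z" and k = "\<lambda>z. z + x z"])
    show "\<forall>\<^sub>F z in nhds (q t). ((\<lambda>z. z + y z) has_real_derivative 1 + vy z) (at z)"
      using yq by eventually_elim (intro DERIV_add DERIV_ident)
    show "\<forall>\<^sub>F z in nhds t. ((\<lambda>z. z + x z) has_real_derivative 1 + vx z) (at z)"
      using x by eventually_elim (intro DERIV_add DERIV_ident)
    show "\<forall>\<^sub>F z in nhds t. isCont q z \<and> q z + y (q z) = z + x z"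
      using q(1) by eventually_elim auto
  qed (use vq smooth in \<open>auto intro: smooth_add\<close>)
  then have qs: "smooth d m q t" by (rule smooth_SucD)
  have xs: "smooth d m x t" by (rule smooth_SucD[OF smooth_SucI[OF x smooth(1)]])
  have ys: "smooth d m y (r t)" "smooth d m y (q t)"
    by (rule smooth_SucD[OF smooth_SucI[OF yr smooth(2)]], rule smooth_SucD[OF smooth_SucI[OF yq smooth(3)]])
  have "smooth d (Suc m) p t"
    using r(2) q(2) vr vq unfolding power2_eq_square
    by (intro smooth_SucI[OF p[unfolded power2_eq_square]] smooth_mult smooth_const smooth_add smooth_divide smooth_rho smooth_sig
        smooth_diff smooth_compose[of d m vy r t] smooth_compose[of d m vy q t]
        smooth_compose[of d m y r t] smooth_compose[of d m y q t] xs ys rs qs smooth) auto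
  then have "smooth d (Suc m) (\<lambda>s. vel (p s)) t" by (rule smooth_compose[OF smooth_vel])
  moreover have "\<forall>\<^sub>F s in nhds t. vel (p s) = vx s" using v by eventually_elim simp
  ultimately show ?thesis by (rule smooth_cong[rotated])
qed

text \<open>The mean value theorem keeps the inequality strict although the speed bound is not
  uniform.\<close>

lemma slower_than_light:
  fixes f f' :: "real \<Rightarrow> real"
  assumes der: "\<And>t. c \<le> t \<Longrightarrow> (f has_real_derivative f' t) (at t within {c..})"
    and f': "\<And>t. c \<le> t \<Longrightarrow> \<bar>f' t\<bar> < 1" and st: "c \<le> s" "s < t"
  shows "\<bar>f t - f s\<bar> < t - s"
proof -
  have "continuous_on {s..t} f"
    by (rule continuous_on_subset[of "{c..}"]) (use st der in \<open>auto intro: DERIV_continuous_on[of _ f f']\<close>)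
  moreover have "(f has_derivative (*) (f' x)) (at x)" if "s < x" "x < t" for x
    using derivative_within_interior[OF der, of x] that st by (auto simp: has_field_derivative_def)
  ultimately obtain x where x: "s < x" "x < t" "f t - f s = f' x * (t - s)"
    using mvt[of s t f "\<lambda>x. (*) (f' x)"] st by auto
  have "\<bar>f' x\<bar> * (t - s) < 1 * (t - s)" using f'[of x] x st by (intro mult_strict_right_mono) auto
  then show ?thesis using x st by (simp add: abs_mult)
qed

section \<open>Delayed times and light rays of an arbitrary solution\<close>

locale solution =
  fixes \<kappa>a \<kappa>b a0 va0 Tm Tp :: real and b0 a b :: "real \<Rightarrow> real"
  assumes sol: "is_solution \<kappa>a \<kappa>b a0 va0 Tm Tp b0 a b"
    and Tm: "Tm = - (a0 - b0 Tm)" and Tp: "Tp = a0 - b0 Tp" and le: "Tm \<le> Tp"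
    and behind: "\<And>t. t \<in> {Tm..Tp} \<Longrightarrow> b0 t < a0"
begin

definition va :: "real \<Rightarrow> real" where "va = velocity {0..} a"

definition vb :: "real \<Rightarrow> real" where "vb = velocity {Tm..} b"

abbreviation adv_b :: "real \<Rightarrow> real" where "adv_b \<equiv> t2 Tm 1 a b"
abbreviation ret_b :: "real \<Rightarrow> real" where "ret_b \<equiv> t2 Tm (-1) a b"
abbreviation adv_a :: "real \<Rightarrow> real" where "adv_a \<equiv> t1 1 a b"
abbreviation ret_a :: "real \<Rightarrow> real" where "ret_a \<equiv> t1 (-1) a b"

lemma times: "Tm < 0" "0 < Tp" "Tm < Tp"
proof -
  have "b0 Tm < a0" "b0 Tp < a0" using behind le by auto
  then show "Tm < 0" "0 < Tp" using Tm Tp by linarith+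
  then show "Tm < Tp" by linarith
qed

lemma initial: "a 0 = a0" "t \<in> {Tm..Tp} \<Longrightarrow> b t = b0 t"
  using sol by (auto simp: is_solution_def)

lemma equations: "solves_equations \<kappa>a \<kappa>b Tm Tp a b"
  using sol by (simp add: is_solution_def)

lemma va_facts:
  "0 \<le> t \<Longrightarrow> (a has_real_derivative va t) (at t within {0..})"
  "0 \<le> t \<Longrightarrow> \<exists>d. (va has_real_derivative d) (at t within {0..})"
proof -
  have "Ck_on 2 a {0..}" using sol by (simp add: is_solution_def)
  then obtain g h where g: "\<And>t. t \<in> {0..} \<Longrightarrow> (a has_real_derivative g t) (at t within {0..})"
    and h: "\<And>t. t \<in> {0..} \<Longrightarrow> (g has_real_derivative h t) (at t within {0..})"
    unfolding numeral_2_eq_2 Ck_on.simps by blast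
  have eq: "va t = g t" if "t \<in> {0..}" for t
    unfolding va_def by (rule velocity_eq[OF g[OF that] at_within_atLeast]) (use that in simp)
  show "0 \<le> t \<Longrightarrow> (a has_real_derivative va t) (at t within {0..})" using g eq by simp
  show "0 \<le> t \<Longrightarrow> \<exists>d. (va has_real_derivative d) (at t within {0..})"
    using derivative_cong_within[OF _ eq h] by auto
qed

lemma vb_facts:
  "Tm \<le> t \<Longrightarrow> (b has_real_derivative vb t) (at t within {Tm..})"
  "continuous_on {Tm..} vb"
proof -
  have "Ck_on 1 b {Tm..}" using sol by (simp add: is_solution_def)
  then obtain g where g: "\<And>t. t \<in> {Tm..} \<Longrightarrow> (b has_real_derivative g t) (at t within {Tm..})"
    and cont: "continuous_on {Tm..} g"
    unfolding One_nat_def Ck_on.simps by blast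
  have eq: "vb t = g t" if "t \<in> {Tm..}" for t
    unfolding vb_def by (rule velocity_eq[OF g[OF that] at_within_atLeast]) (use that in simp)
  show "Tm \<le> t \<Longrightarrow> (b has_real_derivative vb t) (at t within {Tm..})" using g eq by simp
  show "continuous_on {Tm..} vb" using cont by (rule continuous_on_eq) (simp add: eq)
qed

lemma speeds: "0 \<le> t \<Longrightarrow> \<bar>va t\<bar> < 1" "Tm \<le> t \<Longrightarrow> \<bar>vb t\<bar> < 1"
  using equations by (auto simp: solves_equations_def Let_def va_def vb_def)

lemma a_derivative: "0 < t \<Longrightarrow> (a has_real_derivative va t) (at t)"
  using derivative_within_interior[OF va_facts(1)] by simp

lemma b_derivative: "Tm < t \<Longrightarrow> (b has_real_derivative vb t) (at t)"
  using derivative_within_interior[OF vb_facts(1)] by simp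

lemma va_differentiable:
  assumes "0 < t"
  shows "\<exists>d. (va has_real_derivative d) (at t)"
proof -
  obtain d where "(va has_real_derivative d) (at t within {0..})" using va_facts(2)[of t] assms by auto
  from derivative_within_interior[OF this assms] show ?thesis by blast
qed

lemma vb_differentiable:
  assumes "Tp < t"
  shows "\<exists>d. (vb has_real_derivative d) (at t)"
proof -
  have "Ck_on 2 b {Tp<..}" using sol by (simp add: is_solution_def)
  then have "smooth False 2 b t" by (rule Ck_on_imp_smooth) (use assms in \<open>simp add: interior_open\<close>)
  then obtain g where g: "\<forall>\<^sub>F s in nhds t. (b has_real_derivative g s) (at s)" "smooth False 1 g t"
    unfolding numeral_2_eq_2 One_nat_def by (rule smooth_SucE)
  have "\<forall>\<^sub>F s in nhds t. s \<in> {Tp<..}" using assms by (intro eventually_nhds_in_open) auto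
  with g(1) have "\<forall>\<^sub>F s in nhds t. g s = vb s"
  proof eventually_elim
    case (elim s)
    then have "Tm < s" using times by simp
    from DERIV_unique[OF elim(1) b_derivative[OF this]] show ?case .
  qed
  then have "smooth False 1 vb t" using g(2) by (rule smooth_cong)
  then have "vb differentiable (at t)" by (auto dest: eventually_nhds_x_imp_x)
  then show ?thesis by (simp add: real_differentiable_def)
qed

lemma a_slow: "0 \<le> s \<Longrightarrow> s < t \<Longrightarrow> \<bar>a t - a s\<bar> < t - s"
  by (rule slower_than_light[OF va_facts(1) speeds(1)])

lemma b_slow: "Tm \<le> s \<Longrightarrow> s < t \<Longrightarrow> \<bar>b t - b s\<bar> < t - s"
  by (rule slower_than_light[OF vb_facts(1) speeds(2)])

lemma is_t2_unique:
  assumes "\<bar>\<epsilon>\<bar> = 1" "is_t2 Tm \<epsilon> a b t s" "is_t2 Tm \<epsilon> a b t s'"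
  shows "s = s'"
proof -
  have s: "Tm \<le> s" "s = t + \<epsilon> * \<bar>a t - b s\<bar>" and s': "Tm \<le> s'" "s' = t + \<epsilon> * \<bar>a t - b s'\<bar>"
    using assms(2,3) unfolding is_t2_def by blast+
  have "s - s' = \<epsilon> * (\<bar>a t - b s\<bar> - \<bar>a t - b s'\<bar>)" unfolding right_diff_distrib using s(2) s'(2) by linarith
  then have "\<bar>s - s'\<bar> = \<bar>\<bar>a t - b s\<bar> - \<bar>a t - b s'\<bar>\<bar>" using assms(1) by (simp add: abs_mult)
  also have "\<dots> \<le> \<bar>b s - b s'\<bar>" by linarith
  finally show ?thesis
    using b_slow[OF s(1), of s'] b_slow[OF s'(1), of s] by (cases s s' rule: linorder_cases) auto
qed

lemma is_t1_unique:
  assumes "\<bar>\<epsilon>\<bar> = 1" "is_t1 \<epsilon> a b t s" "is_t1 \<epsilon> a b t s'"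
  shows "s = s'"
proof -
  have s: "0 \<le> s" "s = t + \<epsilon> * \<bar>a s - b t\<bar>" and s': "0 \<le> s'" "s' = t + \<epsilon> * \<bar>a s' - b t\<bar>"
    using assms(2,3) unfolding is_t1_def by blast+
  have "s - s' = \<epsilon> * (\<bar>a s - b t\<bar> - \<bar>a s' - b t\<bar>)" unfolding right_diff_distrib using s(2) s'(2) by linarith
  then have "\<bar>s - s'\<bar> = \<bar>\<bar>a s - b t\<bar> - \<bar>a s' - b t\<bar>\<bar>" using assms(1) by (simp add: abs_mult)
  also have "\<dots> \<le> \<bar>a s - a s'\<bar>" by linarith
  finally show ?thesis
    using a_slow[OF s(1), of s'] a_slow[OF s'(1), of s] by (cases s s' rule: linorder_cases) auto
qed

lemma t2_is_t2:
  assumes t: "0 \<le> t" and e: "\<epsilon> = 1 \<or> \<epsilon> = -1"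
  shows "is_t2 Tm \<epsilon> a b t (t2 Tm \<epsilon> a b t)"
proof -
  have e1: "\<bar>\<epsilon>\<bar> = 1" using e by auto
  have "\<exists>s. is_t2 Tm \<epsilon> a b t s" using equations t e by (auto simp: solves_equations_def Let_def)
  then have "\<exists>!s. is_t2 Tm \<epsilon> a b t s" using is_t2_unique[OF e1] by blast
  then show ?thesis unfolding t2_def by (rule theI')
qed

lemma t1_is_t1:
  assumes t: "Tp \<le> t" and e: "\<epsilon> = 1 \<or> \<epsilon> = -1"
  shows "is_t1 \<epsilon> a b t (t1 \<epsilon> a b t)"
proof -
  have e1: "\<bar>\<epsilon>\<bar> = 1" using e by auto
  have "\<exists>s. is_t1 \<epsilon> a b t s" using equations t e by (auto simp: solves_equations_def Let_def)
  then have "\<exists>!s. is_t1 \<epsilon> a b t s" using is_t1_unique[OF e1] by blast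
  then show ?thesis unfolding t1_def by (rule theI')
qed

text \<open>At a collision the present time would be its own advanced time and a denominator would
  vanish; by the intermediate value theorem the initial order persists.\<close>

lemma ordered:
  assumes "0 \<le> t"
  shows "b t < a t"
proof -
  have ne: "a s \<noteq> b s" if "0 \<le> s" for s
  proof
    assume eq: "a s = b s"
    then have "is_t2 Tm 1 a b s s" using that times by (simp add: is_t2_def)
    then have "adv_b s = s" using is_t2_unique[of 1 s] t2_is_t2[OF that, of 1] by simp
    moreover have "a s \<noteq> b (adv_b s)" using equations that by (auto simp: solves_equations_def Let_def)
    ultimately show False using eq by simp
  qed
  show ?thesis
  proof (rule ccontr)
    assume "\<not> b t < a t"
    then have neg: "a t - b t \<le> 0" by simp
    have cont: "continuous_on {0..t} (\<lambda>s. a s - b s)"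
    proof (rule continuous_on_diff)
      show "continuous_on {0..t} a"
        by (rule continuous_on_subset[of "{0..}"]) (use va_facts in \<open>auto intro: DERIV_continuous_on[of _ a va]\<close>)
      show "continuous_on {0..t} b"
        by (rule continuous_on_subset[of "{Tm..}"])
          (use vb_facts times in \<open>auto intro: DERIV_continuous_on[of _ b vb]\<close>)
    qed
    have "b 0 < a 0" using behind[of 0] initial times by simp
    then obtain x where "0 \<le> x" "x \<le> t" "a x - b x = 0"
      using IVT2'[of "\<lambda>s. a s - b s" t 0 0] neg assms cont by auto
    then show False using ne[of x] by simp
  qed
qed

lemma t2_props:
  assumes "0 \<le> t"
  shows "Tm \<le> ret_b t" "t - ret_b t = a t - b (ret_b t)" "ret_b t < t"
    and "Tm \<le> adv_b t" "adv_b t - t = a t - b (adv_b t)" "t < adv_b t"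
proof -
  have r1: "Tm \<le> ret_b t" by (rule conjunct1[OF t2_is_t2[OF assms disjI2[OF refl], unfolded is_t2_def]])
  have r2: "ret_b t = t - \<bar>a t - b (ret_b t)\<bar>"
    using conjunct2[OF t2_is_t2[OF assms disjI2[OF refl], unfolded is_t2_def]] unfolding mult_minus1 add_uminus_conv_diff .
  note r = r1 r2
  have q1: "Tm \<le> adv_b t" by (rule conjunct1[OF t2_is_t2[OF assms disjI1[OF refl], unfolded is_t2_def]])
  have q2: "adv_b t = t + \<bar>a t - b (adv_b t)\<bar>"
    using conjunct2[OF t2_is_t2[OF assms disjI1[OF refl], unfolded is_t2_def]] unfolding mult_1 .
  note q = q1 q2
  have o: "b t < a t" by (rule ordered[OF assms])
  have "ret_b t \<noteq> t"
  proof
    assume e: "ret_b t = t"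
    show False using r(2) o unfolding e by simp
  qed
  moreover have "adv_b t \<noteq> t"
  proof
    assume e: "adv_b t = t"
    show False using q(2) o unfolding e by simp
  qed
  ultimately have rt: "ret_b t < t" "t < adv_b t" using r(2) q(2) by linarith+
  show "Tm \<le> ret_b t" "Tm \<le> adv_b t" "ret_b t < t" "t < adv_b t" using r q rt by auto
  show "t - ret_b t = a t - b (ret_b t)" using b_slow[OF r(1) rt(1)] r(2) o by linarith
  have "Tm \<le> t" using assms times by simp
  from b_slow[OF this rt(2)] show "adv_b t - t = a t - b (adv_b t)" using q(2) o by linarith
qed

lemma t1_props:
  assumes "Tp \<le> t"
  shows "0 \<le> ret_a t" "t - ret_a t = a (ret_a t) - b t" "ret_a t < t"
    and "0 \<le> adv_a t" "adv_a t - t = a (adv_a t) - b t" "t < adv_a t"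
proof -
  have t0: "0 \<le> t" using assms times by simp
  have r1: "0 \<le> ret_a t" by (rule conjunct1[OF t1_is_t1[OF assms disjI2[OF refl], unfolded is_t1_def]])
  have r2: "ret_a t = t - \<bar>a (ret_a t) - b t\<bar>"
    using conjunct2[OF t1_is_t1[OF assms disjI2[OF refl], unfolded is_t1_def]] unfolding mult_minus1 add_uminus_conv_diff .
  note r = r1 r2
  have q1: "0 \<le> adv_a t" by (rule conjunct1[OF t1_is_t1[OF assms disjI1[OF refl], unfolded is_t1_def]])
  have q2: "adv_a t = t + \<bar>a (adv_a t) - b t\<bar>"
    using conjunct2[OF t1_is_t1[OF assms disjI1[OF refl], unfolded is_t1_def]] unfolding mult_1 .
  note q = q1 q2
  have o: "b t < a t" by (rule ordered[OF t0])
  have "ret_a t \<noteq> t"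
  proof
    assume e: "ret_a t = t"
    show False using r(2) o unfolding e by simp
  qed
  moreover have "adv_a t \<noteq> t"
  proof
    assume e: "adv_a t = t"
    show False using q(2) o unfolding e by simp
  qed
  ultimately have rt: "ret_a t < t" "t < adv_a t" using r(2) q(2) by linarith+
  show "0 \<le> ret_a t" "0 \<le> adv_a t" "ret_a t < t" "t < adv_a t" using r q rt by auto
  show "t - ret_a t = a (ret_a t) - b t" using a_slow[OF r(1) rt(1)] r(2) o by linarith
  from a_slow[OF t0 rt(2)] show "adv_a t - t = a (adv_a t) - b t" using q(2) o by linarith
qed

text \<open>Light rays: the point \<open>(t, a t)\<close> sees \<open>(s, b s)\<close> on its future cone iff \<open>t + a t = s + b s\<close>
  and on its past cone iff \<open>t - a t = s - b s\<close>.\<close>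

lemma a_rays: "0 \<le> s \<Longrightarrow> 0 \<le> t \<Longrightarrow> s + a s < t + a t \<longleftrightarrow> s < t"
    "0 \<le> s \<Longrightarrow> 0 \<le> t \<Longrightarrow> s - a s < t - a t \<longleftrightarrow> s < t"
  using a_slow[of s t] a_slow[of t s] by (cases s t rule: linorder_cases; auto)+

lemma b_rays: "Tm \<le> s \<Longrightarrow> Tm \<le> t \<Longrightarrow> s + b s < t + b t \<longleftrightarrow> s < t"
    "Tm \<le> s \<Longrightarrow> Tm \<le> t \<Longrightarrow> s - b s < t - b t \<longleftrightarrow> s < t"
  using b_slow[of s t] b_slow[of t s] by (cases s t rule: linorder_cases; auto)+

text \<open>The conditions on \<open>Tm\<close> and \<open>Tp\<close> say that \<open>b\<close>
  crosses the past and the future light cone of \<open>(0, a0)\<close> at these times; this anchors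
  the zigzag.\<close>

lemma start_rays: "Tm - b Tm = 0 - a 0" "Tp + b Tp = 0 + a 0"
  using Tm Tp initial(1) initial(2)[of Tm] initial(2)[of Tp] le by auto

lemma rays:
  "0 \<le> t \<Longrightarrow> ret_b t - b (ret_b t) = t - a t" "0 \<le> t \<Longrightarrow> adv_b t + b (adv_b t) = t + a t"
  "Tp \<le> t \<Longrightarrow> ret_a t + a (ret_a t) = t + b t" "Tp \<le> t \<Longrightarrow> adv_a t - a (adv_a t) = t - b t"
  using t2_props(2,5)[of t] t1_props(2,5)[of t] by auto

lemma ret_b_gt: "0 < t \<Longrightarrow> Tm < ret_b t"
  using b_rays(2)[of Tm "ret_b t"] a_rays(2)[of 0 t] rays(1)[of t] start_rays(1) t2_props(1)[of t] by simp

lemma ret_a_gt: "Tp < t \<Longrightarrow> 0 < ret_a t"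
  using a_rays(1)[of 0 "ret_a t"] b_rays(1)[of Tp t] rays(3)[of t] start_rays(2) t1_props(1)[of t] times by simp

lemma ev_greater: "(c::real) < t \<Longrightarrow> \<forall>\<^sub>F s in nhds t. c < s"
  using eventually_nhds_in_open[of "{c<..}" t] by simp

lemma ret_b_isCont: "0 < t \<Longrightarrow> isCont ret_b t"
proof (rule monotone_implicit_continuous[where c = Tm and h = "\<lambda>s. s - b s" and k = "\<lambda>s. s - a s"])
  assume t: "0 < t"
  show "isCont (\<lambda>s. s - a s) t" using a_derivative[OF t] by (intro continuous_intros DERIV_isCont)
  show "\<forall>\<^sub>F s in nhds t. Tm \<le> ret_b s \<and> ret_b s - b (ret_b s) = s - a s"
    using ev_greater[OF t] by eventually_elim (use t2_props(1) rays(1) in auto)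
qed (use b_rays ret_b_gt in auto)

lemma adv_b_isCont: "0 < t \<Longrightarrow> isCont adv_b t"
proof (rule monotone_implicit_continuous[where c = Tm and h = "\<lambda>s. s + b s" and k = "\<lambda>s. s + a s"])
  assume t: "0 < t"
  show "isCont (\<lambda>s. s + a s) t" using a_derivative[OF t] by (intro continuous_intros DERIV_isCont)
  show "\<forall>\<^sub>F s in nhds t. Tm \<le> adv_b s \<and> adv_b s + b (adv_b s) = s + a s"
    using ev_greater[OF t] by eventually_elim (use t2_props(4) rays(2) in auto)
  show "Tm < adv_b t" using t2_props(6)[of t] t times by simp
qed (use b_rays in auto)

lemma ret_a_isCont: "Tp < t \<Longrightarrow> isCont ret_a t"
proof (rule monotone_implicit_continuous[where c = 0 and h = "\<lambda>s. s + a s" and k = "\<lambda>s. s + b s"])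
  assume t: "Tp < t"
  have "Tm < t" using t times by simp
  then show "isCont (\<lambda>s. s + b s) t" using b_derivative by (intro continuous_intros DERIV_isCont)
  show "\<forall>\<^sub>F s in nhds t. 0 \<le> ret_a s \<and> ret_a s + a (ret_a s) = s + b s"
    using ev_greater[OF t] by eventually_elim (use t1_props(1) rays(3) in auto)
qed (use a_rays ret_a_gt in auto)

lemma adv_a_isCont: "Tp < t \<Longrightarrow> isCont adv_a t"
proof (rule monotone_implicit_continuous[where c = 0 and h = "\<lambda>s. s - a s" and k = "\<lambda>s. s - b s"])
  assume t: "Tp < t"
  have "Tm < t" using t times by simp
  then show "isCont (\<lambda>s. s - b s) t" using b_derivative by (intro continuous_intros DERIV_isCont)
  show "\<forall>\<^sub>F s in nhds t. 0 \<le> adv_a s \<and> adv_a s - a (adv_a s) = s - b s"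
    using ev_greater[OF t] by eventually_elim (use t1_props(4) rays(4) in auto)
  show "0 < adv_a t" using t1_props(6)[of t] t times by simp
qed (use a_rays in auto)

section \<open>One step of the bootstrap for each particle\<close>

lemma va_step:
  assumes t: "0 < t" and s: "smooth d m va t" "smooth d m vb (ret_b t)" "smooth d m vb (adv_b t)"
  shows "smooth d (Suc m) va t"
proof (rule velocity_regularity[where x = a and y = b and r = ret_b and q = adv_b and vy = vb
      and p = "\<lambda>s. mom (va s)" and \<kappa> = \<kappa>a, OF _ _ _ _ _ _ _ _ _ _ _ s])
  note ev = ev_greater[OF t]
  show "\<forall>\<^sub>F s in nhds t. (a has_real_derivative va s) (at s)" using ev by eventually_elim (rule a_derivative)
  show "\<forall>\<^sub>F s in nhds (ret_b t). (b has_real_derivative vb s) (at s)"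
    using ev_greater[OF ret_b_gt[OF t]] by eventually_elim (rule b_derivative)
  have "Tm < adv_b t" using t2_props(6)[of t] t times by simp
  from ev_greater[OF this] show "\<forall>\<^sub>F s in nhds (adv_b t). (b has_real_derivative vb s) (at s)"
    by eventually_elim (rule b_derivative)
  show "\<bar>vb (ret_b t)\<bar> < 1" "\<bar>vb (adv_b t)\<bar> < 1" using speeds(2) t2_props(1,4)[of t] t by auto
  show "\<forall>\<^sub>F s in nhds t. isCont ret_b s \<and> s - ret_b s = a s - b (ret_b s)"
    using ev by eventually_elim (use ret_b_isCont t2_props(2) in force)
  show "\<forall>\<^sub>F s in nhds t. isCont adv_b s \<and> adv_b s - s = a s - b (adv_b s)"
    using ev by eventually_elim (use adv_b_isCont t2_props(5) in force)
  show "a t \<noteq> b (ret_b t)" "a t \<noteq> b (adv_b t)" using t2_props(2,3,5,6)[of t] t by auto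
  show "\<forall>\<^sub>F s in nhds t. va s = vel (mom (va s))"
    using ev by eventually_elim (simp add: speeds(1) vel_mom)
  show "\<forall>\<^sub>F s in nhds t. ((\<lambda>s. mom (va s)) has_real_derivative
       \<kappa>a / 2 * (rho (vb (ret_b s)) / (a s - b (ret_b s))\<^sup>2 + sig (vb (adv_b s)) / (a s - b (adv_b s))\<^sup>2)) (at s)"
    using ev
  proof eventually_elim
    case (elim s)
    have "((\<lambda>s. mom (va s)) has_real_derivative
       \<kappa>a / 2 * (rho (vb (ret_b s)) / (a s - b (ret_b s))\<^sup>2 + sig (vb (adv_b s)) / (a s - b (adv_b s))\<^sup>2)) (at s within {0..})"
      using equations elim unfolding solves_equations_def Let_def va_def vb_def mom_def by simp
    then show ?case using elim by (rule derivative_within_interior)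
  qed
qed

text \<open>By reflection: \<open>- b\<close> is to the right of \<open>- a\<close>, as
  \<open>velocity_regularity\<close> expects, and \<open>sig\<close> and \<open>rho\<close> trade
  places.\<close>

lemma vb_step:
  assumes t: "Tp < t" and s: "smooth d m vb t" "smooth d m va (ret_a t)" "smooth d m va (adv_a t)"
  shows "smooth d (Suc m) vb t"
proof -
  have s': "smooth d m (\<lambda>s. - vb s) t" "smooth d m (\<lambda>s. - va s) (ret_a t)" "smooth d m (\<lambda>s. - va s) (adv_a t)"
    using s by (auto intro: smooth_minus)
  have "smooth d (Suc m) (\<lambda>s. - vb s) t"
  proof (rule velocity_regularity[where x = "\<lambda>s. - b s" and y = "\<lambda>s. - a s" and r = ret_a and q = adv_a
        and vy = "\<lambda>s. - va s" and p = "\<lambda>s. mom (- vb s)" and \<kappa> = \<kappa>b, OF _ _ _ _ _ _ _ _ _ _ _ s'])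
    note ev = ev_greater[OF t]
    have "Tm < t" using t times by simp
    from ev_greater[OF this] show "\<forall>\<^sub>F s in nhds t. ((\<lambda>s. - b s) has_real_derivative - vb s) (at s)"
      by eventually_elim (intro DERIV_minus b_derivative)
    show "\<forall>\<^sub>F s in nhds (ret_a t). ((\<lambda>s. - a s) has_real_derivative - va s) (at s)"
      using ev_greater[OF ret_a_gt[OF t]] by eventually_elim (intro DERIV_minus a_derivative)
    have "0 < adv_a t" using t1_props(6)[of t] t times by simp
    from ev_greater[OF this] show "\<forall>\<^sub>F s in nhds (adv_a t). ((\<lambda>s. - a s) has_real_derivative - va s) (at s)"
      by eventually_elim (intro DERIV_minus a_derivative)
    show "\<bar>- va (ret_a t)\<bar> < 1" "\<bar>- va (adv_a t)\<bar> < 1" using speeds(1) t1_props(1,4)[of t] t by auto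
    show "\<forall>\<^sub>F s in nhds t. isCont ret_a s \<and> s - ret_a s = - b s - - a (ret_a s)"
      using ev by eventually_elim (use ret_a_isCont t1_props(2) in force)
    show "\<forall>\<^sub>F s in nhds t. isCont adv_a s \<and> adv_a s - s = - b s - - a (adv_a s)"
      using ev by eventually_elim (use adv_a_isCont t1_props(5) in force)
    show "- b t \<noteq> - a (ret_a t)" "- b t \<noteq> - a (adv_a t)" using t1_props(2,3,5,6)[of t] t by auto
    show "\<forall>\<^sub>F s in nhds t. - vb s = vel (mom (- vb s))"
      using ev by eventually_elim (use speeds(2) times in \<open>simp add: vel_mom\<close>)
    show "\<forall>\<^sub>F s in nhds t. ((\<lambda>s. mom (- vb s)) has_real_derivative
         \<kappa>b / 2 * (rho (- va (ret_a s)) / (- b s - - a (ret_a s))\<^sup>2 + sig (- va (adv_a s)) / (- b s - - a (adv_a s))\<^sup>2)) (at s)"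
      using ev
    proof eventually_elim
      case (elim s)
      have "((\<lambda>s. mom (vb s)) has_real_derivative
         - (\<kappa>b / 2) * (sig (va (ret_a s)) / (b s - a (ret_a s))\<^sup>2 + rho (va (adv_a s)) / (b s - a (adv_a s))\<^sup>2)) (at s within {Tp..})"
        using equations elim unfolding solves_equations_def Let_def va_def vb_def mom_def by simp
      from DERIV_minus[OF derivative_within_interior[OF this elim]]
      have "((\<lambda>s. mom (- vb s)) has_real_derivative
         \<kappa>b / 2 * (sig (va (ret_a s)) / (b s - a (ret_a s))\<^sup>2 + rho (va (adv_a s)) / (b s - a (adv_a s))\<^sup>2)) (at s)"
        by (simp add: mom_uminus)
      moreover have "(- b s - - a z)\<^sup>2 = (b s - a z)\<^sup>2" for z by (simp add: power2_commute)
      ultimately show ?case by (simp only: sig_eq_rho minus_minus)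
    qed
  qed
  then show ?thesis using smooth_minus by fastforce
qed

section \<open>The zigzag of light rays\<close>

abbreviation "\<sigma> \<equiv> sigma_seq Tm Tp a b"
abbreviation "\<tau> \<equiv> tau_seq Tm Tp a b"

text \<open>For \<open>k = 0\<close> the ray comes from the condition on \<open>Tp\<close> instead
  of the recursion. The lower bound \<open>Tp\<close> is carried along because \<open>adv_a\<close>
  is controlled only from \<open>Tp\<close> on.\<close>

lemma seq_rays: "0 \<le> \<sigma> k \<and> Tp \<le> \<tau> k \<and> \<tau> k + b (\<tau> k) = \<sigma> k + a (\<sigma> k)"
proof (induction k)
  case (Suc k)
  then have s: "0 \<le> \<sigma> (Suc k)" using t1_props(4) by simp
  then have r: "\<tau> (Suc k) + b (\<tau> (Suc k)) = \<sigma> (Suc k) + a (\<sigma> (Suc k))" "Tm \<le> \<tau> (Suc k)"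
    using rays(2) t2_props(4) by simp_all
  moreover have "0 + a 0 \<le> \<sigma> (Suc k) + a (\<sigma> (Suc k))" using a_rays(1)[of "\<sigma> (Suc k)" 0] s by linarith
  ultimately have "Tp \<le> \<tau> (Suc k)" using b_rays(1)[of "\<tau> (Suc k)" Tp] start_rays(2) times by auto
  then show ?case using r s by blast
qed (use start_rays in auto)

lemma seq_rays': "\<sigma> (Suc k) - a (\<sigma> (Suc k)) = \<tau> k - b (\<tau> k)"
  using rays(4)[of "\<tau> k"] seq_rays[of k] by simp

lemma \<sigma>_pos: "k \<ge> 1 \<Longrightarrow> 0 < \<sigma> k"
proof (cases k)
  case (Suc l)
  have "0 - a 0 < \<tau> l - b (\<tau> l)"
    using b_rays(2)[of Tm "\<tau> l"] seq_rays[of l] start_rays(1) times by simp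
  then show ?thesis using a_rays(2)[of 0 "\<sigma> k"] seq_rays[of k] seq_rays'[of l] Suc by simp
qed simp

lemma \<tau>_gt: "k \<ge> 1 \<Longrightarrow> Tp < \<tau> k"
  using a_rays(1)[of 0 "\<sigma> k"] b_rays(1)[of Tp "\<tau> k"] \<sigma>_pos[of k] seq_rays[of k] start_rays(2) times by simp

text \<open>Time plus and minus position increase along both trajectories, so rays from a gap
  between nodes end in a gap: the future ray in the one of the same index, the past ray one gap
  earlier, which for \<open>k = 0\<close> is the initial strip.\<close>

lemma between_a:
  assumes "\<sigma> k < t" "t < \<sigma> (Suc k)"
  shows "0 < t" "adv_b t \<in> {\<tau> k<..<\<tau> (Suc k)}" "ret_b t < \<tau> k" "k = 0 \<Longrightarrow> Tm < ret_b t"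
    "k = Suc l \<Longrightarrow> \<tau> l < ret_b t"
proof -
  note facts = seq_rays[of k] seq_rays[of "Suc k"] seq_rays'[of k] times
  show t: "0 < t" using facts assms by linarith
  note t0 = less_imp_le[OF t]
  show "adv_b t \<in> {\<tau> k<..<\<tau> (Suc k)}"
    using b_rays(1)[of "\<tau> k" "adv_b t"] b_rays(1)[of "adv_b t" "\<tau> (Suc k)"] rays(2)[OF t0] t2_props(4)[OF t0]
      a_rays(1)[of "\<sigma> k" t] a_rays(1)[of t "\<sigma> (Suc k)"] facts assms t0 by simp
  show "ret_b t < \<tau> k"
    using b_rays(2)[of "ret_b t" "\<tau> k"] rays(1)[OF t0] t2_props(1)[OF t0] a_rays(2)[of t "\<sigma> (Suc k)"] facts assms t0 by simp
  show "Tm < ret_b t" by (rule ret_b_gt[OF t])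
  show "\<tau> l < ret_b t" if "k = Suc l"
    using b_rays(2)[of "\<tau> l" "ret_b t"] rays(1)[OF t0] t2_props(1)[OF t0] a_rays(2)[of "\<sigma> k" t]
      seq_rays'[of l] seq_rays[of l] facts assms t0 that by simp
qed

lemma between_b:
  assumes "\<tau> k < t" "t < \<tau> (Suc k)"
  shows "Tp < t" "ret_a t \<in> {\<sigma> k<..<\<sigma> (Suc k)}" "adv_a t \<in> {\<sigma> (Suc k)<..<\<sigma> (Suc (Suc k))}"
proof -
  note facts = seq_rays[of k] seq_rays[of "Suc k"] seq_rays[of "Suc (Suc k)"] seq_rays'[of k] seq_rays'[of "Suc k"] times
  show t: "Tp < t" using facts assms by linarith
  note t0 = less_imp_le[OF t]
  show "ret_a t \<in> {\<sigma> k<..<\<sigma> (Suc k)}"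
    using a_rays(1)[of "\<sigma> k" "ret_a t"] a_rays(1)[of "ret_a t" "\<sigma> (Suc k)"] rays(3)[OF t0] t1_props(1)[OF t0]
      b_rays(1)[of "\<tau> k" t] b_rays(1)[of t "\<tau> (Suc k)"] facts assms t0 by simp
  show "adv_a t \<in> {\<sigma> (Suc k)<..<\<sigma> (Suc (Suc k))}"
    using a_rays(2)[of "\<sigma> (Suc k)" "adv_a t"] a_rays(2)[of "adv_a t" "\<sigma> (Suc (Suc k))"] rays(4)[OF t0] t1_props(4)[OF t0]
      b_rays(2)[of "\<tau> k" t] b_rays(2)[of t "\<tau> (Suc k)"] facts assms t0 by simp
qed

lemma at_\<sigma>: "ret_b (\<sigma> (Suc k)) = \<tau> k" "adv_b (\<sigma> (Suc k)) = \<tau> (Suc k)"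
proof -
  have s: "0 \<le> \<sigma> (Suc k)" and T: "Tp \<le> \<tau> k" using seq_rays[of k] seq_rays[of "Suc k"] by blast+
  then show "ret_b (\<sigma> (Suc k)) = \<tau> k"
    using b_rays(2)[of "ret_b (\<sigma> (Suc k))" "\<tau> k"] b_rays(2)[of "\<tau> k" "ret_b (\<sigma> (Suc k))"]
      rays(1)[OF s] t2_props(1)[OF s] seq_rays'[of k] times by linarith
qed simp

lemma at_\<tau>: "ret_a (\<tau> k) = \<sigma> k" "adv_a (\<tau> k) = \<sigma> (Suc k)"
proof -
  have s: "0 \<le> \<sigma> k" and T: "Tp \<le> \<tau> k" using seq_rays by auto
  then show "ret_a (\<tau> k) = \<sigma> k"
    using a_rays(1)[of "ret_a (\<tau> k)" "\<sigma> k"] a_rays(1)[of "\<sigma> k" "ret_a (\<tau> k)"]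
      rays(3)[OF T] t1_props(1)[OF T] seq_rays[of k] by linarith
qed simp

section \<open>Regularity between and at the nodes\<close>

lemma va_smooth_0: "0 < t \<Longrightarrow> smooth d 0 va t"
proof -
  assume "0 < t"
  have der: "(va has_real_derivative deriv va s) (at s)" if "0 < s" for s
    using va_differentiable[OF that] DERIV_imp_deriv by blast
  show ?thesis by (rule smooth_0I[OF eventually_mono[OF ev_greater[OF \<open>0 < t\<close>] der]])
qed

lemma vb_smooth_0: "Tp < t \<Longrightarrow> smooth d 0 vb t"
proof -
  assume "Tp < t"
  have der: "(vb has_real_derivative deriv vb s) (at s)" if "Tp < s" for s
    using vb_differentiable[OF that] DERIV_imp_deriv by blast
  show ?thesis by (rule smooth_0I[OF eventually_mono[OF ev_greater[OF \<open>Tp < t\<close>] der]])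
qed

text \<open>Advanced arguments point to later gaps, so an induction along the nodes would not be
  founded. The induction is on the order \<open>m\<close>, for all gaps at once and capped by the
  claimed orders. Retarded arguments set the caps: for \<open>a\<close> they lie one gap back, where
  the cap of \<open>vb\<close> is \<open>n + 2 * k\<close>; for \<open>b\<close> they lie in gap
  \<open>k\<close>, where that of \<open>va\<close> is \<open>1 + n + 2 * k\<close>.\<close>

lemma smooth_between:
  assumes b0: "Ck_on (1 + n) b0 {Tm..Tp}"
  shows "(\<forall>k. \<forall>t\<in>{\<sigma> k<..<\<sigma> (Suc k)}. smooth False (min m (1 + n + 2 * k)) va t) \<and>
    (\<forall>k. \<forall>t\<in>{\<tau> k<..<\<tau> (Suc k)}. smooth False (min m (2 + n + 2 * k)) vb t)"
proof (induction m)
  case 0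
  show ?case
    unfolding min_0L using va_smooth_0 between_a(1) vb_smooth_0 between_b(1) greaterThanLessThan_iff by blast
next
  case (Suc m)
  have a_IH: "smooth False j va t" if "\<sigma> k < t" "t < \<sigma> (Suc k)" "j \<le> m" "j \<le> 1 + n + 2 * k" for t k j
  proof (rule smooth_le)
    show "smooth False (min m (1 + n + 2 * k)) va t" using Suc that(1,2) greaterThanLessThan_iff by blast
  qed (use that in simp)
  have b_IH: "smooth False j vb t" if "\<tau> k < t" "t < \<tau> (Suc k)" "j \<le> m" "j \<le> 2 + n + 2 * k" for t k j
  proof (rule smooth_le)
    show "smooth False (min m (2 + n + 2 * k)) vb t" using Suc that(1,2) greaterThanLessThan_iff by blast
  qed (use that in simp)
  \<comment> \<open>For \<open>k = 0\<close> the retarded argument is in the strip, where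
    \<open>vb\<close> inherits order \<open>n\<close> from the derivative of
    \<open>b0\<close>.\<close>
  have strip: "smooth False n vb t" if t: "Tm < t" "t < Tp" for t
  proof -
    have "smooth False (Suc n) b0 t"
      using Ck_on_imp_smooth[OF b0, of t] t by (simp del: smooth.simps)
    then obtain g where g: "\<forall>\<^sub>F s in nhds t. (b0 has_real_derivative g s) (at s)" "smooth False n g t"
      by (rule smooth_SucE)
    have "\<forall>\<^sub>F s in nhds t. s \<in> {Tm<..<Tp}" using t by (intro eventually_nhds_in_open) auto
    with g(1) have "\<forall>\<^sub>F s in nhds t. g s = vb s"
    proof eventually_elim
      case (elim s)
      have "\<forall>\<^sub>F r in nhds s. r \<in> {Tm<..<Tp}" using elim by (intro eventually_nhds_in_open) auto
      then have eq: "\<forall>\<^sub>F r in nhds s. b0 r = b r" by eventually_elim (use initial(2) in auto)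
      have "(b has_real_derivative g s) (at s)" using DERIV_cong_ev[OF refl eq refl] elim(1) by simp
      from DERIV_unique[OF this b_derivative] show ?case using elim by simp
    qed
    then show ?thesis using g(2) by (rule smooth_cong)
  qed
  show ?case
  proof (intro conjI allI ballI)
    fix k t assume t: "t \<in> {\<sigma> k<..<\<sigma> (Suc k)}"
    then have t': "\<sigma> k < t" "t < \<sigma> (Suc k)" by auto
    note bt = between_a[OF t']
    have "smooth False (Suc (min m (n + 2 * k))) va t"
    proof (rule va_step[OF bt(1)])
      show "smooth False (min m (n + 2 * k)) va t" using t' by (intro a_IH) auto
      show "smooth False (min m (n + 2 * k)) vb (adv_b t)" using bt(2) by (intro b_IH[of k]) auto
      show "smooth False (min m (n + 2 * k)) vb (ret_b t)"
      proof (cases k)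
        case 0
        then have "smooth False n vb (ret_b t)" using strip[of "ret_b t"] bt(3,4) by simp
        then show ?thesis by (rule smooth_le) (simp add: 0)
      next
        case (Suc l)
        then show ?thesis using bt(3) between_a(5)[OF t' Suc] by (intro b_IH[of l]) auto
      qed
    qed
    then show "smooth False (min (Suc m) (1 + n + 2 * k)) va t" by simp
  next
    fix k t assume t: "t \<in> {\<tau> k<..<\<tau> (Suc k)}"
    then have t': "\<tau> k < t" "t < \<tau> (Suc k)" by auto
    note bt = between_b[OF t']
    have "smooth False (Suc (min m (1 + n + 2 * k))) vb t"
    proof (rule vb_step[OF bt(1)])
      show "smooth False (min m (1 + n + 2 * k)) vb t" using t' by (intro b_IH) auto
      show "smooth False (min m (1 + n + 2 * k)) va (ret_a t)" using bt(2) by (intro a_IH[of k]) auto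
      show "smooth False (min m (1 + n + 2 * k)) va (adv_a t)" using bt(3) by (intro a_IH[of "Suc k"]) auto
    qed
    then show "smooth False (min (Suc m) (2 + n + 2 * k)) vb t" by simp
  qed
qed

text \<open>Again an induction on the order. The chain starts at \<open>\<sigma> 1\<close>, whose
  retarded node is \<open>\<tau> 0 = Tp\<close>, where \<open>vb\<close> need not be differentiable;
  so only the differentiability of \<open>va\<close> is available there. Each passage to the next
  node of the zigzag adds one order.\<close>

lemma smooth_at_nodes:
  "(\<forall>k\<ge>1. smooth True (min m (2 * k - 2)) va (\<sigma> k)) \<and> (\<forall>k\<ge>1. smooth True (min m (2 * k - 1)) vb (\<tau> k))"
proof (induction m)
  case 0
  show ?case using va_smooth_0 \<sigma>_pos vb_smooth_0 \<tau>_gt by (auto simp del: smooth.simps)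
next
  case (Suc m)
  have a_IH: "smooth True j va (\<sigma> k)" if "k \<ge> 1" "j \<le> m" "j \<le> 2 * k - 2" for k j
  proof (rule smooth_le)
    show "smooth True (min m (2 * k - 2)) va (\<sigma> k)" using Suc that(1) by blast
  qed (use that in simp)
  have b_IH: "smooth True j vb (\<tau> k)" if "k \<ge> 1" "j \<le> m" "j \<le> 2 * k - 1" for k j
  proof (rule smooth_le)
    show "smooth True (min m (2 * k - 1)) vb (\<tau> k)" using Suc that(1) by blast
  qed (use that in simp)
  show ?case
  proof (intro conjI allI impI)
    fix k :: nat assume k: "1 \<le> k"
    show "smooth True (min (Suc m) (2 * k - 2)) va (\<sigma> k)"
    proof (cases "k = 1")
      case True
      then show ?thesis using va_smooth_0[OF \<sigma>_pos[OF k]] by (simp del: smooth.simps)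
    next
      case False
      then obtain l where l: "k = Suc l" "l \<ge> 1" using k by (cases k) auto
      have "smooth True (Suc (min m (2 * l - 1))) va (\<sigma> k)"
      proof (rule va_step[OF \<sigma>_pos[OF k]])
        show "smooth True (min m (2 * l - 1)) va (\<sigma> k)" using l by (intro a_IH) auto
        show "smooth True (min m (2 * l - 1)) vb (ret_b (\<sigma> k))" unfolding l(1) at_\<sigma> using l by (intro b_IH) auto
        show "smooth True (min m (2 * l - 1)) vb (adv_b (\<sigma> k))" unfolding l(1) at_\<sigma> using l by (intro b_IH) auto
      qed
      moreover have "min (Suc m) (2 * k - 2) = Suc (min m (2 * l - 1))" using l by auto
      ultimately show ?thesis by simp
    qed
  next
    fix k :: nat assume k: "1 \<le> k"
    have "smooth True (Suc (min m (2 * k - 2))) vb (\<tau> k)"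
    proof (rule vb_step[OF \<tau>_gt[OF k]])
      show "smooth True (min m (2 * k - 2)) vb (\<tau> k)" using k by (intro b_IH) auto
      show "smooth True (min m (2 * k - 2)) va (ret_a (\<tau> k))" unfolding at_\<tau> using k by (intro a_IH) auto
      show "smooth True (min m (2 * k - 2)) va (adv_a (\<tau> k))" unfolding at_\<tau> using k by (intro a_IH) auto
    qed
    moreover have "min (Suc m) (2 * k - 1) = Suc (min m (2 * k - 2))" using k by auto
    ultimately show "smooth True (min (Suc m) (2 * k - 1)) vb (\<tau> k)" by simp
  qed
qed

lemma a_smooth: "0 < t \<Longrightarrow> smooth d m va t \<Longrightarrow> smooth d (Suc m) a t"
  by (rule smooth_SucI[OF eventually_mono[OF ev_greater a_derivative]])

lemma b_smooth: "Tm < t \<Longrightarrow> smooth d m vb t \<Longrightarrow> smooth d (Suc m) b t"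
  by (rule smooth_SucI[OF eventually_mono[OF ev_greater b_derivative]])

lemma node_regularity:
  "k \<ge> 1 \<Longrightarrow> times_differentiable_at (2 * k) a (\<sigma> k)" "times_differentiable_at (2 * k + 1) b (\<tau> k)"
proof -
  show "times_differentiable_at (2 * k) a (\<sigma> k)" if k: "k \<ge> 1"
  proof -
    have "smooth True (2 * k - 2) va (\<sigma> k)" using smooth_at_nodes[of "2 * k"] k by (metis diff_le_self min.absorb2)
    from a_smooth[OF \<sigma>_pos[OF k] this] have "times_differentiable_at (Suc (Suc (2 * k - 2))) a (\<sigma> k)"
      by (simp only: times_differentiable_smooth)
    moreover have "Suc (Suc (2 * k - 2)) = 2 * k" using k by simp
    ultimately show ?thesis by simp
  qed
  show "times_differentiable_at (2 * k + 1) b (\<tau> k)"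
  proof (cases "k \<ge> 1")
    case True
    have "smooth True (2 * k - 1) vb (\<tau> k)" using smooth_at_nodes[of "2 * k"] True by (metis diff_le_self min.absorb2)
    moreover have "Tm < \<tau> k" using \<tau>_gt[OF True] times by simp
    ultimately have "times_differentiable_at (Suc (Suc (2 * k - 1))) b (\<tau> k)"
      using b_smooth times_differentiable_smooth by blast
    moreover have "Suc (Suc (2 * k - 1)) = 2 * k + 1" using True by simp
    ultimately show ?thesis by simp
  next
    case False
    then have "k = 0" by simp
    \<comment> \<open>At \<open>\<tau> 0 = Tp\<close> the acceleration of \<open>b\<close> may jump,
      and only one derivative is claimed.\<close>
    have "b differentiable (at Tp)" using b_derivative[OF times(3)] by (auto simp: real_differentiable_def)
    then show ?thesis by (simp add: \<open>k = 0\<close> times_differentiable_at_def)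
  qed
qed

lemma interval_regularity:
  assumes b0: "Ck_on (1 + n) b0 {Tm..Tp}"
  shows "Ck_on (2 + n + 2 * k) a {\<sigma> k<..<\<sigma> (Suc k)}" "Ck_on (3 + n + 2 * k) b {\<tau> k<..<\<tau> (Suc k)}"
proof -
  have "smooth False (Suc (1 + n + 2 * k)) a t" if "t \<in> {\<sigma> k<..<\<sigma> (Suc k)}" for t
  proof (rule a_smooth)
    show "0 < t" using between_a(1)[of k t] that by simp
    have "smooth False (min (1 + n + 2 * k) (1 + n + 2 * k)) va t" using smooth_between[OF b0] that by blast
    then show "smooth False (1 + n + 2 * k) va t" by simp
  qed
  from smooth_imp_Ck_on[OF open_greaterThanLessThan this]
  show "Ck_on (2 + n + 2 * k) a {\<sigma> k<..<\<sigma> (Suc k)}" by (simp del: Ck_on.simps)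
  have "smooth False (Suc (2 + n + 2 * k)) b t" if "t \<in> {\<tau> k<..<\<tau> (Suc k)}" for t
  proof (rule b_smooth)
    show "Tm < t" using between_b(1)[of k t] that times by simp
    have "smooth False (min (2 + n + 2 * k) (2 + n + 2 * k)) vb t" using smooth_between[OF b0] that by blast
    then show "smooth False (2 + n + 2 * k) vb t" by simp
  qed
  from smooth_imp_Ck_on[OF open_greaterThanLessThan this]
  show "Ck_on (3 + n + 2 * k) b {\<tau> k<..<\<tau> (Suc k)}" by (simp del: Ck_on.simps add: numeral_3_eq_3)
qed

end

section \<open>The data of the theorem\<close>

lemma cauchy_data_of_strip:
  fixes a0 va0 Tm Tp \<kappa>a \<kappa>b :: real and b0 :: "real \<Rightarrow> real"
  assumes \<kappa>: "\<kappa>a > 0" "\<kappa>b > 0" and va0: "va0 \<in> {-1<..<1}" and le: "Tm \<le> Tp"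
    and Tm: "Tm = - (a0 - b0 Tm)" and Tp: "Tp = a0 - b0 Tp" and C1: "Ck_on 1 b0 {Tm..Tp}"
    and behind: "\<forall>t\<in>{Tm..Tp}. b0 t < a0"
    and slow: "(SUP t\<in>{Tm..Tp}. \<bar>velocity {Tm..Tp} b0 t\<bar>) < 1"
  shows "\<exists>W gb. cauchy_data W Tp (a0 - b0 0) \<kappa>a \<kappa>b Tm a0 va0 b0 gb"
proof -
  have "b0 Tm < a0" "b0 Tp < a0" using behind le by auto
  then have signs: "Tm < 0" "0 < Tp" using Tm Tp by linarith+
  obtain gb where gb: "\<And>t. t \<in> {Tm..Tp} \<Longrightarrow> (b0 has_real_derivative gb t) (at t within {Tm..Tp})"
    and cont: "continuous_on {Tm..Tp} gb"
    using C1 unfolding One_nat_def Ck_on.simps by blast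
  have vel: "velocity {Tm..Tp} b0 t = gb t" if "t \<in> {Tm..Tp}" for t
  proof (rule velocity_eq[OF gb[OF that]])
    have "t islimpt {Tm..Tp}" using that signs by (simp add: islimpt_Icc)
    then show "at t within {Tm..Tp} \<noteq> bot" by (simp add: trivial_limit_within)
  qed
  define w where "w = (SUP t\<in>{Tm..Tp}. \<bar>gb t\<bar>)"
  \<comment> \<open>Compactness of the strip makes the supremum a genuine bound; for an unbounded
    set \<open>SUP\<close> would carry no information.\<close>
  have "compact ((\<lambda>t. \<bar>gb t\<bar>) ` {Tm..Tp})"
    by (intro compact_continuous_image continuous_intros cont) auto
  then have bdd: "bdd_above ((\<lambda>t. \<bar>gb t\<bar>) ` {Tm..Tp})" by (intro bounded_imp_bdd_above compact_imp_bounded)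
  have w: "\<bar>gb t\<bar> \<le> w" if "t \<in> {Tm..Tp}" for t unfolding w_def by (rule cSUP_upper[OF that bdd])
  have "(SUP t\<in>{Tm..Tp}. \<bar>velocity {Tm..Tp} b0 t\<bar>) = w"
    unfolding w_def by (rule SUP_cong) (simp_all add: vel)
  then have "w < 1" using slow by simp
  \<comment> \<open>\<open>W\<close> has to dominate the initial speeds of both particles.\<close>
  have "cauchy_data (max w \<bar>va0\<bar>) Tp (a0 - b0 0) \<kappa>a \<kappa>b Tm a0 va0 b0 gb"
  proof
    show "\<bar>gb t\<bar> \<le> max w \<bar>va0\<bar>" if "t \<in> {Tm..Tp}" for t using w[OF that] by simp
  qed (use \<open>w < 1\<close> va0 signs \<kappa> behind Tm Tp gb cont in auto)
  then show ?thesis by blast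
qed

theorem theorem1p1:
  fixes e\<^sub>a e\<^sub>b m\<^sub>a m\<^sub>b \<kappa>\<^sub>a \<kappa>\<^sub>b a\<^sub>0 va\<^sub>0 Tm Tp :: real
    and b\<^sub>0 :: "real \<Rightarrow> real"
  assumes "e\<^sub>a * e\<^sub>b > 0" "m\<^sub>a > 0" "m\<^sub>b > 0"
    and "\<kappa>\<^sub>a = e\<^sub>a * e\<^sub>b / m\<^sub>a" "\<kappa>\<^sub>b = e\<^sub>a * e\<^sub>b / m\<^sub>b"
    and "va\<^sub>0 \<in> {-1<..<1}"
    and "Tm \<le> Tp"
    and "Tm = - (a\<^sub>0 - b\<^sub>0 Tm)" "Tp = a\<^sub>0 - b\<^sub>0 Tp"
    and "Ck_on 1 b\<^sub>0 {Tm..Tp}"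
    and "\<forall>t\<in>{Tm..Tp}. b\<^sub>0 t < a\<^sub>0"
    and "(SUP t\<in>{Tm..Tp}. \<bar>velocity {Tm..Tp} b\<^sub>0 t\<bar>) < 1"
  shows "(\<exists>a b. is_solution \<kappa>\<^sub>a \<kappa>\<^sub>b a\<^sub>0 va\<^sub>0 Tm Tp b\<^sub>0 a b) \<and>
    (\<forall>n. Ck_on (1 + n) b\<^sub>0 {Tm..Tp} \<longrightarrow>
      (\<forall>a b. is_solution \<kappa>\<^sub>a \<kappa>\<^sub>b a\<^sub>0 va\<^sub>0 Tm Tp b\<^sub>0 a b \<longrightarrow>
        (let \<sigma> = sigma_seq Tm Tp a b; \<tau> = tau_seq Tm Tp a b in
          (\<forall>k\<ge>1. times_differentiable_at (2 * k) a (\<sigma> k)) \<and>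
          (\<forall>k. times_differentiable_at (2 * k + 1) b (\<tau> k)) \<and>
          (\<forall>k. Ck_on (2 + n + 2 * k) a {\<sigma> k<..<\<sigma> (Suc k)} \<and>
               Ck_on (3 + n + 2 * k) b {\<tau> k<..<\<tau> (Suc k)}))))"
proof (intro conjI allI impI)
  have \<kappa>: "\<kappa>\<^sub>a > 0" "\<kappa>\<^sub>b > 0" using assms(1-5) by simp_all
  obtain W gb where "cauchy_data W Tp (a\<^sub>0 - b\<^sub>0 0) \<kappa>\<^sub>a \<kappa>\<^sub>b Tm a\<^sub>0 va\<^sub>0 b\<^sub>0 gb"
    using cauchy_data_of_strip[OF \<kappa> assms(6-12)] by blast
  then show "\<exists>a b. is_solution \<kappa>\<^sub>a \<kappa>\<^sub>b a\<^sub>0 va\<^sub>0 Tm Tp b\<^sub>0 a b" by (rule cauchy_data.solution_exists)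
next
  fix n a b
  assume b0: "Ck_on (1 + n) b\<^sub>0 {Tm..Tp}" and "is_solution \<kappa>\<^sub>a \<kappa>\<^sub>b a\<^sub>0 va\<^sub>0 Tm Tp b\<^sub>0 a b"
  then interpret solution \<kappa>\<^sub>a \<kappa>\<^sub>b a\<^sub>0 va\<^sub>0 Tm Tp b\<^sub>0 a b
    using assms(7-11) by unfold_locales auto
  show "let \<sigma> = sigma_seq Tm Tp a b; \<tau> = tau_seq Tm Tp a b in
          (\<forall>k\<ge>1. times_differentiable_at (2 * k) a (\<sigma> k)) \<and>
          (\<forall>k. times_differentiable_at (2 * k + 1) b (\<tau> k)) \<and>
          (\<forall>k. Ck_on (2 + n + 2 * k) a {\<sigma> k<..<\<sigma> (Suc k)} \<and>
               Ck_on (3 + n + 2 * k) b {\<tau> k<..<\<tau> (Suc k)})"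
    unfolding Let_def using node_regularity interval_regularity[OF b0] by blast
qed

end
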